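(* Let $N\ge1$, $p=p_F:=1+2/N$ and $0<\epsilon<N/2$, and let $$f_\epsilon(x):=|x|^{-N}\,\big|\log|x|\big|^{-\frac N2-1+\epsilon}\,\chi_{B(0;e^{-3/2})}(x),\qquad x\in\mathbf{R}^N\setminus\{0\}.$$ Then there exist positive constants $C_1\le C_2$ such that, for each $\kappa>0$, there is $\alpha(\kappa,\epsilon)\in(0,1)$ such that for all $\alpha$ with $\alpha(\kappa,\epsilon)<\alpha<1$, $$C_1\,\kappa^{\frac{2}{N-2\epsilon}}(1-\alpha)^{-\frac{N}{N-2\epsilon}}\le-\log\left(T_\alpha[\kappa f_\epsilon]\right)\le C_2\,\kappa^{\frac{2}{N-2\epsilon}}(1-\alpha)^{-\frac{N}{N-2\epsilon}},$$ where $T_\alpha[\mu]$ denotes the life span of solutions of the problem $$(\mathrm{P})_\alpha:\qquad {}^{C}\partial_t^\alpha u-\Delta u=u^p\quad (t>0,\ x\in\mathbf{R}^N),\qquad u(0)=\mu\ \text{ in }\mathbf{R}^N.$$ In particular, $\lim_{\alpha\to1-0}T_\alpha[\kappa f_\epsilon]=0$ for all $\kappa>0$.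
   Context: $B(z;r):=\{y\in\mathbf{R}^N;\ |z-y|<r\}$ and $\chi_A$ is the characteristic function of $A$. For $t>0$, $x\in\mathbf{R}^N$, $G(t,x):=(4\pi t)^{-N/2}\exp(-|x|^2/(4t))$, and for a Radon measure $\mu$ on $\mathbf{R}^N$, $e^{t\Delta}\mu(x):=\int_{\mathbf{R}^N}G(t,x-y)\,d\mu(y)$. A locally integrable function $\phi$ is identified with the Radon measure $\phi\,dx$. For $\alpha\in(0,1)$, $h_\alpha>0$ denotes the probability density function on $(0,\infty)$ characterized by $$\int_0^\infty h_\alpha(\theta)e^{z\theta}\,d\theta=E_{\alpha,1}(z),\qquad z\in\mathbf{C},\qquad\text{where } E_{\alpha,\beta}(z):=\sum_{k=0}^\infty\frac{z^k}{\Gamma(\alpha k+\beta)}$$ is the Mittag--Leffler function. It also satisfies $\int_0^\infty\alpha\theta h_\alpha(\theta)e^{z\theta}\,d\theta=E_{\alpha,\alpha}(z)$ for $z\in\mathbf{C}$ and $\int_0^\infty\theta^\delta h_\alpha(\theta)\,d\theta=\Gamma(1+\delta)/\Gamma(1+\alpha\delta)<\infty$ for $\delta>-1$. Set, for $t>0$, $$P_\alpha(t)\mu:=\int_0^\infty h_\alpha(\theta)\,e^{t^\alpha\theta\Delta}\mu\,d\theta,\qquad S_\alpha(t)\mu:=\int_0^\infty\theta h_\alpha(\theta)\,e^{t^\alpha\theta\Delta}\mu\,d\theta.$$ Here ${}^{C}\partial_t^\alpha$ is the Caputo derivative of order $\alpha$, $({}^{C}\partial_t^\alpha f)(t)=\frac{1}{\Gamma(1-\alpha)}\frac{d}{dt}\int_0^t\frac{f(s)-f(0)}{(t-s)^\alpha}\,ds$,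 but solutions are understood in the following integral sense. Definition of solution: for $T\in(0,\infty]$ and a nonnegative Radon measure $\mu$, a nonnegative measurable function $u$ on $(0,T)\times\mathbf{R}^N$ is a solution of $(\mathrm{P})_\alpha$ in $[0,T)\times\mathbf{R}^N$ if $$\infty>u(t,x)=[P_\alpha(t)\mu](x)+\alpha\int_0^t(t-s)^{\alpha-1}[S_\alpha(t-s)u(s)^p](x)\,ds$$ for almost all $t\in(0,T)$ and $x\in\mathbf{R}^N$. It is a supersolution if this holds with $=$ replaced by $\ge$. Life span: it is known that if $(\mathrm{P})_\alpha$ possesses a supersolution in $[0,T)\times\mathbf{R}^N$, then it possesses a (unique) minimal solution $\overline u$ in $[0,T)\times\mathbf{R}^N$, i.e. a solution with $0\le\overline u\le v$ almost everywhere in $(0,T)\times\mathbf{R}^N$ for all solutions $v$ of $(\mathrm{P})_\alpha$ in $[0,T)\times\mathbf{R}^N$. The life span is $$T_\alpha[\mu]:=\sup\{T'>0;\ \text{the minimal solution of }(\mathrm{P})_\alpha\text{ exists in }[0,T')\times\mathbf{R}^N\}.$$ *)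

theory Defs
  imports "HOL-Analysis.Analysis"
begin

text \<open>Dimension-dependent notions are stated for an arbitrary Euclidean space \<^typ>\<open>'a\<close>,
  with \<open>N = DIM('a)\<close>. Integrals of nonnegative quantities are taken in \<^typ>\<open>ennreal\<close>, so they
  always make sense and may be infinite.\<close>

definition heat_kernel :: "real \<Rightarrow> 'a::euclidean_space \<Rightarrow> real" where
  "heat_kernel t x =
     (4 * pi * t) powr (- (real DIM('a) / 2)) * exp (- ((norm x)\<^sup>2 / (4 * t)))"

definition heat_semigroup :: "real \<Rightarrow> 'a::euclidean_space measure \<Rightarrow> 'a \<Rightarrow> ennreal" where
  "heat_semigroup t \<mu> x = (\<integral>\<^sup>+ y. ennreal (heat_kernel t (x - y)) \<partial>\<mu>)"

text \<open>On a Euclidean space every locally finite Borel measure is automatically regular.\<close>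

definition radon_measure :: "'a::euclidean_space measure \<Rightarrow> bool" where
  "radon_measure \<mu> \<longleftrightarrow>
     sets \<mu> = sets borel \<and> (\<forall>K. compact K \<longrightarrow> emeasure \<mu> K < \<infinity>)"

definition fun_measure :: "('a::euclidean_space \<Rightarrow> real) \<Rightarrow> 'a measure" where
  "fun_measure \<phi> = density lborel (\<lambda>x. ennreal (\<phi> x))"

definition mittag_leffler :: "real \<Rightarrow> real \<Rightarrow> complex \<Rightarrow> complex" where
  "mittag_leffler \<alpha> \<beta> z = (\<Sum>k. z ^ k / complex_of_real (Gamma (\<alpha> * real k + \<beta>)))"

definition is_subordination_density :: "real \<Rightarrow> (real \<Rightarrow> real) \<Rightarrow> bool" where
  "is_subordination_density \<alpha> h \<longleftrightarrow>
     h \<in> borel_measurable borel \<and>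
     (\<forall>\<theta>>0. 0 < h \<theta>) \<and>
     (\<integral>\<^sup>+ \<theta>\<in>{0<..}. ennreal (h \<theta>) \<partial>lborel) = 1 \<and>
     (\<forall>z::complex.
        set_integrable lborel {0<..} (\<lambda>\<theta>. complex_of_real (h \<theta>) * exp (z * complex_of_real \<theta>)) \<and>
        (LINT \<theta>:{0<..}|lborel. complex_of_real (h \<theta>) * exp (z * complex_of_real \<theta>))
          = mittag_leffler \<alpha> 1 z)"

text \<open>The characterization determines the density up to a null set; only integrals against it
  are used below, so the choice of representative is immaterial.\<close>

definition subordination_density :: "real \<Rightarrow> real \<Rightarrow> real" where
  "subordination_density \<alpha> = (SOME h. is_subordination_density \<alpha> h)"

definition P_op :: "real \<Rightarrow> real \<Rightarrow> 'a::euclidean_space measure \<Rightarrow> 'a \<Rightarrow> ennreal" where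
  "P_op \<alpha> t \<mu> x =
     (\<integral>\<^sup>+ \<theta>\<in>{0<..}. ennreal (subordination_density \<alpha> \<theta>)
                     * heat_semigroup (t powr \<alpha> * \<theta>) \<mu> x \<partial>lborel)"

definition S_op :: "real \<Rightarrow> real \<Rightarrow> 'a::euclidean_space measure \<Rightarrow> 'a \<Rightarrow> ennreal" where
  "S_op \<alpha> t \<mu> x =
     (\<integral>\<^sup>+ \<theta>\<in>{0<..}. ennreal (\<theta> * subordination_density \<alpha> \<theta>)
                     * heat_semigroup (t powr \<alpha> * \<theta>) \<mu> x \<partial>lborel)"

definition cylinder :: "ennreal \<Rightarrow> (real \<times> 'a::euclidean_space) set" where
  "cylinder T = {t. 0 < t \<and> ennreal t < T} \<times> UNIV"

text \<open>Solutions are finite almost everywhere, hence they are represented by real-valued functions;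
  the equation, which holds in \<^typ>\<open>ennreal\<close>, forces its right-hand side to be finite.
  Measurability is Borel measurability, which loses nothing, as functions are considered only
  up to null sets.\<close>

definition is_solution ::
  "real \<Rightarrow> real \<Rightarrow> ennreal \<Rightarrow> 'a::euclidean_space measure \<Rightarrow> (real \<Rightarrow> 'a \<Rightarrow> real) \<Rightarrow> bool" where
  "is_solution \<alpha> p T \<mu> u \<longleftrightarrow>
     0 < T \<and> radon_measure \<mu> \<and>
     (\<lambda>(t, x). u t x) \<in> borel_measurable (restrict_space borel (cylinder T)) \<and>
     (\<forall>(t, x)\<in>cylinder T. 0 \<le> u t x) \<and>
     (AE (t, x) in lborel. (t, x) \<in> cylinder T \<longrightarrow>
        ennreal (u t x) =
          P_op \<alpha> t \<mu> x
          + ennreal \<alpha> * (\<integral>\<^sup>+ s\<in>{0<..<t}. ennreal ((t - s) powr (\<alpha> - 1))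
              * S_op \<alpha> (t - s) (fun_measure (\<lambda>y. u s y powr p)) x \<partial>lborel))"

definition is_minimal_solution ::
  "real \<Rightarrow> real \<Rightarrow> ennreal \<Rightarrow> 'a::euclidean_space measure \<Rightarrow> (real \<Rightarrow> 'a \<Rightarrow> real) \<Rightarrow> bool" where
  "is_minimal_solution \<alpha> p T \<mu> u \<longleftrightarrow>
     is_solution \<alpha> p T \<mu> u \<and>
     (\<forall>v. is_solution \<alpha> p T \<mu> v \<longrightarrow>
        (AE (t, x) in lborel. (t, x) \<in> cylinder T \<longrightarrow> u t x \<le> v t x))"

text \<open>Since \<open>Sup {} = 0\<close> in \<^typ>\<open>ennreal\<close>, the life span is \<open>0\<close> if there is no local solution.\<close>

definition life_span :: "real \<Rightarrow> real \<Rightarrow> 'a::euclidean_space measure \<Rightarrow> ennreal" where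
  "life_span \<alpha> p \<mu> = Sup {T. 0 < T \<and> (\<exists>u. is_minimal_solution \<alpha> p T \<mu> u)}"

text \<open>At the origin, where the singular function is not defined, this takes the value \<open>0\<close>.\<close>

definition f_eps :: "real \<Rightarrow> 'a::euclidean_space \<Rightarrow> real" where
  "f_eps \<epsilon> x =
     norm x powr (- real DIM('a)) * \<bar>ln (norm x)\<bar> powr (- (real DIM('a) / 2) - 1 + \<epsilon>)
       * indicator (ball 0 (exp (- 3 / 2))) x"

end

theory Submission
  imports Defs "HOL-Probability.Distributions" "HOL-Real_Asymp.Real_Asymp"
begin

text \<open>For \<open>\<alpha> < 1\<close> and the Fujita exponent the local mass decides solvability up to time \<open>T\<close>: the threshold for
  \<open>sup\<^sub>z \<mu>(B(z; T powr (\<alpha> / 2)))\<close> is of order \<open>(1 - \<alpha>) powr (N / 2)\<close>, since with \<open>M\<close> the mass the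
  nonlinear term is of relative size \<open>M powr (p - 1) * (\<integral>\<^sub>0\<^sup>t (t - s) powr (\<alpha> - 1) * s powr (- \<alpha>) ds)\<close>,
  and this Beta integral is of order \<open>1 / (1 - \<alpha>)\<close>. As \<open>f\<^sub>\<epsilon>\<close> has mass of order
  \<open>\<bar>ln \<sigma>\<bar> powr (- N / 2 + \<epsilon>)\<close> in \<open>B(0; \<sigma>)\<close>, the theorem follows by solving for \<open>T\<close>.

  Existence: the data is split at radius \<open>T powr (\<alpha> / 2)\<close>. The singular part generates Picard iterates \<open>u\<^sub>n\<close> with
  \<open>(\<integral>u\<^sub>n(t)\<^sup>p dx) \<le> A * t powr (- \<alpha>)\<close>, a bound that Minkowski's inequality reproduces when the mass is small; the bounded part
  is dominated by a constant. Nonexistence: the mass \<open>m(t)\<close> of a solution in \<open>B(0; t powr (\<alpha> / 2))\<close> satisfies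
  \<open>m(t) \<ge> c * t powr (\<alpha> - 1) * (\<integral>\<^sub>0\<^sup>t s powr (- \<alpha>) * m(s) powr p ds)\<close> by Jensen's inequality, which forces
  \<open>m = \<infinity>\<close> after a time \<open>\<sigma> powr (2 / \<alpha>) * exp (2 / (1 - \<alpha>))\<close> if \<open>m\<close> is initially too large.

  The constants must not depend on \<open>\<alpha>\<close>. This rests on bounds for the moments of \<open>h\<^sub>\<alpha>\<close>, which are read off from
  \<open>\<integral>h\<^sub>\<alpha>(\<theta>) exp (- l * \<theta>) d\<theta> \<le> 2 / l\<close>. That \<open>h\<^sub>\<alpha>\<close> exists at all is shown with Kanter's
  explicit formula for the stable subordinator.\<close>

section \<open>Existence of the subordination density\<close>

text \<open>\<open>subordination_density\<close> is a \<open>SOME\<close>-choice, so nothing can be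
  said about the operators before a density has been exhibited. Positivity and the Laplace transform
  on the real axis give moment bounds that stay bounded as \<open>a\<close> tends to 1. The iterates
  are measured by the integral of their \<open>p\<close>-th power rather than pointwise: data of
  small mass need not be bounded, and this integral is exactly the mass that enters the next Duhamel
  step. Solutions are real-valued and satisfy the equation only almost everywhere, while iterates
  and local masses may be infinite. Hence all estimates are made in \<open>ennreal\<close>, with a
  power \<open>epow\<close> that preserves \<open>top\<close>. The iteration then needs monotone
  convergence only, and existence reduces to finiteness of the limit almost everywhere. Since only
  \<open>a\<close> close to 1 matters, \<open>1 / 2 \<le> a\<close> may be assumed to make the other
  constants independent of \<open>a\<close>.\<close>

lemma sin_mult_pos:
  fixes a u :: real
  assumes "0 < a" "a < 1" "0 < u" "u < pi"
  shows "0 < sin (a * u)"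
proof (rule sin_gt_zero)
  show "0 < a * u" using assms by simp
  have "a * u < 1 * u" using assms by (intro mult_strict_right_mono) auto
  then show "a * u < pi" using assms by linarith
qed

text \<open>Kanter's representation: for \<open>U\<close> uniform on \<open>(0, pi)\<close> and \<open>E\<close> exponentially distributed, independent of \<open>U\<close>,
  the density sought is that of \<open>E powr (1 - a) * kanter_fun a U\<close>. Its moments come from the curve
  \<open>w = sin_ratio a u * cis u\<close>, along which \<open>(1 + w) ^ k * w powr (- a * k)\<close> is the real number \<open>kanter_fun a u ^ k\<close>.\<close>

definition sin_ratio :: "real \<Rightarrow> real \<Rightarrow> real" where
  "sin_ratio a u = sin (a * u) / sin ((1 - a) * u)"

definition kanter_fun :: "real \<Rightarrow> real \<Rightarrow> real" where
  "kanter_fun a u = sin u / (sin (a * u) powr a * sin ((1 - a) * u) powr (1 - a))"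

lemma sin_ratio_pos:
  assumes "0 < a" "a < 1" "0 < u" "u < pi"
  shows "0 < sin_ratio a u"
  using sin_mult_pos[of a u] sin_mult_pos[of "1 - a" u] assms by (simp add: sin_ratio_def)

lemma kanter_fun_pos:
  assumes "0 < a" "a < 1" "0 < u" "u < pi"
  shows "0 < kanter_fun a u"
  using sin_mult_pos[of a u] sin_mult_pos[of "1 - a" u] sin_gt_zero[of u] assms
  by (simp add: kanter_fun_def)

text \<open>The sine rule in the triangle \<open>0\<close>, \<open>1\<close>, \<open>1 + w\<close>:
  \<open>sin_ratio a u\<close> is the length of \<open>w\<close> for which \<open>1 + w\<close> has
  argument \<open>a * u\<close>.\<close>

lemma one_plus_sin_ratio_cis:
  assumes "0 < a" "a < 1" "0 < u" "u < pi"
  shows "1 + of_real (sin_ratio a u) * cis u = of_real (sin u / sin ((1 - a) * u)) * cis (a * u)"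
proof -
  have s: "sin ((1 - a) * u) > 0" using assms by (intro sin_mult_pos) auto
  have 1: "sin ((1 - a) * u) + sin (a * u) * cos u = sin u * cos (a * u)"
    by (simp add: left_diff_distrib sin_diff)
  show ?thesis
    using s 1 by (simp add: complex_eq_iff sin_ratio_def field_simps)
qed

text \<open>Binomial theorem for \<open>(1 + w) ^ k\<close>, multiplied by
  \<open>w powr (- a * k)\<close>, whose phase \<open>- a * k * u\<close> cancels that of
  \<open>(1 + w) ^ k\<close>. The vanishing imaginary part is as useful as the real part: it removes
  the radial derivative in the integration below.\<close>

lemma kanter_power_expansion:
  fixes k :: nat
  assumes "0 < a" "a < 1" "0 < u" "u < pi"
  shows "(\<Sum>j\<le>k. of_nat (k choose j) * (of_real (sin_ratio a u powr (real j - a * k)) * cis ((real j - a * k) * u)))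
    = of_real (kanter_fun a u ^ k)"
proof -
  define r where "r = sin_ratio a u"
  have r: "r > 0" using sin_ratio_pos assms by (simp add: r_def)
  have s: "sin ((1 - a) * u) > 0" "sin (a * u) > 0" using assms by (auto intro!: sin_mult_pos)
  have "(\<Sum>j\<le>k. of_nat (k choose j) * (of_real (r powr (real j - a * k)) * cis ((real j - a * k) * u)))
     = (\<Sum>j\<le>k. of_nat (k choose j) * (of_real r * cis u) ^ j) * (of_real (r powr (- a * k)) * cis (- a * k * u))"
    unfolding sum_distrib_right
  proof (rule sum.cong, simp)
    fix j assume "j \<in> {..k}"
    have "r powr (real j - a * k) = r ^ j * r powr (- a * k)"
      using r by (simp add: powr_diff powr_minus powr_realpow field_simps)
    moreover have "cis ((real j - a * k) * u) = cis u ^ j * cis (- a * k * u)"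
    proof -
      have "cis u ^ j * cis (- a * k * u) = cis (real j * u + (- a * k * u))"
        using Complex.DeMoivre[of u j] cis_mult[of "real j * u" "- a * k * u"] by simp
      also have "real j * u + (- a * k * u) = (real j - a * k) * u" by (simp add: algebra_simps)
      finally show ?thesis ..
    qed
    ultimately show "of_nat (k choose j) * (of_real (r powr (real j - a * k)) * cis ((real j - a * k) * u))
      = of_nat (k choose j) * (of_real r * cis u) ^ j * (of_real (r powr (- a * k)) * cis (- a * k * u))"
      by (simp add: power_mult_distrib)
  qed
  also have "(\<Sum>j\<le>k. of_nat (k choose j) * (of_real r * cis u) ^ j) = (of_real r * cis u + 1) ^ k"
    by (subst binomial_ring) simp
  also have "of_real r * cis u + 1 = of_real (sin u / sin ((1 - a) * u)) * cis (a * u)"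
    using one_plus_sin_ratio_cis[OF assms] by (simp add: r_def add.commute)
  also have "(of_real (sin u / sin ((1 - a) * u)) * cis (a * u)) ^ k * (of_real (r powr (- a * k)) * cis (- a * k * u))
    = of_real ((sin u / sin ((1 - a) * u)) ^ k * r powr (- a * k)) * (cis (a * u) ^ k * cis (- a * k * u))"
    by (simp only: power_mult_distrib of_real_mult of_real_power mult_ac)
  also have "cis (a * u) ^ k * cis (- a * k * u) = 1"
    by (simp add: Complex.DeMoivre cis_mult algebra_simps)
  also have "(sin u / sin ((1 - a) * u)) ^ k * r powr (- a * k) = (sin u / sin ((1 - a) * u) * r powr (- a)) ^ k"
  proof -
    have "r powr (- a * k) = (r powr (- a)) ^ k" using r by (simp add: powr_realpow[symmetric] powr_powr)
    then show ?thesis by (simp only: power_mult_distrib)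
  qed
  also have "sin u / sin ((1 - a) * u) * r powr (- a) = kanter_fun a u"
    using s by (simp add: r_def sin_ratio_def kanter_fun_def powr_diff powr_minus powr_divide field_simps)
  finally show ?thesis by (simp add: r_def)
qed

lemma kanter_power_cos_sum:
  fixes k :: nat
  assumes "0 < a" "a < 1" "0 < u" "u < pi"
  shows "(\<Sum>j\<le>k. real (k choose j) * (sin_ratio a u powr (real j - a * k) * cos ((real j - a * k) * u)))
    = kanter_fun a u ^ k"
  using arg_cong[OF kanter_power_expansion[OF assms], of Re] by (simp add: Re_sum)

lemma kanter_power_sin_sum:
  fixes k :: nat
  assumes "0 < a" "a < 1" "0 < u" "u < pi"
  shows "(\<Sum>j\<le>k. real (k choose j) * (sin_ratio a u powr (real j - a * k) * sin ((real j - a * k) * u))) = 0"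
  using arg_cong[OF kanter_power_expansion[OF assms], of Im] by (simp add: Im_sum)

text \<open>The imaginary part of the primitive \<open>w powr g / g\<close> (or \<open>ln w\<close>, if \<open>g = 0\<close>) of \<open>w powr (g - 1)\<close> along this curve.\<close>

definition wave_prim :: "real \<Rightarrow> real \<Rightarrow> real \<Rightarrow> real" where
  "wave_prim a g u = (if g = 0 then u else sin_ratio a u powr g * sin (g * u) / g)"

text \<open>Along the curve, \<open>w' = (i + r' / r) * w\<close> with
  \<open>r = sin_ratio a u\<close>. The term with \<open>r'\<close> stays an unevaluated
  \<open>deriv\<close>, because it drops out after summation by
  \<open>kanter_power_sin_sum\<close>.\<close>

lemma DERIV_wave_prim:
  assumes "0 < a" "a < 1" "0 < u" "u < pi"
  shows "(wave_prim a g has_real_derivative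
     sin_ratio a u powr g * cos (g * u) + deriv (sin_ratio a) u / sin_ratio a u * (sin_ratio a u powr g * sin (g * u))) (at u)"
proof -
  have s: "sin ((1 - a) * u) > 0" using assms by (intro sin_mult_pos) auto
  have r: "sin_ratio a u > 0" using sin_ratio_pos assms by simp
  have "(sin_ratio a has_real_derivative (cos (a * u) * a * sin ((1 - a) * u) - sin (a * u) * (cos ((1 - a) * u) * (1 - a)))
      / (sin ((1 - a) * u) * sin ((1 - a) * u))) (at u)"
    unfolding sin_ratio_def using s by (auto intro!: derivative_eq_intros)
  then have d: "(sin_ratio a has_real_derivative deriv (sin_ratio a) u) (at u)"
    by (simp add: DERIV_imp_deriv)
  show ?thesis
  proof (cases "g = 0")
    case True
    then have "wave_prim a g = (\<lambda>u. u)" by (auto simp: wave_prim_def)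
    then show ?thesis using True r by simp
  next
    case False
    have eq: "wave_prim a g = (\<lambda>u. sin_ratio a u powr g * sin (g * u) / g)" using False by (auto simp: wave_prim_def)
    have "((\<lambda>u. sin_ratio a u powr g) has_real_derivative g * sin_ratio a u powr (g - of_nat 1) * deriv (sin_ratio a) u) (at u)"
      by (rule DERIV_fun_powr[OF d r])
    moreover have "((\<lambda>u. sin (g * u)) has_real_derivative cos (g * u) * g) (at u)"
      by (auto intro!: derivative_eq_intros)
    ultimately have "(wave_prim a g has_real_derivative (g * sin_ratio a u powr (g - of_nat 1) * deriv (sin_ratio a) u * sin (g * u)
        + cos (g * u) * g * sin_ratio a u powr g) / g) (at u)"
      unfolding eq by (intro DERIV_cdivide DERIV_mult)
    moreover have "sin_ratio a u powr (g - of_nat 1) = sin_ratio a u powr g / sin_ratio a u"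
      using r by (simp add: powr_diff)
    moreover have "(g * (p / r) * d * s + c * g * p) / g = p * c + d / r * (p * s)" for p r d s c :: real
      using False by (simp add: field_simps)
    ultimately show ?thesis by simp
  qed
qed

lemma sin_ratio_tendsto_0:
  assumes "0 < a" "a < 1"
  shows "(sin_ratio a \<longlongrightarrow> a / (1 - a)) (at_right 0)"
proof -
  have "(sin_ratio a \<longlongrightarrow> a * inverse (1 - a)) (at_right 0)"
    unfolding sin_ratio_def using assms by real_asymp
  then show ?thesis by (simp add: divide_inverse)
qed

lemma wave_prim_tendsto_0:
  assumes "0 < a" "a < 1"
  shows "(wave_prim a g \<longlongrightarrow> 0) (at_right 0)"
proof (cases "g = 0")
  case True
  then have "wave_prim a g = (\<lambda>u. u)" by (auto simp: wave_prim_def)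
  then show ?thesis by (simp add: tendsto_ident_at)
next
  case False
  have eq: "wave_prim a g = (\<lambda>u. sin_ratio a u powr g * sin (g * u) / g)" using False by (auto simp: wave_prim_def)
  have "((\<lambda>u. sin_ratio a u powr g * sin (g * u) / g) \<longlongrightarrow> (a / (1 - a)) powr g * sin (g * 0) / g) (at_right 0)"
    using assms False by (intro tendsto_intros sin_ratio_tendsto_0) auto
  then show ?thesis by (simp add: eq)
qed

text \<open>\<open>sin ((1 - a) * pi) = sin (a * pi)\<close>, so the ratio tends to 1, the curve
  ends at \<open>w = - 1\<close>, and the limit depends on \<open>g\<close> alone.\<close>

lemma wave_prim_tendsto_pi:
  assumes "0 < a" "a < 1"
  shows "(wave_prim a g \<longlongrightarrow> (if g = 0 then pi else sin (g * pi) / g)) (at_left pi)"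
proof (cases "g = 0")
  case True
  then have "wave_prim a g = (\<lambda>u. u)" by (auto simp: wave_prim_def)
  then show ?thesis using True by (simp add: tendsto_ident_at)
next
  case False
  have eq: "wave_prim a g = (\<lambda>u. (sin (a * u) / sin ((1 - a) * u)) powr g * sin (g * u) / g)" using False by (auto simp: wave_prim_def sin_ratio_def)
  have a1: "sin ((1 - a) * pi) = sin (a * pi)" by (simp add: left_diff_distrib sin_diff)
  have a2: "sin (a * pi) > 0"
    using assms by (intro sin_gt_zero) auto
  have "((\<lambda>u. (sin (a * u) / sin ((1 - a) * u)) powr g * sin (g * u) / g) \<longlongrightarrow> (sin (a * pi) / sin ((1 - a) * pi)) powr g * sin (g * pi) / g) (at_left pi)"
    using assms False a1 a2 by (intro tendsto_intros) auto
  then show ?thesis using a1 a2 False by (simp add: eq)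
qed

text \<open>Partial fractions of \<open>k! / (x * (x + 1) * ... * (x + k))\<close>. By Pascal's rule
  the sum for \<open>Suc k\<close> is the difference of the sums for \<open>k\<close> at
  \<open>x\<close> and at \<open>x + 1\<close>.\<close>

lemma alternating_binomial_partial_fraction:
  fixes x :: real
  assumes "\<And>i. i \<le> k \<Longrightarrow> x + real i \<noteq> 0"
  shows "(\<Sum>j\<le>k. (-1) ^ j * real (k choose j) / (x + real j)) = fact k / pochhammer x (Suc k)"
  using assms
proof (induction k arbitrary: x)
  case 0
  then show ?case by simp
next
  case (Suc k)
  have nz: "x \<noteq> 0" "x + 1 + real k \<noteq> 0" using Suc.prems[of 0] Suc.prems[of "Suc k"] by (auto simp: ac_simps)
  have pz: "pochhammer (x + 1) k \<noteq> 0"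
  proof
    assume "pochhammer (x + 1) k = 0"
    then obtain i where "i < k" "x + 1 = - real i" by (auto simp: pochhammer_eq_0_iff)
    then show False using Suc.prems[of "Suc i"] by simp
  qed
  have "(\<Sum>j\<le>Suc k. (-1) ^ j * real (Suc k choose j) / (x + real j))
     = 1 / x + (\<Sum>j\<le>k. (-1) ^ Suc j * (real (k choose j) + real (k choose Suc j)) / (x + real (Suc j)))"
    by (subst sum.atMost_Suc_shift) simp
  also have "\<dots> = (1 / x + (\<Sum>j\<le>k. (-1) ^ Suc j * real (k choose Suc j) / (x + real (Suc j))))
      - (\<Sum>j\<le>k. (-1) ^ j * real (k choose j) / (x + 1 + real j))"
  proof -
    have "(\<Sum>j\<le>k. (-1) ^ Suc j * (real (k choose j) + real (k choose Suc j)) / (x + real (Suc j)))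
      = (\<Sum>j\<le>k. (-1) ^ Suc j * real (k choose Suc j) / (x + real (Suc j)) - (-1) ^ j * real (k choose j) / (x + 1 + real j))"
    proof (intro sum.cong refl)
      fix j
      have "x + 1 + real j = x + real (Suc j)" by simp
      then show "(-1) ^ Suc j * (real (k choose j) + real (k choose Suc j)) / (x + real (Suc j))
        = (-1) ^ Suc j * real (k choose Suc j) / (x + real (Suc j)) - (-1) ^ j * real (k choose j) / (x + 1 + real j)"
        by (simp only: ring_distribs add_divide_distrib power_Suc)
    qed
    then show ?thesis by (simp only: sum_subtractf)
  qed
  also have "1 / x + (\<Sum>j\<le>k. (-1) ^ Suc j * real (k choose Suc j) / (x + real (Suc j)))
     = (\<Sum>j\<le>Suc k. (-1) ^ j * real (k choose j) / (x + real j))"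
    by (subst sum.atMost_Suc_shift) simp
  also have "\<dots> = (\<Sum>j\<le>k. (-1) ^ j * real (k choose j) / (x + real j))" by simp
  also have "\<dots> = fact k / pochhammer x (Suc k)"
    by (rule Suc.IH) (use Suc.prems in auto)
  also have "(\<Sum>j\<le>k. (-1) ^ j * real (k choose j) / (x + 1 + real j)) = fact k / pochhammer (x + 1) (Suc k)"
  proof (rule Suc.IH)
    fix i assume "i \<le> k"
    then show "x + 1 + real i \<noteq> 0" using Suc.prems[of "Suc i"] by (simp add: ac_simps)
  qed
  also have "fact k / pochhammer x (Suc k) - fact k / pochhammer (x + 1) (Suc k) = fact (Suc k) / pochhammer x (Suc (Suc k))"
  proof -
    have e1: "pochhammer x (Suc k) = x * pochhammer (x + 1) k" by (rule pochhammer_rec)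
    have e2: "pochhammer (x + 1) (Suc k) = pochhammer (x + 1) k * (x + 1 + real k)" by (rule pochhammer_Suc)
    have e3: "pochhammer x (Suc (Suc k)) = x * (pochhammer (x + 1) k * (x + 1 + real k))"
      by (subst pochhammer_rec, subst e2, rule refl)
    show ?thesis unfolding e1 e2 e3 using nz pz by (simp add: divide_simps) (simp add: algebra_simps)
  qed
  finally show ?case .
qed

lemma Gamma_reflection_real:
  "Gamma (x::real) * Gamma (1 - x) = pi / sin (pi * x)"
proof -
  have "complex_of_real (Gamma x * Gamma (1 - x)) = of_real (pi / sin (pi * x))"
    using Gamma_reflection_complex[of "of_real x"]
    unfolding of_real_mult of_real_divide sin_of_real[symmetric] Gamma_complex_of_real[symmetric] of_real_diff of_real_1 .
  then show ?thesis by (simp only: of_real_eq_iff)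
qed

text \<open>The right-hand side is \<open>pi\<close> times the binomial coefficient of
  \<open>k\<close> over the real number \<open>b\<close>. For integral \<open>b\<close> only the
  term \<open>j = b\<close> survives; otherwise \<open>sin ((real j - b) * pi)\<close> is
  \<open>(-1) ^ j\<close> times a constant, and partial fractions together with Euler's reflection
  formula apply.\<close>

lemma binomial_sinc_sum:
  fixes b :: real
  assumes "0 \<le> b" "b \<le> real k"
  shows "(\<Sum>j\<le>k. real (k choose j) * (if real j - b = 0 then pi else sin ((real j - b) * pi) / (real j - b)))
    = pi * fact k / (Gamma (b + 1) * Gamma (real k - b + 1))"
proof (cases "b \<in> \<int>")
  case True
  then obtain m :: int where m: "b = of_int m" by (elim Ints_cases)
  define n where "n = nat m"
  have n: "b = real n" using m assms by (simp add: n_def)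
  have nk: "n \<le> k" using assms n by simp
  have "real (k choose j) * (if real j - b = 0 then pi else sin ((real j - b) * pi) / (real j - b))
     = (if j = n then real (k choose n) * pi else 0)" for j
  proof (cases "j = n")
    case False
    have "sin ((real j - real n) * pi) = 0"
      by (simp add: sin_times_pi_eq_0)
    then show ?thesis using False n by simp
  qed (simp add: n)
  then have "(\<Sum>j\<le>k. real (k choose j) * (if real j - b = 0 then pi else sin ((real j - b) * pi) / (real j - b)))
    = real (k choose n) * pi" using nk by simp
  also have "\<dots> = pi * fact k / (fact n * fact (k - n))" using binomial_fact[OF nk, where 'a = real] by simp
  also have "Gamma (b + 1) = fact n" by (simp add: n Gamma_fact add.commute)
  moreover have "Gamma (real k - b + 1) = fact (k - n)"
    using nk Gamma_fact[of "k - n", where 'a = real] by (simp add: n of_nat_diff add.commute)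
  ultimately show ?thesis by simp
next
  case False
  have nz: "real j - b \<noteq> 0" for j using False by (metis Ints_of_nat eq_iff_diff_eq_0)
  have "real (k choose j) * (if real j - b = 0 then pi else sin ((real j - b) * pi) / (real j - b))
     = - sin (pi * b) * ((-1) ^ j * real (k choose j) / (- b + real j))" for j
    using nz by (simp add: left_diff_distrib sin_diff) (simp add: mult_ac)
  then have "(\<Sum>j\<le>k. real (k choose j) * (if real j - b = 0 then pi else sin ((real j - b) * pi) / (real j - b)))
    = - sin (pi * b) * (\<Sum>j\<le>k. (-1) ^ j * real (k choose j) / (- b + real j))"
    by (simp add: sum_distrib_left)
  also have "(\<Sum>j\<le>k. (-1) ^ j * real (k choose j) / (- b + real j)) = fact k / pochhammer (- b) (Suc k)"
    by (rule alternating_binomial_partial_fraction) (use nz in \<open>auto simp: algebra_simps\<close>)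
  also have "pochhammer (- b) (Suc k) = Gamma (- b + real (Suc k)) / Gamma (- b)"
    by (rule pochhammer_Gamma) (use False in \<open>auto dest!: subsetD[OF nonpos_Ints_subset_Ints]\<close>)
  also have "- sin (pi * b) * (fact k / (Gamma (- b + real (Suc k)) / Gamma (- b)))
     = pi * fact k / (Gamma (b + 1) * Gamma (real k - b + 1))"
  proof -
    have r: "Gamma (- b) * Gamma (1 + b) = - pi / sin (pi * b)"
      using Gamma_reflection_real[of "- b"] by simp
    have sn: "sin (pi * b) \<noteq> 0"
      using False by (metis sin_times_pi_eq_0 mult.commute)
    have gp: "Gamma (1 + b) > 0" using assms by (intro Gamma_real_pos) auto
    have gb: "Gamma (- b) = - pi / (sin (pi * b) * Gamma (1 + b))" using r gp sn by (simp add: field_simps)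
    show ?thesis unfolding gb using sn gp by (simp add: field_simps)
  qed
  finally show ?thesis .
qed

text \<open>The primitive \<open>F\<close> is the binomial sum of \<open>wave_prim\<close>; it tends
  to 0 at 0 and to \<open>binomial_sinc_sum\<close> with \<open>b = a * k\<close> at
  \<open>pi\<close>. The denominator \<open>Gamma ((1 - a) * k + 1)\<close> will be cancelled by the
  moment of the exponential variable.\<close>

lemma nn_integral_kanter_power:
  assumes a: "0 < a" "a < 1"
  shows "(\<integral>\<^sup>+u\<in>{0<..<pi}. ennreal (kanter_fun a u ^ k) \<partial>lborel)
    = ennreal (pi * fact k / (Gamma (a * k + 1) * Gamma ((1 - a) * k + 1)))"
proof -
  define F where "F u = (\<Sum>j\<le>k. real (k choose j) * wave_prim a (real j - a * k) u)" for u
  let ?v = "pi * fact k / (Gamma (a * k + 1) * Gamma ((1 - a) * k + 1))"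
  have F: "(F has_real_derivative kanter_fun a u ^ k) (at u)" if "0 < u" "u < pi" for u
  proof -
    have "(F has_real_derivative (\<Sum>j\<le>k. real (k choose j) * (sin_ratio a u powr (real j - a * k) * cos ((real j - a * k) * u)
       + deriv (sin_ratio a) u / sin_ratio a u * (sin_ratio a u powr (real j - a * k) * sin ((real j - a * k) * u))))) (at u)"
      unfolding F_def using that a by (intro derivative_intros DERIV_cmult DERIV_wave_prim) auto
    also have "(\<Sum>j\<le>k. real (k choose j) * (sin_ratio a u powr (real j - a * k) * cos ((real j - a * k) * u)
       + deriv (sin_ratio a) u / sin_ratio a u * (sin_ratio a u powr (real j - a * k) * sin ((real j - a * k) * u))))
      = (\<Sum>j\<le>k. real (k choose j) * (sin_ratio a u powr (real j - a * k) * cos ((real j - a * k) * u)))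
      + deriv (sin_ratio a) u / sin_ratio a u * (\<Sum>j\<le>k. real (k choose j) * (sin_ratio a u powr (real j - a * k) * sin ((real j - a * k) * u)))"
      unfolding sum_distrib_left sum.distrib[symmetric] by (intro sum.cong) (auto simp: algebra_simps)
    also have "\<dots> = kanter_fun a u ^ k"
      using that a by (simp add: kanter_power_cos_sum kanter_power_sin_sum)
    finally show ?thesis .
  qed
  have F0: "(F \<longlongrightarrow> (\<Sum>j\<le>k. real (k choose j) * 0)) (at_right 0)"
    unfolding F_def by (intro tendsto_intros wave_prim_tendsto_0 a)
  have Fpi: "(F \<longlongrightarrow> (\<Sum>j\<le>k. real (k choose j) * (if real j - a * k = 0 then pi else sin ((real j - a * k) * pi) / (real j - a * k)))) (at_left pi)"
    unfolding F_def by (intro tendsto_intros wave_prim_tendsto_pi a)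
  have v: "(\<Sum>j\<le>k. real (k choose j) * (if real j - a * k = 0 then pi else sin ((real j - a * k) * pi) / (real j - a * k))) = ?v"
    using binomial_sinc_sum[of "a * k" k] a by (simp add: mult_left_le_one_le algebra_simps)
  have c: "isCont (\<lambda>u. kanter_fun a u ^ k) u" if "0 < u" "u < pi" for u
    unfolding kanter_fun_def using sin_mult_pos[of a u] sin_mult_pos[of "1 - a" u] that a
    by (intro continuous_intros) auto
  have nn: "0 \<le> kanter_fun a u ^ k" if "0 < u" "u < pi" for u
    using kanter_fun_pos[of a u] that a by simp
  note ftc = interval_integral_FTC_nonneg[of "ereal 0" "ereal pi" F "\<lambda>u. kanter_fun a u ^ k" 0 ?v]
  have i: "set_integrable lborel (einterval (ereal 0) (ereal pi)) (\<lambda>u. kanter_fun a u ^ k)"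
    by (rule ftc(1)) (use F c nn F0 Fpi v in \<open>auto simp: ereal_tendsto_simps\<close>)
  have e: "(LBINT u=ereal 0..ereal pi. kanter_fun a u ^ k) = ?v - 0"
    by (rule ftc(2)) (use F c nn F0 Fpi v in \<open>auto simp: ereal_tendsto_simps\<close>)
  have "(\<integral>\<^sup>+u\<in>{0<..<pi}. ennreal (kanter_fun a u ^ k) \<partial>lborel)
     = (\<integral>\<^sup>+u. ennreal (indicator {0<..<pi} u *\<^sub>R (kanter_fun a u ^ k)) \<partial>lborel)"
    by (intro nn_integral_cong) (auto split: split_indicator)
  also have "\<dots> = ennreal (LINT u|lborel. indicator {0<..<pi} u *\<^sub>R (kanter_fun a u ^ k))"
    using i nn by (intro nn_integral_eq_integral) (auto simp: set_integrable_def split: split_indicator)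
  also have "(LINT u|lborel. indicator {0<..<pi} u *\<^sub>R (kanter_fun a u ^ k)) = ?v"
    using e by (simp add: interval_lebesgue_integral_def set_lebesgue_integral_def)
  finally show ?thesis .
qed

text \<open>Moment of \<open>E powr (1 / c) / B\<close> with \<open>E\<close> exponentially
  distributed: substituting \<open>(B * \<theta>) powr c\<close> gives the Gamma integral. In the
  application \<open>1 / c = 1 - a\<close> and \<open>1 / B = kanter_fun a u\<close>.\<close>

lemma nn_integral_weibull_moment:
  fixes c B :: real
  assumes c: "0 < c" and B: "0 < B"
  shows "(\<integral>\<^sup>+\<theta>\<in>{0<..}. ennreal (\<theta> ^ k * (c * B powr c * \<theta> powr (c - 1) * exp (- ((B * \<theta>) powr c)))) \<partial>lborel)
    = ennreal (Gamma (1 + k / c) / B ^ k)"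
proof -
  let ?g = "\<lambda>\<theta>. (B * \<theta>) powr c"
  let ?g' = "\<lambda>\<theta>. c * B powr c * \<theta> powr (c - 1)"
  let ?f = "\<lambda>x. x powr ((1 + k / c) - 1) / exp x"
  have G: "(?f has_integral Gamma (1 + k / c)) {0..}"
    using c by (intro Gamma_integral_real) (simp add: add_pos_nonneg)
  then have G: "(?f has_integral Gamma (1 + k / c)) {0<..}"
  proof (rule iffD1[OF has_integral_spike_set_eq, rotated 2])
    show "negligible {x \<in> {0..} - {0<..}. ?f x \<noteq> 0}" by (rule negligible_subset[of "{0}"]) auto
    have "{x \<in> {0<..} - {0..}. ?f x \<noteq> 0} = {}" by auto
    then show "negligible {x \<in> {0<..} - {0..}. ?f x \<noteq> 0}" by (simp only: negligible_empty)
  qed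
  then have ai: "?f absolutely_integrable_on {0<..}"
    by (intro nonnegative_absolutely_integrable_1) (auto simp: integrable_on_def)
  have der: "(?g has_field_derivative ?g' x) (at x within {0<..})" if "x \<in> {0<..}" for x
  proof -
    have "((\<lambda>\<theta>. B * \<theta>) has_real_derivative B) (at x)" by (auto intro!: derivative_eq_intros)
    then have "(?g has_real_derivative c * (B * x) powr (c - of_nat 1) * B) (at x)"
      using that B by (intro DERIV_fun_powr) auto
    moreover have "c * (B * x) powr (c - of_nat 1) * B = ?g' x"
      using that B by (simp add: powr_mult powr_diff)
    ultimately have "(?g has_real_derivative ?g' x) (at x)" by (simp only:)
    then show ?thesis by (rule has_field_derivative_at_within)
  qed
  have inj: "inj_on ?g {0<..}"
  proof (rule strict_mono_on_imp_inj_on, rule strict_mono_onI)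
    fix x y :: real assume "x \<in> {0<..}" "y \<in> {0<..}" "x < y"
    then show "?g x < ?g y" using B c by (intro powr_less_mono2) auto
  qed
  have img: "?g ` {0<..} = {0<..}"
  proof (intro set_eqI iffI)
    fix y :: real assume "y \<in> {0<..}"
    then have "y = ?g (y powr (1 / c) / B)" using B c by (simp add: powr_powr)
    moreover have "y powr (1 / c) / B \<in> {0<..}" using \<open>y \<in> {0<..}\<close> B by simp
    ultimately show "y \<in> ?g ` {0<..}" by blast
  qed (use B in auto)
  have "?f absolutely_integrable_on ?g ` {0<..} \<and> integral (?g ` {0<..}) ?f = Gamma (1 + k / c)"
    unfolding img using ai integral_unique[OF G] by (rule conjI)
  then have *: "(\<lambda>x. \<bar>?g' x\<bar> * ?f (?g x)) absolutely_integrable_on {0<..} \<and>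
      integral {0<..} (\<lambda>x. \<bar>?g' x\<bar> * ?f (?g x)) = Gamma (1 + k / c)"
    by (rule iffD2[OF has_absolute_integral_change_of_variables_1'[OF _ der inj], rotated -1]) simp_all
  have "((\<lambda>x. \<bar>?g' x\<bar> * ?f (?g x)) has_integral Gamma (1 + k / c)) {0<..}"
    using integrable_integral[OF set_lebesgue_integral_eq_integral(1)[OF conjunct1[OF *]]]
    unfolding conjunct2[OF *] .
  then have "((\<lambda>x. (\<bar>?g' x\<bar> * ?f (?g x)) / B ^ k) has_integral Gamma (1 + k / c) / B ^ k) {0<..}"
    by (rule has_integral_divide)
  then have "((\<lambda>\<theta>. \<theta> ^ k * (c * B powr c * \<theta> powr (c - 1) * exp (- ((B * \<theta>) powr c)))) has_integral Gamma (1 + k / c) / B ^ k) {0<..}"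
  proof (rule has_integral_eq[rotated])
    fix x :: real assume "x \<in> {0<..}"
    then have "((B * x) powr c) powr (k / c) = B ^ k * x ^ k"
      using B c by (simp add: powr_powr powr_realpow power_mult_distrib)
    then show "(\<bar>?g' x\<bar> * ?f (?g x)) / B ^ k = x ^ k * (c * B powr c * x powr (c - 1) * exp (- ((B * x) powr c)))"
      using B c by (simp add: exp_minus field_simps)
  qed
  from nn_integral_has_integral_lebesgue[OF _ this] B c
  have "(\<integral>\<^sup>+x. ennreal (indicator {0<..} x * (x ^ k * (c * B powr c * x powr (c - 1) * exp (- ((B * x) powr c))))) \<partial>lborel)
    = ennreal (Gamma (1 + k / c) / B ^ k)" by simp
  then show ?thesis
    by (subst (asm) nn_integral_cong[where v = "\<lambda>x. ennreal (x ^ k * (c * B powr c * x powr (c - 1) * exp (- ((B * x) powr c)))) * indicator {0<..} x"])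
       (auto split: split_indicator)
qed

text \<open>The Gamma integral restricted to \<open>{A..}\<close>, where \<open>t powr x\<close> is
  at least \<open>A powr x\<close>. As \<open>A\<close> is free, \<open>Gamma (a * k + 1)\<close>
  outgrows every geometric sequence in \<open>k\<close>.\<close>

lemma Gamma_plus1_ge:
  fixes x A :: real
  assumes "0 \<le> x" "0 < A"
  shows "A powr x * exp (- A) \<le> Gamma (x + 1)"
proof -
  have "ennreal (A powr x * exp (- A)) = (\<integral>\<^sup>+t. ennreal (A powr x * exp (- t)) * indicator {A..} t \<partial>lborel)"
  proof (subst nn_integral_FTC_atLeast[where F = "\<lambda>t. - (A powr x * exp (- t))" and T = 0])
    show "((\<lambda>t. - (A powr x * exp (- t))) \<longlongrightarrow> 0) at_top" by real_asymp
  qed (auto intro!: derivative_eq_intros)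
  also have "\<dots> \<le> (\<integral>\<^sup>+t. ennreal (indicator {0..} t * t powr ((x + 1) - 1) / exp t) \<partial>lborel)"
    using assms by (intro nn_integral_mono)
      (auto split: split_indicator intro!: ennreal_leI mult_right_mono powr_mono2 simp: exp_minus divide_inverse)
  also have "\<dots> = ennreal (Gamma (x + 1))"
    using assms by (subst Gamma_conv_nn_integral_real[symmetric]) auto
  finally show ?thesis
    by (subst (asm) ennreal_le_iff) (use assms in \<open>auto intro!: less_imp_le Gamma_real_pos\<close>)
qed

lemma summable_mittag_leffler:
  fixes a r :: real
  assumes "0 < a" "0 \<le> r"
  shows "summable (\<lambda>k. r ^ k / Gamma (a * real k + 1))"
proof (rule summable_comparison_test')
  \<comment> \<open>\<open>A powr a = 2 * r + 1\<close>, so \<open>r ^ k / A powr (a * k)\<close> is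
    at most \<open>(1 / 2) ^ k\<close>; the summand 1 keeps \<open>A\<close> positive for
    \<open>r = 0\<close>.\<close>
  define A where "A = (2 * r + 1) powr (1 / a)"
  have A: "A > 0" using assms by (simp add: A_def)
  show "summable (\<lambda>k. exp A * (1 / 2) ^ k)" by (intro summable_mult summable_geometric) auto
  fix k :: nat
  have "A powr (a * k) = (2 * r + 1) ^ k"
    using assms by (simp add: A_def powr_powr powr_realpow)
  with Gamma_plus1_ge[of "a * k" A] A assms have G: "(2 * r + 1) ^ k * exp (- A) \<le> Gamma (a * k + 1)" by simp
  have G0: "0 < Gamma (a * real k + 1)" using assms by (intro Gamma_real_pos) (simp add: add_nonneg_pos)
  have "r ^ k / Gamma (a * real k + 1) \<le> r ^ k / ((2 * r + 1) ^ k * exp (- A))"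
    using G G0 assms by (intro divide_left_mono) auto
  also have "\<dots> = exp A * (r / (2 * r + 1)) ^ k" by (simp add: exp_minus power_divide field_simps)
  also have "\<dots> \<le> exp A * (1 / 2) ^ k"
    using assms by (intro mult_left_mono power_mono) (auto simp: field_simps)
  finally show "norm (r ^ k / Gamma (a * real k + 1)) \<le> exp A * (1 / 2) ^ k"
    using G0 assms by simp
qed

text \<open>Termwise integration of the exponential series. It is legitimate for every complex
  \<open>z\<close>, because the moments divided by \<open>k!\<close> are the coefficients of the
  Mittag-Leffler series, which converges absolutely everywhere.\<close>

lemma is_subordination_density_if_moments:
  assumes a: "0 < a" and h[measurable]: "h \<in> borel_measurable borel" and pos: "\<And>\<theta>. 0 < \<theta> \<Longrightarrow> 0 < h \<theta>"
    and mom: "\<And>k. (\<integral>\<^sup>+\<theta>\<in>{0<..}. ennreal (\<theta> ^ k * h \<theta>) \<partial>lborel) = ennreal (fact k / Gamma (a * real k + 1))"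
  shows "is_subordination_density a h"
proof -
  have G0: "0 < Gamma (a * real k + 1)" for k using a by (intro Gamma_real_pos) (simp add: add_nonneg_pos)
  let ?m = "\<lambda>k \<theta>. indicator {0<..} \<theta> * (\<theta> ^ k * h \<theta>)"
  have mb: "has_bochner_integral lborel (?m k) (fact k / Gamma (a * real k + 1))" for k
  proof (rule has_bochner_integral_nn_integral)
    show "(\<integral>\<^sup>+x. ennreal (?m k x) \<partial>lborel) = ennreal (fact k / Gamma (a * real k + 1))"
      unfolding mom[symmetric] by (intro nn_integral_cong) (auto split: split_indicator)
    show "AE x in lborel. 0 \<le> ?m k x"
      by (auto split: split_indicator intro!: mult_nonneg_nonneg less_imp_le[OF pos])
  qed (use G0[of k] in auto)
  have main: "set_integrable lborel {0<..} (\<lambda>\<theta>. complex_of_real (h \<theta>) * exp (z * complex_of_real \<theta>)) \<and>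
        (LINT \<theta>:{0<..}|lborel. complex_of_real (h \<theta>) * exp (z * complex_of_real \<theta>)) = mittag_leffler a 1 z" for z
  proof -
    let ?f = "\<lambda>k \<theta>. (z ^ k / fact k) * complex_of_real (?m k \<theta>)"
    have fb: "has_bochner_integral lborel (?f k) (z ^ k / fact k * complex_of_real (fact k / Gamma (a * real k + 1)))" for k
      using mb by (intro has_bochner_integral_mult_right has_bochner_integral_of_real) auto
    have fv: "z ^ k / fact k * complex_of_real (fact k / Gamma (a * real k + 1)) = z ^ k / complex_of_real (Gamma (a * real k + 1))" for k
      by simp
    have nf: "norm (?f k \<theta>) = norm z ^ k / fact k * ?m k \<theta>" for k \<theta>
      using pos[of \<theta>] by (auto simp: norm_mult norm_divide norm_power split: split_indicator)
    have sf: "(\<lambda>k. ?f k \<theta>) sums (indicator {0<..} \<theta> *\<^sub>R (complex_of_real (h \<theta>) * exp (z * complex_of_real \<theta>)))" for \<theta>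
    proof -
      have "(\<lambda>k. (indicator {0<..} \<theta> *\<^sub>R complex_of_real (h \<theta>)) * ((z * complex_of_real \<theta>) ^ k /\<^sub>R fact k))
        sums ((indicator {0<..} \<theta> *\<^sub>R complex_of_real (h \<theta>)) * exp (z * complex_of_real \<theta>))"
        by (intro sums_mult exp_converges)
      then show ?thesis by (simp add: scaleR_conv_of_real power_mult_distrib divide_simps mult_ac)
    qed
    have i: "integrable lborel (?f k)" for k using fb[of k] by (rule integrable.intros)
    have s1: "AE \<theta> in lborel. summable (\<lambda>k. norm (?f k \<theta>))"
    proof (rule AE_I2)
      fix \<theta> :: real
      have "summable (\<lambda>k. (indicator {0<..} \<theta> * h \<theta>) * ((norm z * \<theta>) ^ k /\<^sub>R fact k))"
        by (intro summable_mult sums_summable[OF exp_converges])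
      then show "summable (\<lambda>k. norm (?f k \<theta>))" unfolding nf by (simp add: power_mult_distrib divide_simps mult_ac)
    qed
    have "(\<integral>\<theta>. norm (?f k \<theta>) \<partial>lborel) = norm z ^ k / Gamma (a * real k + 1)" for k
      unfolding nf using has_bochner_integral_integral_eq[OF mb[of k]] by simp
    then have s2: "summable (\<lambda>k. \<integral>\<theta>. norm (?f k \<theta>) \<partial>lborel)"
      using summable_mittag_leffler[OF a, of "norm z"] by simp
    have e: "(\<Sum>k. ?f k \<theta>) = indicator {0<..} \<theta> *\<^sub>R (complex_of_real (h \<theta>) * exp (z * complex_of_real \<theta>))" for \<theta>
      using sf by (rule sums_unique[symmetric])
    have "(\<Sum>k. integral\<^sup>L lborel (?f k)) = mittag_leffler a 1 z"
      unfolding mittag_leffler_def has_bochner_integral_integral_eq[OF fb] fv ..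
    then show ?thesis
      using integrable_suminf[OF i s1 s2] integral_suminf[OF i s1 s2]
      unfolding e set_integrable_def set_lebesgue_integral_def by simp
  qed
  have "(\<integral>\<^sup>+\<theta>\<in>{0<..}. ennreal (h \<theta>) \<partial>lborel) = 1"
    using mom[of 0] by simp
  with main pos show ?thesis unfolding is_subordination_density_def by auto
qed

text \<open>The joint density of \<open>E powr (1 - a) * kanter_fun a U\<close> and \<open>U\<close>.\<close>

definition kanter_density :: "real \<Rightarrow> real \<Rightarrow> real \<Rightarrow> real" where
  "kanter_density a \<theta> u = (1 / pi) * (1 / (1 - a) * (1 / kanter_fun a u) powr (1 / (1 - a)) * \<theta> powr (1 / (1 - a) - 1)
     * exp (- ((1 / kanter_fun a u * \<theta>) powr (1 / (1 - a)))))"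

lemma measurable_kanter_density[measurable]: "(\<lambda>(\<theta>, u). kanter_density a \<theta> u) \<in> borel_measurable (lborel \<Otimes>\<^sub>M lborel)"
  unfolding kanter_density_def kanter_fun_def by measurable

lemma kanter_density_pos:
  assumes "0 < a" "a < 1" "0 < u" "u < pi" "0 < \<theta>"
  shows "0 < kanter_density a \<theta> u"
  using kanter_fun_pos[OF assms(1-4)] assms by (simp add: kanter_density_def)

text \<open>\<open>x * exp (- x) \<le> 1\<close>. The bound does not depend on \<open>u\<close>, so
  the integral over \<open>u\<close> is finite for each \<open>\<theta>\<close> and can be taken as
  a real number; its growth in \<open>a\<close> is harmless for this purpose.\<close>

lemma kanter_density_le:
  assumes "0 < a" "a < 1" "0 < u" "u < pi" "0 < \<theta>"
  shows "kanter_density a \<theta> u \<le> 1 / (1 - a) / (pi * \<theta>)"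
proof -
  define c where "c = 1 / (1 - a)"
  define x where "x = (1 / kanter_fun a u * \<theta>) powr c"
  have "x * exp (- x) \<le> 1" using exp_ge_add_one_self[of x] by (simp add: exp_minus divide_simps, linarith?)
  then have "1 / (1 - a) / (pi * \<theta>) * (x * exp (- x)) \<le> 1 / (1 - a) / (pi * \<theta>) * 1"
    using assms by (intro mult_left_mono) auto
  moreover have "kanter_density a \<theta> u = 1 / (1 - a) / (pi * \<theta>) * (x * exp (- x))"
  proof -
    have "x = (1 / kanter_fun a u) powr c * \<theta> powr c"
      using assms kanter_fun_pos[OF assms(1-4)] by (simp add: x_def powr_mult powr_divide)
    moreover have "\<theta> powr (c - 1) = \<theta> powr c / \<theta>" using assms by (simp add: powr_diff)
    ultimately have "c / (pi * \<theta>) * (x * exp (- x)) = (1 / pi) * (c * (1 / kanter_fun a u) powr c * \<theta> powr (c - 1) * exp (- x))"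
      by simp
    then show ?thesis unfolding kanter_density_def c_def x_def by simp
  qed
  ultimately show ?thesis by simp
qed

text \<open>The marginal of \<open>kanter_density\<close> in \<open>\<theta>\<close>. Its moments
  are computed by integrating in \<open>\<theta>\<close> first and then in \<open>u\<close>: the
  Weibull moment gives \<open>Gamma (1 + (1 - a) * k)\<close>, which cancels one Gamma factor in the
  integral of \<open>kanter_fun a u ^ k\<close>.\<close>

theorem ex_is_subordination_density:
  assumes a: "0 < a" "a < 1"
  shows "\<exists>h. is_subordination_density a h"
proof
  define h where "h \<theta> = enn2real (\<integral>\<^sup>+u\<in>{0<..<pi}. ennreal (kanter_density a \<theta> u) \<partial>lborel)" for \<theta>
  have fin: "(\<integral>\<^sup>+u\<in>{0<..<pi}. ennreal (kanter_density a \<theta> u) \<partial>lborel) < \<infinity>" if "0 < \<theta>" for \<theta>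
  proof -
    have "(\<integral>\<^sup>+u\<in>{0<..<pi}. ennreal (kanter_density a \<theta> u) \<partial>lborel) \<le> (\<integral>\<^sup>+u\<in>{0<..<pi}. ennreal (1 / (1 - a) / (pi * \<theta>)) \<partial>lborel)"
      using that a by (intro nn_integral_mono) (auto split: split_indicator simp del: divide_divide_eq_left intro!: ennreal_leI kanter_density_le)
    also have "\<dots> < \<infinity>" by (simp add: nn_integral_cmult_indicator ennreal_mult_less_top)
    finally show ?thesis .
  qed
  have pos: "0 < h \<theta>" if "0 < \<theta>" for \<theta>
  proof -
    have "(\<integral>\<^sup>+u\<in>{0<..<pi}. ennreal (kanter_density a \<theta> u) \<partial>lborel) \<noteq> 0"
    proof
      assume "(\<integral>\<^sup>+u\<in>{0<..<pi}. ennreal (kanter_density a \<theta> u) \<partial>lborel) = 0"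
      then have "AE u in lborel. ennreal (kanter_density a \<theta> u) * indicator {0<..<pi} u = 0"
        by (subst (asm) nn_integral_0_iff_AE) auto
      then have "AE u in lborel. u \<notin> {0<..<pi}"
        by eventually_elim (use kanter_density_pos[OF a] that in \<open>fastforce split: split_indicator_asm\<close>)
      then have "emeasure lborel {0<..<pi} = 0"
        by (subst (asm) AE_iff_measurable[where N = "{0<..<pi}"]) auto
      then show False by simp
    qed
    with fin[OF that] show ?thesis unfolding h_def
      by (simp add: enn2real_positive_iff zero_less_iff_neq_zero)
  qed
  show "is_subordination_density a h"
  proof (rule is_subordination_density_if_moments[OF a(1) _ pos])
    show "h \<in> borel_measurable borel" unfolding h_def by measurable
    fix k :: nat
    have "(\<integral>\<^sup>+\<theta>\<in>{0<..}. ennreal (\<theta> ^ k * h \<theta>) \<partial>lborel)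
      = (\<integral>\<^sup>+\<theta>. (\<integral>\<^sup>+u. ennreal (\<theta> ^ k * kanter_density a \<theta> u) * indicator {0<..<pi} u * indicator {0<..} \<theta> \<partial>lborel) \<partial>lborel)"
    proof (rule nn_integral_cong)
      fix \<theta> :: real
      show "ennreal (\<theta> ^ k * h \<theta>) * indicator {0<..} \<theta>
        = (\<integral>\<^sup>+u. ennreal (\<theta> ^ k * kanter_density a \<theta> u) * indicator {0<..<pi} u * indicator {0<..} \<theta> \<partial>lborel)"
      proof (cases "0 < \<theta>")
        case True
        have "ennreal (\<theta> ^ k * h \<theta>) = ennreal (\<theta> ^ k) * (\<integral>\<^sup>+u\<in>{0<..<pi}. ennreal (kanter_density a \<theta> u) \<partial>lborel)"
          using True fin[OF True] by (simp add: h_def ennreal_mult)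
        also have "\<dots> = (\<integral>\<^sup>+u. ennreal (\<theta> ^ k * kanter_density a \<theta> u) * indicator {0<..<pi} u \<partial>lborel)"
          using True by (subst nn_integral_cmult[symmetric]) (auto intro!: nn_integral_cong simp: ennreal_mult' mult_ac)
        finally show ?thesis using True by simp
      qed simp
    qed
    also have "\<dots> = (\<integral>\<^sup>+u. (\<integral>\<^sup>+\<theta>. ennreal (\<theta> ^ k * kanter_density a \<theta> u) * indicator {0<..<pi} u * indicator {0<..} \<theta> \<partial>lborel) \<partial>lborel)"
      by (rule lborel_pair.Fubini'[symmetric]) measurable
    also have "\<dots> = (\<integral>\<^sup>+u. ennreal (Gamma (1 + (1 - a) * k) / pi) * (ennreal (kanter_fun a u ^ k) * indicator {0<..<pi} u) \<partial>lborel)"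
    proof (rule nn_integral_cong)
      fix u :: real
      show "(\<integral>\<^sup>+\<theta>. ennreal (\<theta> ^ k * kanter_density a \<theta> u) * indicator {0<..<pi} u * indicator {0<..} \<theta> \<partial>lborel)
        = ennreal (Gamma (1 + (1 - a) * k) / pi) * (ennreal (kanter_fun a u ^ k) * indicator {0<..<pi} u)"
      proof (cases "u \<in> {0<..<pi}")
        case True
        define B where "B = 1 / kanter_fun a u"
        have B: "B > 0" using True a kanter_fun_pos by (simp add: B_def)
        have "(\<integral>\<^sup>+\<theta>. ennreal (\<theta> ^ k * kanter_density a \<theta> u) * indicator {0<..<pi} u * indicator {0<..} \<theta> \<partial>lborel)
          = (\<integral>\<^sup>+\<theta>. ennreal (1 / pi) * (ennreal (\<theta> ^ k * (1 / (1 - a) * B powr (1 / (1 - a)) * \<theta> powr (1 / (1 - a) - 1)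
             * exp (- ((B * \<theta>) powr (1 / (1 - a)))))) * indicator {0<..} \<theta>) \<partial>lborel)"
          using True by (intro nn_integral_cong)
            (auto simp: kanter_density_def B_def[symmetric] ennreal_mult'[symmetric] split: split_indicator)
        also have "\<dots> = ennreal (1 / pi) * ennreal (Gamma (1 + k / (1 / (1 - a))) / B ^ k)"
          using a B by (subst nn_integral_cmult, measurable, subst nn_integral_weibull_moment) auto
        also have "\<dots> = ennreal (Gamma (1 + (1 - a) * k) / pi) * ennreal (kanter_fun a u ^ k)"
          using a kanter_fun_pos[of a u] True
          by (simp add: ennreal_mult'[symmetric] B_def power_divide mult_ac)
        finally show ?thesis using True by simp
      qed simp
    qed
    also have "\<dots> = ennreal (Gamma (1 + (1 - a) * k) / pi) * ennreal (pi * fact k / (Gamma (a * k + 1) * Gamma ((1 - a) * k + 1)))"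
    proof (subst nn_integral_cmult)
      show "(\<lambda>u. ennreal (kanter_fun a u ^ k) * indicator {0<..<pi} u) \<in> borel_measurable lborel"
        unfolding kanter_fun_def by measurable
    qed (simp add: nn_integral_kanter_power a)
    also have "\<dots> = ennreal (fact k / Gamma (a * k + 1))"
    proof -
      have "Gamma (1 + (1 - a) * k) > 0" using a by (intro Gamma_real_pos) (simp add: add_pos_nonneg)
      then show ?thesis by (simp add: ennreal_mult'[symmetric] add.commute)
    qed
    finally show "(\<integral>\<^sup>+\<theta>\<in>{0<..}. ennreal (\<theta> ^ k * h \<theta>) \<partial>lborel) = ennreal (fact k / Gamma (a * real k + 1))" .
  qed
qed

section \<open>Moments of the subordination density\<close>

lemma has_bochner_integral_Beta:
  fixes x y :: real
  assumes "0 < x" "0 < y"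
  shows "has_bochner_integral lborel (\<lambda>s. indicator {0<..<1} s * (s powr (x - 1) * (1 - s) powr (y - 1))) (Beta x y)"
proof (rule has_bochner_integral_nn_integral)
  have "((\<lambda>s. s powr (x - 1) * (1 - s) powr (y - 1)) has_integral Beta x y) {0<..<1}"
    using has_integral_Beta_real[OF assms] by (simp add: has_integral_Icc_iff_Ioo)
  from nn_integral_has_integral_lebesgue[OF _ this]
  show "(\<integral>\<^sup>+s. ennreal (indicator {0<..<1} s * (s powr (x - 1) * (1 - s) powr (y - 1))) \<partial>lborel) = ennreal (Beta x y)"
    by simp
  show "0 \<le> Beta x y" using assms by (auto simp: Beta_def intro!: divide_nonneg_pos mult_nonneg_nonneg less_imp_le Gamma_real_pos)
qed (auto split: split_indicator)

lemma bochner_integral_le: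
  fixes f g :: "real \<Rightarrow> real"
  assumes "has_bochner_integral lborel f x" "has_bochner_integral lborel g y" "\<And>t. f t \<le> g t"
  shows "x \<le> y"
  using integral_mono[of lborel f g] assms by (auto simp: has_bochner_integral_iff)

locale subordination =
  fixes a :: real and h :: "real \<Rightarrow> real"
  assumes a: "0 < a" "a < 1" and dens: "is_subordination_density a h"
begin

section \<open>The Laplace transform of the density\<close>

lemma h_measurable[measurable]: "h \<in> borel_measurable borel"
  and h_pos: "0 < \<theta> \<Longrightarrow> 0 < h \<theta>"
  and h_mass: "(\<integral>\<^sup>+\<theta>\<in>{0<..}. ennreal (h \<theta>) \<partial>lborel) = 1"
  using dens by (auto simp: is_subordination_density_def)

lemma Gamma_pos: "0 < Gamma (a * real k + 1)"
  using a by (intro Gamma_real_pos) (simp add: add_nonneg_pos)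

text \<open>The Mittag-Leffler function \<open>mittag_leffler a 1\<close> at \<open>- l\<close> as a
  real series; by \<open>nn_integral_laplace\<close> it is the Laplace transform of
  \<open>h\<close>.\<close>

definition phi :: "real \<Rightarrow> real" where
  "phi l = (\<Sum>k. (- l) ^ k / Gamma (a * real k + 1))"

lemma summable_phi: "summable (\<lambda>k. norm ((- l) ^ k / Gamma (a * real k + 1)))"
  using summable_mittag_leffler[of a "\<bar>l\<bar>"] a Gamma_pos
  by (simp add: abs_divide power_abs[symmetric] less_imp_le)

lemma nn_integral_laplace:
  "(\<integral>\<^sup>+\<theta>\<in>{0<..}. ennreal (h \<theta> * exp (- l * \<theta>)) \<partial>lborel) = ennreal (phi l)"
proof -
  let ?f = "\<lambda>\<theta>. indicator {0<..} \<theta> *\<^sub>R (h \<theta> * exp (- l * \<theta>))"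
  have 1: "indicator {0<..} \<theta> *\<^sub>R (complex_of_real (h \<theta>) * exp (complex_of_real (- l) * complex_of_real \<theta>)) = complex_of_real (?f \<theta>)" for \<theta>
    by (simp add: scaleR_conv_of_real exp_of_real[symmetric])
  have 2: "set_integrable lborel {0<..} (\<lambda>\<theta>. complex_of_real (h \<theta>) * exp (complex_of_real (- l) * complex_of_real \<theta>))"
    "(LINT \<theta>:{0<..}|lborel. complex_of_real (h \<theta>) * exp (complex_of_real (- l) * complex_of_real \<theta>)) = mittag_leffler a 1 (complex_of_real (- l))"
    using dens unfolding is_subordination_density_def by blast+
  have "integrable lborel (\<lambda>\<theta>. complex_of_real (?f \<theta>))"
    using 2(1) unfolding set_integrable_def 1 .
  from integrable_Re[OF this] have i: "integrable lborel ?f" by simp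
  have "mittag_leffler a 1 (complex_of_real (- l)) = complex_of_real (phi l)"
    using suminf_of_real[OF summable_norm_cancel[OF summable_phi[of l]], where 'a = complex]
    by (simp add: mittag_leffler_def phi_def)
  then have "complex_of_real (integral\<^sup>L lborel ?f) = complex_of_real (phi l)"
    using 2(2) unfolding set_lebesgue_integral_def 1 integral_complex_of_real by simp
  then have e: "integral\<^sup>L lborel ?f = phi l" by (simp only: of_real_eq_iff)
  have "(\<integral>\<^sup>+\<theta>. ennreal (?f \<theta>) \<partial>lborel) = ennreal (phi l)"
    unfolding e[symmetric] using i
    by (rule nn_integral_eq_integral) (auto split: split_indicator intro!: AE_I2 mult_nonneg_nonneg less_imp_le[OF h_pos])
  then show ?thesis
    by (subst (asm) nn_integral_cong[where v = "\<lambda>\<theta>. ennreal (h \<theta> * exp (- l * \<theta>)) * indicator {0<..} \<theta>"])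
       (auto split: split_indicator)
qed

lemma phi_0: "phi 0 = 1"
  unfolding phi_def by (subst suminf_finite[of "{0}"]) auto

text \<open>\<open>nn_integral_laplace\<close> does not exclude a negative value, which
  \<open>ennreal\<close> would turn into 0. In that case \<open>h\<close> would vanish almost
  everywhere on \<open>{0<..}\<close>, contrary to its mass 1.\<close>

lemma phi_nonneg: "0 \<le> phi l"
proof (rule ccontr)
  assume "\<not> 0 \<le> phi l"
  then have "(\<integral>\<^sup>+\<theta>\<in>{0<..}. ennreal (h \<theta> * exp (- l * \<theta>)) \<partial>lborel) = 0"
    unfolding nn_integral_laplace by (simp add: ennreal_neg)
  then have "AE \<theta> in lborel. ennreal (h \<theta> * exp (- l * \<theta>)) * indicator {0<..} \<theta> = 0"
    by (subst (asm) nn_integral_0_iff_AE) auto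
  then have "AE \<theta> in lborel. ennreal (h \<theta>) * indicator {0<..} \<theta> = 0"
    by eventually_elim (auto split: split_indicator simp: ennreal_eq_0_iff mult_le_0_iff)
  then have "(\<integral>\<^sup>+\<theta>\<in>{0<..}. ennreal (h \<theta>) \<partial>lborel) = 0"
    by (subst nn_integral_0_iff_AE) auto
  with h_mass show False by simp
qed

lemma phi_antimono:
  assumes "l \<le> m"
  shows "phi m \<le> phi l"
proof -
  have "ennreal (phi m) \<le> ennreal (phi l)"
    unfolding nn_integral_laplace[symmetric]
    by (intro nn_integral_mono) (use assms h_pos in \<open>auto split: split_indicator intro!: ennreal_leI mult_left_mono simp: less_imp_le\<close>)
  then show ?thesis using phi_nonneg by simp
qed

text \<open>\<open>t \<mapsto> phi (l * t powr a)\<close> solves the fractional relaxation equation; this is its integral form at \<open>t = 1\<close>.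
  Since \<open>phi\<close> is decreasing, it gives two-sided bounds for \<open>phi\<close> that are uniform in \<open>a\<close>.\<close>

lemma phi_volterra:
  assumes l: "0 < l"
  shows "has_bochner_integral lborel (\<lambda>s. indicator {0<..<1} s * ((1 - s) powr (a - 1) * phi (l * s powr a)))
    (Gamma a * (1 - phi l) / l)"
proof -
  let ?b = "\<lambda>k s. indicator {0<..<1} s * (s powr ((a * real k + 1) - 1) * (1 - s) powr (a - 1))"
  let ?f = "\<lambda>k s. (- l) ^ k / Gamma (a * real k + 1) * ?b k s"
  let ?G = "\<lambda>s. indicator {0<..<1} s * ((1 - s) powr (a - 1) * phi (l * s powr a))"
  have Ga: "0 < Gamma a" using a by (intro Gamma_real_pos) auto
  have B: "has_bochner_integral lborel (?b k) (Beta (a * real k + 1) a)" for k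
    using a by (intro has_bochner_integral_Beta) (auto simp: add_nonneg_pos)
  \<comment> \<open>The Beta integral replaces the denominator for \<open>k\<close> by the one for
    \<open>Suc k\<close>. Up to the factor \<open>Gamma a\<close>, the integrated series is
    therefore that of \<open>phi l\<close> without its constant term, divided by
    \<open>- l\<close>.\<close>
  have Be: "Beta (a * real k + 1) a = Gamma (a * real k + 1) * Gamma a / Gamma (a * real (Suc k) + 1)" for k
    by (simp add: Beta_def algebra_simps)
  have f: "has_bochner_integral lborel (?f k) ((- l) ^ k * Gamma a / Gamma (a * real (Suc k) + 1))" for k
    using has_bochner_integral_mult_right[of "(- l) ^ k / Gamma (a * real k + 1)", OF B[of k]] Gamma_pos[of k]
    unfolding Be by simp
  have nf: "norm (?f k s) = l ^ k / Gamma (a * real k + 1) * ?b k s" for k s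
    using l Gamma_pos[of k] by (auto simp: abs_mult abs_divide power_abs split: split_indicator)
  have pw: "s powr ((a * real k + 1) - 1) = (s powr a) ^ k" if "0 < s" for s k
    using that by (simp add: powr_powr powr_realpow[symmetric])
  have sG: "(\<lambda>k. ?f k s) sums ?G s" for s
  proof (cases "s \<in> {0<..<1}")
    case True
    have "(\<lambda>k. (1 - s) powr (a - 1) * ((- (l * s powr a)) ^ k / Gamma (a * real k + 1))) sums ((1 - s) powr (a - 1) * phi (l * s powr a))"
      unfolding phi_def by (intro sums_mult summable_sums summable_norm_cancel[OF summable_phi])
    also have "(\<lambda>k. (1 - s) powr (a - 1) * ((- (l * s powr a)) ^ k / Gamma (a * real k + 1))) = (\<lambda>k. ?f k s)"
    proof
      fix k
      have "(- (l * s powr a)) ^ k = (- l) ^ k * (s powr a) ^ k"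
        by (simp add: power_mult_distrib[symmetric])
      then show "(1 - s) powr (a - 1) * ((- (l * s powr a)) ^ k / Gamma (a * real k + 1)) = ?f k s"
        using True pw[of s k] by simp
    qed
    finally show ?thesis using True by simp
  qed simp
  have i: "integrable lborel (?f k)" for k using f[of k] by (rule integrable.intros)
  have s1: "AE s in lborel. summable (\<lambda>k. norm (?f k s))"
  proof (rule AE_I2)
    fix s :: real
    show "summable (\<lambda>k. norm (?f k s))"
    proof (cases "s \<in> {0<..<1}")
      case True
      have "summable (\<lambda>k. (1 - s) powr (a - 1) * ((l * s powr a) ^ k / Gamma (a * real k + 1)))"
        using l a by (intro summable_mult summable_mittag_leffler) auto
      then show ?thesis unfolding nf using True pw[of s] by (simp add: power_mult_distrib mult_ac)
    qed simp
  qed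
  have tail: "summable (\<lambda>k. l ^ Suc k / Gamma (a * real (Suc k) + 1))"
    using summable_mittag_leffler[of a l] a l by (subst summable_Suc_iff) auto
  have "(\<integral>s. norm (?f k s) \<partial>lborel) = Gamma a / l * (l ^ Suc k / Gamma (a * real (Suc k) + 1))" for k
    unfolding nf using has_bochner_integral_integral_eq[OF B[of k]] Gamma_pos[of k] l unfolding Be by simp
  then have s2: "summable (\<lambda>k. \<integral>s. norm (?f k s) \<partial>lborel)"
    using summable_mult[OF tail, of "Gamma a / l"] by simp
  have e: "(\<Sum>k. ?f k s) = ?G s" for s
    using sG by (rule sums_unique[symmetric])
  have "(\<Sum>k. integral\<^sup>L lborel (?f k)) = (\<Sum>k. (- Gamma a / l) * ((- l) ^ Suc k / Gamma (a * real (Suc k) + 1)))"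
    unfolding has_bochner_integral_integral_eq[OF f] by (intro suminf_cong) (use l in \<open>simp add: field_simps\<close>)
  also have "\<dots> = (- Gamma a / l) * (\<Sum>k. (- l) ^ Suc k / Gamma (a * real (Suc k) + 1))"
    using summable_norm_cancel[OF summable_phi[of l]] by (subst suminf_mult) (simp_all only: summable_Suc_iff[of "\<lambda>k. (- l) ^ k / Gamma (a * real k + 1)"])
  also have "(\<Sum>k. (- l) ^ Suc k / Gamma (a * real (Suc k) + 1)) = phi l - 1"
    unfolding phi_def using suminf_split_head[OF summable_norm_cancel[OF summable_phi[of l]]] by simp
  also have "- Gamma a / l * (phi l - 1) = Gamma a * (1 - phi l) / l"
    by (subst times_divide_eq_left, rule arg_cong[where f = "\<lambda>x. x / l"]) (simp add: algebra_simps)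
  finally have "(\<Sum>k. integral\<^sup>L lborel (?f k)) = Gamma a * (1 - phi l) / l" .
  then show ?thesis
    using integrable_suminf[OF i s1 s2] integral_suminf[OF i s1 s2]
    unfolding e by (simp add: has_bochner_integral_iff)
qed

text \<open>From below the tail bound with \<open>A = 1\<close>, from above
  \<open>t powr a \<le> 1 + t\<close> under the Gamma integral; both are uniform in
  \<open>a\<close>.\<close>

lemma Gamma_1a: "1 / 3 \<le> Gamma (a + 1)" "Gamma (a + 1) \<le> 2"
proof -
  have "exp (- 1) \<le> Gamma (a + 1)" using Gamma_plus1_ge[of a 1] a by simp
  moreover have "1 / 3 \<le> exp (- 1 :: real)"
    using exp_le by (simp add: exp_minus field_simps)
  ultimately show "1 / 3 \<le> Gamma (a + 1)" by linarith
  have "ennreal (Gamma (a + 1)) = (\<integral>\<^sup>+t. ennreal (indicator {0..} t * t powr ((a + 1) - 1) / exp t) \<partial>lborel)"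
    using a by (subst Gamma_conv_nn_integral_real[symmetric]) auto
  also have "\<dots> \<le> (\<integral>\<^sup>+t. ennreal (indicator {0..} t * t powr (1 - 1) / exp t) + ennreal (indicator {0..} t * t powr (2 - 1) / exp t) \<partial>lborel)"
  proof (intro nn_integral_mono)
    fix t :: real
    have "t powr a \<le> t powr 0 + t powr 1" if "0 \<le> t"
    proof (cases "t \<le> 1")
      case True
      then show ?thesis using that a powr_mono'[of 0 a t] by (cases "t = 0") auto
    next
      case False
      then have "t powr a \<le> t powr 1" using a by (intro powr_mono) auto
      then show ?thesis using powr_ge_zero[of t 0] by linarith
    qed
    then show "ennreal (indicator {0..} t * t powr ((a + 1) - 1) / exp t)
       \<le> ennreal (indicator {0..} t * t powr (1 - 1) / exp t) + ennreal (indicator {0..} t * t powr (2 - 1) / exp t)"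
      by (auto split: split_indicator simp del: ennreal_plus simp: ennreal_plus[symmetric] add_divide_distrib[symmetric] intro!: ennreal_leI divide_right_mono)
  qed
  also have "\<dots> = ennreal (Gamma 1) + ennreal (Gamma 2)"
    by (subst nn_integral_add, measurable) (simp only: Gamma_conv_nn_integral_real zero_less_one zero_less_numeral)
  also have "\<dots> = ennreal 2"
    using Gamma_fact[of 1, where 'a = real] by (simp flip: ennreal_plus ennreal_1)
  finally show "Gamma (a + 1) \<le> 2" by (subst (asm) ennreal_le_iff) auto
qed

text \<open>In \<open>phi_volterra\<close> the factor \<open>phi (l * s powr a)\<close> lies between
  \<open>phi l\<close> and \<open>phi 0 = 1\<close>, and the weight
  \<open>(1 - s) powr (a - 1)\<close> has mass \<open>1 / a\<close>. The first bound controls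
  \<open>h\<close> near 0, the second its first moment.\<close>

lemma phi_bounds:
  assumes l: "0 < l"
  shows "phi l \<le> 2 / l" "1 - phi l \<le> 3 * l"
proof -
  have Ga: "0 < Gamma a" using a by (intro Gamma_real_pos) auto
  have "a \<notin> \<int>\<^sub>\<le>\<^sub>0" using a by (auto elim!: nonpos_Ints_cases)
  then have G1: "Gamma (a + 1) = a * Gamma a" by (rule Gamma_plus1)
  have "has_bochner_integral lborel (\<lambda>s. indicator {0<..<1} s * (s powr (1 - 1) * (1 - s) powr (a - 1))) (Beta 1 a)"
    using a by (intro has_bochner_integral_Beta) auto
  moreover have "Beta 1 a = 1 / a" using Ga by (simp add: Beta_def add.commute[of 1 a] G1)
  moreover have "(\<lambda>s::real. indicator {0<..<1} s * (s powr (1 - 1) * (1 - s) powr (a - 1))) = (\<lambda>s. indicator {0<..<1} s * (1 - s) powr (a - 1))"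
    by (auto split: split_indicator)
  ultimately have B: "has_bochner_integral lborel (\<lambda>s. indicator {0<..<1} s * (1 - s) powr (a - 1)) (1 / a)" by simp
  have sa: "l * s powr a \<le> l" if "0 < s" "s < 1" for s
    using that l a powr_mono'[of 0 a s] by simp
  have "phi l * (1 / a) \<le> Gamma a * (1 - phi l) / l"
    by (rule bochner_integral_le[OF has_bochner_integral_mult_right[OF B, where c = "phi l"] phi_volterra[OF l]])
       (auto split: split_indicator simp: mult.commute[of "phi l"] intro!: mult_left_mono phi_antimono sa)
  then have "l * phi l \<le> Gamma (a + 1) * (1 - phi l)"
    using l a unfolding G1 by (simp add: field_simps)
  also have "\<dots> \<le> Gamma (a + 1) * 1" using Gamma_1a phi_nonneg[of l] by (intro mult_left_mono) auto
  finally show "phi l \<le> 2 / l" using Gamma_1a l by (simp add: field_simps)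
  have "Gamma a * (1 - phi l) / l \<le> 1 * (1 / a)"
    by (rule bochner_integral_le[OF phi_volterra[OF l] has_bochner_integral_mult_right[OF B, where c = 1]])
       (use l in \<open>auto split: split_indicator simp: phi_0[symmetric] intro!: mult_left_le phi_antimono\<close>)
  then have "Gamma (a + 1) * (1 - phi l) \<le> l"
    using l a unfolding G1 by (simp add: field_simps)
  moreover have "1 / 3 * (1 - phi l) \<le> Gamma (a + 1) * (1 - phi l)"
    using Gamma_1a phi_antimono[of 0 l] phi_0 l by (intro mult_right_mono) auto
  ultimately have "1 / 3 * (1 - phi l) \<le> l" by (rule order_trans[rotated])
  then show "1 - phi l \<le> 3 * l" by simp
qed

text \<open>Exponential Chebyshev inequality with rate \<open>1 / \<eta>\<close>; the constant is
  \<open>6 = 3 * 2\<close>, from \<open>exp 1 \<le> 3\<close> and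
  \<open>phi (1 / \<eta>) \<le> 2 * \<eta>\<close>.\<close>

lemma small_mass:
  assumes "0 < \<eta>"
  shows "(\<integral>\<^sup>+\<theta>\<in>{0<..\<eta>}. ennreal (h \<theta>) \<partial>lborel) \<le> ennreal (6 * \<eta>)"
proof -
  have "(\<integral>\<^sup>+\<theta>\<in>{0<..\<eta>}. ennreal (h \<theta>) \<partial>lborel) \<le> (\<integral>\<^sup>+\<theta>. ennreal (exp 1) * (ennreal (h \<theta> * exp (- (1 / \<eta>) * \<theta>)) * indicator {0<..} \<theta>) \<partial>lborel)"
  proof (intro nn_integral_mono)
    fix \<theta>
    have "h \<theta> * 1 \<le> h \<theta> * (exp 1 * exp (- (1 / \<eta>) * \<theta>))" if "0 < \<theta>" "\<theta> \<le> \<eta>"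
      using that assms h_pos[of \<theta>] by (intro mult_left_mono) (auto simp: exp_add[symmetric] field_simps)
    then show "ennreal (h \<theta>) * indicator {0<..\<eta>} \<theta> \<le> ennreal (exp 1) * (ennreal (h \<theta> * exp (- (1 / \<eta>) * \<theta>)) * indicator {0<..} \<theta>)"
      using h_pos[of \<theta>] by (auto split: split_indicator simp: ennreal_mult'[symmetric] mult_ac intro!: ennreal_leI)
  qed
  also have "\<dots> = ennreal (exp 1) * ennreal (phi (1 / \<eta>))"
    by (subst nn_integral_cmult, measurable) (simp only: nn_integral_laplace)
  also have "\<dots> = ennreal (exp 1 * phi (1 / \<eta>))" by (simp add: ennreal_mult')
  also have "\<dots> \<le> ennreal (3 * (2 * \<eta>))"
    using phi_bounds(1)[of "1 / \<eta>"] assms exp_le phi_nonneg by (intro ennreal_leI mult_mono) auto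
  finally show ?thesis by simp
qed

text \<open>\<open>\<theta>\<close> is the limit of \<open>(1 - exp (- l * \<theta>)) / l\<close> as
  \<open>l\<close> tends to 0. By Fatou's lemma the moment is at most the upper limit of
  \<open>(1 - phi l) / l\<close>, which \<open>phi_bounds\<close> keeps below 3.\<close>

lemma first_moment: "(\<integral>\<^sup>+\<theta>\<in>{0<..}. ennreal (\<theta> * h \<theta>) \<partial>lborel) \<le> 3"
proof -
  let ?u = "\<lambda>n \<theta>. ennreal (real (Suc n) * (1 - exp (- (1 / real (Suc n)) * \<theta>)) * h \<theta>) * indicator {0<..} \<theta>"
  have lim: "(\<lambda>n. real (Suc n) * (1 - exp (- (1 / real (Suc n)) * \<theta>))) \<longlonglongrightarrow> \<theta>" for \<theta> :: real
    by real_asymp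
  have "(\<integral>\<^sup>+\<theta>\<in>{0<..}. ennreal (\<theta> * h \<theta>) \<partial>lborel) = (\<integral>\<^sup>+\<theta>. liminf (\<lambda>n. ?u n \<theta>) \<partial>lborel)"
  proof (intro nn_integral_cong)
    fix \<theta> :: real
    have "(\<lambda>n. ?u n \<theta>) \<longlonglongrightarrow> ennreal (\<theta> * h \<theta>) * indicator {0<..} \<theta>"
      by (intro tendsto_mult_ennreal tendsto_ennrealI tendsto_mult lim tendsto_const) (auto split: split_indicator)
    then show "ennreal (\<theta> * h \<theta>) * indicator {0<..} \<theta> = liminf (\<lambda>n. ?u n \<theta>)"
      by (simp add: lim_imp_Liminf)
  qed
  also have "\<dots> \<le> liminf (\<lambda>n. \<integral>\<^sup>+\<theta>. ?u n \<theta> \<partial>lborel)" by (rule nn_integral_liminf) measurable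
  also have "\<dots> \<le> limsup (\<lambda>n. \<integral>\<^sup>+\<theta>. ?u n \<theta> \<partial>lborel)" by (rule Liminf_le_Limsup) simp
  also have "\<dots> \<le> 3"
  proof (rule Limsup_bounded, rule always_eventually, rule allI)
    fix n
    define l where "l = 1 / real (Suc n)"
    have l: "0 < l" by (simp add: l_def)
    have p1: "phi l \<le> 1" using phi_antimono[of 0 l] l phi_0 by simp
    \<comment> \<open>To avoid subtraction in \<open>ennreal\<close>, the finite quantity
      \<open>phi l / l\<close> is added on both sides and cancelled at the end.\<close>
    have "(\<integral>\<^sup>+\<theta>. ?u n \<theta> \<partial>lborel) + ennreal (1 / l) * ennreal (phi l)
      = (\<integral>\<^sup>+\<theta>. ?u n \<theta> + ennreal (1 / l) * (ennreal (h \<theta> * exp (- l * \<theta>)) * indicator {0<..} \<theta>) \<partial>lborel)"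
      unfolding nn_integral_laplace[symmetric]
      by (subst nn_integral_add, measurable, subst nn_integral_cmult) (auto intro!: measurable)
    also have "\<dots> = (\<integral>\<^sup>+\<theta>. ennreal (1 / l) * (ennreal (h \<theta>) * indicator {0<..} \<theta>) \<partial>lborel)"
    proof (intro nn_integral_cong)
      fix \<theta>
      have "1 / l * (1 - exp (- l * \<theta>)) * h \<theta> + 1 / l * (h \<theta> * exp (- l * \<theta>)) = 1 / l * h \<theta>"
        by (simp add: algebra_simps)
      moreover have "0 \<le> 1 / l * (1 - exp (- l * \<theta>)) * h \<theta>" if "0 < \<theta>"
        using that l h_pos[OF that] by (intro mult_nonneg_nonneg) auto
      ultimately have "ennreal (1 / l * (1 - exp (- l * \<theta>)) * h \<theta>) + ennreal (1 / l) * ennreal (h \<theta> * exp (- l * \<theta>)) = ennreal (1 / l) * ennreal (h \<theta>)"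
        if "0 < \<theta>"
        using that l h_pos[OF that] by (subst (1 2) ennreal_mult'[symmetric], simp, simp, subst ennreal_plus[symmetric]) auto
      then show "?u n \<theta> + ennreal (1 / l) * (ennreal (h \<theta> * exp (- l * \<theta>)) * indicator {0<..} \<theta>)
        = ennreal (1 / l) * (ennreal (h \<theta>) * indicator {0<..} \<theta>)"
        by (simp add: l_def split: split_indicator)
    qed
    also have "\<dots> = ennreal (1 / l)"
      by (subst nn_integral_cmult) (auto simp: h_mass)
    also have "1 / l \<le> 3 + 1 / l * phi l"
      using phi_bounds(2)[OF l] l by (simp add: field_simps)
    then have "ennreal (1 / l) \<le> 3 + ennreal (1 / l) * ennreal (phi l)"
      using l phi_nonneg[of l] by (metis ennreal_leI ennreal_mult' ennreal_numeral ennreal_plus less_imp_le mult_nonneg_nonneg zero_le_numeral zero_less_divide_1_iff)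
    finally have "(\<integral>\<^sup>+\<theta>. ?u n \<theta> \<partial>lborel) + ennreal (1 / l) * ennreal (phi l) \<le> 3 + ennreal (1 / l) * ennreal (phi l)" .
    then show "(\<integral>\<^sup>+\<theta>. ?u n \<theta> \<partial>lborel) \<le> 3"
      by (subst (asm) (1 2) add.commute) (auto simp: ennreal_add_left_cancel_le ennreal_mult_eq_top_iff)
  qed
  finally show ?thesis .
qed

text \<open>Dyadic shells: on \<open>{(1/2) ^ Suc k<..(1/2) ^ k}\<close> the power is at most
  \<open>2 powr (d * (k + 1))\<close>, while the mass up to \<open>(1/2) ^ k\<close> is at most
  \<open>6 * (1/2) ^ k\<close> by \<open>small_mass\<close>. The resulting geometric series has
  ratio \<open>2 powr (d - 1)\<close>, whence \<open>d < 1\<close>.\<close>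

lemma neg_moment:
  assumes d: "0 < d" "d < 1"
  shows "(\<integral>\<^sup>+\<theta>\<in>{0<..}. ennreal (\<theta> powr (- d) * h \<theta>) \<partial>lborel) \<le> ennreal (1 + 6 * 2 powr d / (1 - 2 powr (d - 1)))"
proof -
  let ?g = "\<lambda>k \<theta>. ennreal (2 powr (d * (real k + 1))) * (ennreal (h \<theta>) * indicator {0<..(1/2) ^ k} \<theta>)"
  have r: "0 < 2 powr (d - 1)" "2 powr (d - 1) < 1" using d powr_less_cancel_iff[of 2 "d - 1" 0] by auto
  have "(\<integral>\<^sup>+\<theta>\<in>{0<..}. ennreal (\<theta> powr (- d) * h \<theta>) \<partial>lborel)
    \<le> (\<integral>\<^sup>+\<theta>. ennreal (h \<theta>) * indicator {0<..} \<theta> + (\<Sum>k. ?g k \<theta>) \<partial>lborel)"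
  proof (intro nn_integral_mono)
    fix \<theta> :: real
    show "ennreal (\<theta> powr (- d) * h \<theta>) * indicator {0<..} \<theta> \<le> ennreal (h \<theta>) * indicator {0<..} \<theta> + (\<Sum>k. ?g k \<theta>)"
    proof (cases "0 < \<theta>")
      case True
      show ?thesis
      proof (cases "1 \<le> \<theta>")
        case True
        then have "\<theta> powr (- d) \<le> 1 powr (- d)" using d by (intro powr_mono2') auto
        then have "ennreal (\<theta> powr (- d) * h \<theta>) \<le> ennreal (h \<theta>)"
          using h_pos[OF \<open>0 < \<theta>\<close>] by (intro ennreal_leI) (auto intro!: mult_left_le_one_le)
        then show ?thesis using \<open>0 < \<theta>\<close> by (simp add: add_increasing2)
      next
        case False
        \<comment> \<open>The shell of \<open>\<theta>\<close>; for \<open>k = 0\<close> its upper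
          end is supplied by \<open>\<theta> < 1\<close>.\<close>
        define k where "k = (LEAST k. (1/2) ^ Suc k < \<theta>)"
        obtain n where "(1/2 :: real) ^ n < \<theta>" using real_arch_pow_inv[of \<theta> "1/2"] True by auto
        then have "(1/2 :: real) ^ Suc n < \<theta>" by (rule le_less_trans[rotated]) simp
        then have k1: "(1/2) ^ Suc k < \<theta>" unfolding k_def by (rule LeastI)
        have k2: "\<theta> \<le> (1/2) ^ k"
        proof (cases k)
          case 0
          then show ?thesis using False by simp
        next
          case (Suc j)
          then have "\<not> (1/2) ^ Suc j < \<theta>" using not_less_Least[of j "\<lambda>k. (1/2) ^ Suc k < \<theta>"] unfolding k_def by simp
          then show ?thesis using Suc by simp
        qed
        have "\<theta> powr (- d) \<le> ((1/2) ^ Suc k) powr (- d)"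
          using k1 d True by (intro powr_mono2') auto
        also have "((1/2 :: real) ^ Suc k) powr (- d) = 2 powr (d * (real k + 1))"
        proof -
          have "(1/2 :: real) ^ Suc k = 2 powr (- real (Suc k))"
            by (simp only: powr_minus_divide powr_realpow zero_less_numeral power_one_over)
          then show ?thesis by (simp only: powr_powr) (simp add: algebra_simps)
        qed
        finally have "\<theta> powr (- d) * h \<theta> \<le> 2 powr (d * (real k + 1)) * h \<theta>"
          using h_pos[OF True] by (intro mult_right_mono) auto
        then have "ennreal (\<theta> powr (- d) * h \<theta>) \<le> ?g k \<theta>"
          using True k2 by (auto simp: ennreal_mult'[symmetric] intro!: ennreal_leI)
        also have "\<dots> \<le> (\<Sum>k. ?g k \<theta>)" using sum_le_suminf[of "\<lambda>k. ?g k \<theta>" "{k}"] by simp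
        finally show ?thesis using True by (simp add: add_increasing)
      qed
    qed simp
  qed
  also have "\<dots> = 1 + (\<Sum>k. \<integral>\<^sup>+\<theta>. ?g k \<theta> \<partial>lborel)"
    by (subst nn_integral_add) (auto simp: h_mass nn_integral_suminf)
  also have "\<dots> \<le> 1 + (\<Sum>k. ennreal (6 * 2 powr d * (2 powr (d - 1)) ^ k))"
  proof (intro add_left_mono suminf_le)
    fix k
    have "(\<integral>\<^sup>+\<theta>. ?g k \<theta> \<partial>lborel) \<le> ennreal (2 powr (d * (real k + 1))) * ennreal (6 * (1/2) ^ k)"
      by (subst nn_integral_cmult) (auto intro!: mult_left_mono small_mass)
    also have "\<dots> = ennreal (6 * 2 powr d * (2 powr (d - 1)) ^ k)"
    proof -
      have "(1/2 :: real) ^ k = 2 powr (- real k)"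
        by (simp only: powr_minus_divide powr_realpow zero_less_numeral power_one_over)
      moreover have "(2 powr (d - 1)) ^ k = 2 powr ((d - 1) * real k)"
        by (subst powr_realpow[symmetric]) (auto simp: powr_powr)
      moreover have "2 powr (d * (real k + 1)) * 2 powr (- real k) = 2 powr d * 2 powr ((d - 1) * real k)"
        unfolding powr_add[symmetric] by (rule arg_cong[where f = "\<lambda>x. 2 powr x"]) (simp add: algebra_simps)
      ultimately have "2 powr (d * (real k + 1)) * (6 * (1/2) ^ k) = 6 * 2 powr d * (2 powr (d - 1)) ^ k" by simp
      then show ?thesis by (subst ennreal_mult'[symmetric]) auto
    qed
    finally show "(\<integral>\<^sup>+\<theta>. ?g k \<theta> \<partial>lborel) \<le> ennreal (6 * 2 powr d * (2 powr (d - 1)) ^ k)" .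
  qed auto
  also have "(\<Sum>k. ennreal (6 * 2 powr d * (2 powr (d - 1)) ^ k)) = ennreal (\<Sum>k. 6 * 2 powr d * (2 powr (d - 1)) ^ k)"
    using r by (intro suminf_ennreal2 summable_mult summable_geometric) auto
  also have "(\<Sum>k. 6 * 2 powr d * (2 powr (d - 1)) ^ k) = 6 * 2 powr d / (1 - 2 powr (d - 1))"
    using r by (subst suminf_mult) (auto simp: suminf_geometric summable_geometric)
  also have "1 + ennreal (6 * 2 powr d / (1 - 2 powr (d - 1))) = ennreal (1 + 6 * 2 powr d / (1 - 2 powr (d - 1)))"
    using r by (subst ennreal_plus) auto
  finally show ?thesis .
qed

text \<open>At most \<open>6 / 24 = 1 / 4\<close> of the mass lies below \<open>1 / 24\<close>, and
  by Markov's inequality with the first moment at most \<open>3 / 12 = 1 / 4\<close> lies above 12.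
  The remaining half sits where \<open>\<theta> > 1 / 24\<close>, which gives the second
  bound.\<close>

lemma bulk_mass:
  "ennreal (1 / 2) \<le> (\<integral>\<^sup>+\<theta>\<in>{0<..12}. ennreal (h \<theta>) \<partial>lborel)"
  "ennreal (1 / 48) \<le> (\<integral>\<^sup>+\<theta>\<in>{0<..12}. ennreal (\<theta> * h \<theta>) \<partial>lborel)"
proof -
  let ?B = "\<integral>\<^sup>+\<theta>\<in>{1/24<..12}. ennreal (h \<theta>) \<partial>lborel"
  have T: "(\<integral>\<^sup>+\<theta>\<in>{12<..}. ennreal (h \<theta>) \<partial>lborel) \<le> ennreal (1 / 4)"
  proof -
    have "(\<integral>\<^sup>+\<theta>\<in>{12<..}. ennreal (h \<theta>) \<partial>lborel) \<le> (\<integral>\<^sup>+\<theta>. ennreal (1 / 12) * (ennreal (\<theta> * h \<theta>) * indicator {0<..} \<theta>) \<partial>lborel)"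
    proof (intro nn_integral_mono)
      fix \<theta>
      have "ennreal (h \<theta>) \<le> ennreal (1 / 12 * (\<theta> * h \<theta>))" if "12 < \<theta>"
        using that h_pos[of \<theta>] mult_right_mono[of 12 \<theta> "h \<theta>"] by (intro ennreal_leI) auto
      then show "ennreal (h \<theta>) * indicator {12<..} \<theta> \<le> ennreal (1 / 12) * (ennreal (\<theta> * h \<theta>) * indicator {0<..} \<theta>)"
        by (auto simp: ennreal_mult'[symmetric] split: split_indicator)
    qed
    also have "\<dots> = ennreal (1 / 12) * (\<integral>\<^sup>+\<theta>\<in>{0<..}. ennreal (\<theta> * h \<theta>) \<partial>lborel)"
      by (subst nn_integral_cmult) auto
    also have "\<dots> \<le> ennreal (1 / 12) * ennreal 3" using first_moment by (intro mult_left_mono) auto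
    also have "\<dots> = ennreal (1 / 4)" by (subst ennreal_mult'[symmetric]) auto
    finally show ?thesis .
  qed
  have "1 = (\<integral>\<^sup>+\<theta>. ennreal (h \<theta>) * indicator {0<..1/24} \<theta> + (ennreal (h \<theta>) * indicator {1/24<..12} \<theta> + ennreal (h \<theta>) * indicator {12<..} \<theta>) \<partial>lborel)"
    unfolding h_mass[symmetric] by (intro nn_integral_cong) (auto split: split_indicator)
  also have "\<dots> = (\<integral>\<^sup>+\<theta>\<in>{0<..1/24}. ennreal (h \<theta>) \<partial>lborel) + (?B + (\<integral>\<^sup>+\<theta>\<in>{12<..}. ennreal (h \<theta>) \<partial>lborel))"
    by (subst nn_integral_add, simp, simp, subst nn_integral_add) auto
  also have "\<dots> \<le> ennreal (6 * (1 / 24)) + (?B + ennreal (1 / 4))"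
    by (intro add_mono order_refl T small_mass) auto
  finally have B: "ennreal (1 / 2) \<le> ?B"
  proof (cases ?B)
    case (real r)
    assume "1 \<le> ennreal (6 * (1 / 24)) + (?B + ennreal (1 / 4))"
    also have "\<dots> = ennreal (6 * (1 / 24) + (r + 1 / 4))"
      unfolding real(2) using real(1) by (simp add: ennreal_plus[symmetric] del: ennreal_plus)
    finally have "1 \<le> 6 * (1 / 24) + (r + 1 / 4)" by (simp only: ennreal_1[symmetric] ennreal_le_iff2) auto
    then show ?thesis unfolding real(2) by (intro ennreal_leI) simp
  qed simp
  have "?B \<le> (\<integral>\<^sup>+\<theta>\<in>{0<..12}. ennreal (h \<theta>) \<partial>lborel)"
    by (intro nn_integral_mono) (auto split: split_indicator)
  with B show "ennreal (1 / 2) \<le> (\<integral>\<^sup>+\<theta>\<in>{0<..12}. ennreal (h \<theta>) \<partial>lborel)" by (rule order_trans)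
  have "ennreal (1 / 48) = ennreal (1 / 24) * ennreal (1 / 2)"
    by (subst ennreal_mult'[symmetric]) auto
  also have "\<dots> \<le> ennreal (1 / 24) * ?B" by (intro mult_left_mono B) auto
  also have "\<dots> = (\<integral>\<^sup>+\<theta>. ennreal (1 / 24) * (ennreal (h \<theta>) * indicator {1/24<..12} \<theta>) \<partial>lborel)"
    by (subst nn_integral_cmult) auto
  also have "\<dots> \<le> (\<integral>\<^sup>+\<theta>\<in>{0<..12}. ennreal (\<theta> * h \<theta>) \<partial>lborel)"
  proof (intro nn_integral_mono)
    fix \<theta>
    have "ennreal (1 / 24 * h \<theta>) \<le> ennreal (\<theta> * h \<theta>)" if "1 / 24 < \<theta>"
      using that h_pos[of \<theta>] by (intro ennreal_leI mult_right_mono) auto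
    then show "ennreal (1 / 24) * (ennreal (h \<theta>) * indicator {1/24<..12} \<theta>) \<le> ennreal (\<theta> * h \<theta>) * indicator {0<..12} \<theta>"
      by (auto simp: ennreal_mult'[symmetric] split: split_indicator)
  qed
  finally show "ennreal (1 / 48) \<le> (\<integral>\<^sup>+\<theta>\<in>{0<..12}. ennreal (\<theta> * h \<theta>) \<partial>lborel)" .
qed

end

section \<open>Integral inequalities and the heat semigroup\<close>

definition epow :: "real \<Rightarrow> ennreal \<Rightarrow> ennreal" where
  "epow p x = (if x = top then top else ennreal (enn2real x powr p))"

lemma epow_top [simp]: "epow p top = top"
  by (simp add: epow_def)

lemma epow_ennreal: "0 \<le> r \<Longrightarrow> epow p (ennreal r) = ennreal (r powr p)"
  by (simp add: epow_def)

lemma epow_0 [simp]: "epow p 0 = 0"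
  by (simp add: epow_def)

lemma epow_measurable[measurable]: "epow p \<in> borel_measurable borel"
proof -
  have "epow p = (\<lambda>x. if x < top then ennreal (enn2real x powr p) else top)"
    by (auto simp: epow_def less_top)
  then show ?thesis by simp
qed

lemma epow_mono:
  assumes "0 \<le> p" "x \<le> y"
  shows "epow p x \<le> epow p y"
proof (cases "y = top")
  case False
  then have "x \<noteq> top" using assms by (auto simp: top_unique)
  then show ?thesis using False assms
    by (auto simp: epow_def intro!: ennreal_leI powr_mono2 enn2real_mono simp: less_top)
qed simp

lemma epow_epow:
  assumes "0 < p"
  shows "epow (1 / p) (epow p x) = x" "epow p (epow (1 / p) x) = x"
  using assms by (cases x; simp add: epow_ennreal powr_powr)+

text \<open>\<open>epow p\<close> has the monotone inverse \<open>epow (1 / p)\<close>, so it commutes with all suprema.\<close>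

lemma epow_SUP:
  assumes "0 < p" "I \<noteq> {}"
  shows "epow p (SUP i\<in>I. f i) = (SUP i\<in>I. epow p (f i))"
proof (rule antisym)
  have "f i \<le> epow (1 / p) (SUP i\<in>I. epow p (f i))" if "i \<in> I" for i
  proof -
    have "epow (1 / p) (epow p (f i)) \<le> epow (1 / p) (SUP i\<in>I. epow p (f i))"
      using that assms by (intro epow_mono SUP_upper) auto
    then show ?thesis using assms by (simp add: epow_epow)
  qed
  then have "(SUP i\<in>I. f i) \<le> epow (1 / p) (SUP i\<in>I. epow p (f i))" by (rule SUP_least)
  then have "epow p (SUP i\<in>I. f i) \<le> epow p (epow (1 / p) (SUP i\<in>I. epow p (f i)))"
    using assms by (intro epow_mono) auto
  then show "epow p (SUP i\<in>I. f i) \<le> (SUP i\<in>I. epow p (f i))" using assms by (simp add: epow_epow)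
  show "(SUP i\<in>I. epow p (f i)) \<le> epow p (SUP i\<in>I. f i)"
    using assms by (intro SUP_least epow_mono SUP_upper) auto
qed

text \<open>Convexity: the tangent at \<open>b\<close> lies below the power. This is Young's
  inequality for \<open>x\<close> and \<open>b powr (p - 1)\<close>, and all convexity estimates
  below are drawn from it.\<close>

lemma powr_tangent:
  fixes x b p :: real
  assumes "1 < p" "0 \<le> x" "0 \<le> b"
  shows "p * b powr (p - 1) * x \<le> x powr p + (p - 1) * b powr p"
proof -
  define q where "q = p / (p - 1)"
  have q: "1 < q" "1 / p + 1 / q = 1" using assms by (auto simp: q_def field_simps)
  have "x * b powr (p - 1) \<le> x powr p / p + (b powr (p - 1)) powr q / q"
    using assms q by (intro Youngs_inequality) auto
  also have "(b powr (p - 1)) powr q = b powr p" using assms by (simp add: powr_powr q_def)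
  also have "b powr p / q = (p - 1) * b powr p / p" by (simp add: q_def)
  finally have "p * (x * b powr (p - 1)) \<le> p * (x powr p / p + (p - 1) * b powr p / p)"
    using assms by (intro mult_left_mono) auto
  also have "p * (x powr p / p + (p - 1) * b powr p / p) = x powr p + (p - 1) * b powr p"
    using assms by (simp add: distrib_left)
  finally show ?thesis by (simp add: mult_ac)
qed

text \<open>The tangent inequalities for both numbers at their midpoint, added.\<close>

lemma epow_add_le:
  assumes p: "1 < p"
  shows "epow p (x + y) \<le> ennreal (2 powr (p - 1)) * (epow p x + epow p y)"
proof (cases "x = top \<or> y = top")
  case True
  then show ?thesis by (elim disjE) (simp_all add: ennreal_mult_top)
next
  case False
  then obtain r s where rs: "x = ennreal r" "y = ennreal s" "0 \<le> r" "0 \<le> s"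
    by (cases x; cases y) auto
  define b where "b = (r + s) / 2"
  have b: "0 \<le> b" using rs by (simp add: b_def)
  have "p * b powr (p - 1) * r + p * b powr (p - 1) * s \<le> r powr p + s powr p + 2 * ((p - 1) * b powr p)"
    using powr_tangent[OF p rs(3) b] powr_tangent[OF p rs(4) b] by linarith
  moreover have "p * b powr (p - 1) * r + p * b powr (p - 1) * s = 2 * (p * b powr p)"
  proof -
    have "b powr (p - 1) * b = b powr p" using b by (cases "b = 0") (auto simp: powr_diff)
    moreover have "p * b powr (p - 1) * r + p * b powr (p - 1) * s = 2 * (p * (b powr (p - 1) * b))"
      by (simp add: b_def algebra_simps)
    ultimately show ?thesis by simp
  qed
  ultimately have 1: "2 * b powr p \<le> r powr p + s powr p" by (simp add: algebra_simps)
  have "r + s = 2 * b" by (simp add: b_def)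
  then have "(r + s) powr p = (2 * b) powr p" by (rule arg_cong)
  also have "\<dots> = 2 powr (p - 1) * (2 * b powr p)"
    using b by (simp add: powr_mult powr_diff)
  also have "\<dots> \<le> 2 powr (p - 1) * (r powr p + s powr p)" using 1 by (intro mult_left_mono) auto
  finally show ?thesis
    using rs by (simp add: epow_ennreal ennreal_plus[symmetric] ennreal_mult'[symmetric] del: ennreal_plus)
qed

lemma epow_mult:
  assumes "0 < c"
  shows "epow p (ennreal c * x) = ennreal (c powr p) * epow p x"
proof (cases x)
  case (real r)
  then show ?thesis using assms by (simp add: ennreal_mult'[symmetric] epow_ennreal powr_mult)
next
  case top
  then show ?thesis using assms by (simp add: ennreal_mult_top)
qed

text \<open>The tangent inequality at \<open>b\<close>, applied to \<open>f / g\<close>, is integrated against \<open>w * g\<close>; the best choice is \<open>b = (\<integral>\<^sup>+s. w s * f s \<partial>M) / K\<close>.\<close>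

lemma jensen_epow:
  fixes f w :: "'s \<Rightarrow> ennreal" and g :: "'s \<Rightarrow> real"
  assumes p: "1 < p"
    and f[measurable]: "f \<in> borel_measurable M" and w[measurable]: "w \<in> borel_measurable M"
    and g[measurable]: "g \<in> borel_measurable M" and g0: "\<And>s. w s \<noteq> 0 \<Longrightarrow> 0 < g s"
    and K: "(\<integral>\<^sup>+s. w s * ennreal (g s) \<partial>M) \<le> ennreal K" "0 < K"
  shows "epow p (\<integral>\<^sup>+s. w s * f s \<partial>M)
    \<le> ennreal (K powr (p - 1)) * (\<integral>\<^sup>+s. w s * (ennreal (g s powr (1 - p)) * epow p (f s)) \<partial>M)"
proof -
  define F where "F = (\<integral>\<^sup>+s. w s * f s \<partial>M)"
  define J where "J = (\<integral>\<^sup>+s. w s * (ennreal (g s powr (1 - p)) * epow p (f s)) \<partial>M)"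
  have tangent: "ennreal (p * b powr (p - 1)) * F \<le> J + ennreal ((p - 1) * b powr p * K)" if b: "0 \<le> b" for b
  proof -
    have "ennreal (p * b powr (p - 1)) * F = (\<integral>\<^sup>+s. ennreal (p * b powr (p - 1)) * (w s * f s) \<partial>M)"
      unfolding F_def by (subst nn_integral_cmult) auto
    also have "\<dots> \<le> (\<integral>\<^sup>+s. w s * (ennreal (g s powr (1 - p)) * epow p (f s)) + ennreal ((p - 1) * b powr p) * (w s * ennreal (g s)) \<partial>M)"
    proof (intro nn_integral_mono)
      fix s
      show "ennreal (p * b powr (p - 1)) * (w s * f s)
        \<le> w s * (ennreal (g s powr (1 - p)) * epow p (f s)) + ennreal ((p - 1) * b powr p) * (w s * ennreal (g s))"
      proof (cases "w s = 0")
        case False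
        then have gs: "0 < g s" by (rule g0)
        have "ennreal (p * b powr (p - 1)) * f s \<le> ennreal (g s powr (1 - p)) * epow p (f s) + ennreal ((p - 1) * b powr p * g s)"
        proof (cases "f s")
          case (real r)
          have "p * b powr (p - 1) * (r / g s) \<le> (r / g s) powr p + (p - 1) * b powr p"
            using p gs real b by (intro powr_tangent) auto
          then have "g s * (p * b powr (p - 1) * (r / g s)) \<le> g s * ((r / g s) powr p + (p - 1) * b powr p)"
            using gs by (intro mult_left_mono) auto
          moreover have "g s * (r / g s) powr p = g s powr (1 - p) * r powr p"
            using gs real by (simp add: powr_divide powr_diff)
          ultimately have "p * b powr (p - 1) * r \<le> g s powr (1 - p) * r powr p + (p - 1) * b powr p * g s"
            using gs by (simp add: algebra_simps)
          then have "ennreal (p * b powr (p - 1) * r) \<le> ennreal (g s powr (1 - p) * r powr p + (p - 1) * b powr p * g s)"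
            by (rule ennreal_leI)
          then show ?thesis using real p gs
            by (simp add: epow_ennreal ennreal_mult')
        next
          case top
          then show ?thesis using gs by (simp add: ennreal_mult_top)
        qed
        then have "w s * (ennreal (p * b powr (p - 1)) * f s)
          \<le> w s * (ennreal (g s powr (1 - p)) * epow p (f s) + ennreal ((p - 1) * b powr p * g s))"
          by (rule mult_left_mono) simp
        then show ?thesis using p gs by (simp add: distrib_left ennreal_mult mult_ac)
      qed simp
    qed
    also have "\<dots> = J + ennreal ((p - 1) * b powr p) * (\<integral>\<^sup>+s. w s * ennreal (g s) \<partial>M)"
      unfolding J_def by (subst nn_integral_add, measurable, subst nn_integral_cmult) auto
    also have "\<dots> \<le> J + ennreal ((p - 1) * b powr p) * ennreal K"
      by (intro add_left_mono mult_left_mono K) simp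
    finally show ?thesis using p K by (simp add: ennreal_mult)
  qed
  have "epow p F \<le> ennreal (K powr (p - 1)) * J"
  proof (cases "J")
    case top
    then show ?thesis using K by (simp add: ennreal_mult_top)
  next
    case (real j)
    show ?thesis
    proof (cases "F")
      case top
      \<comment> \<open>An infinite \<open>F\<close> would contradict the tangent inequality at
        \<open>b = 1\<close>, whose right-hand side is finite.\<close>
      then show ?thesis using tangent[of 1] real p K by (simp add: ennreal_mult_top top_unique)
    next
      case (real r)
      define b where "b = r / K"
      have b: "0 \<le> b" "r = b * K" using real K by (auto simp: b_def)
      have bb: "b powr (p - 1) * b = b powr p" using b by (cases "b = 0") (auto simp: powr_diff)
      have "ennreal (p * b powr (p - 1) * r) \<le> ennreal (j + (p - 1) * b powr p * K)"
        using tangent[OF b(1)] real \<open>J = ennreal j\<close> \<open>0 \<le> j\<close> p K by (simp add: ennreal_mult)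
      then have "p * b powr (p - 1) * r \<le> j + (p - 1) * b powr p * K"
        using \<open>0 \<le> j\<close> p K by (subst (asm) ennreal_le_iff) auto
      moreover have "p * b powr (p - 1) * r = p * b powr p * K" using b bb by (simp add: mult.assoc[symmetric])
      ultimately have "p * b powr p * K \<le> j + (p - 1) * b powr p * K" by (simp only:)
      then have "b powr p * K \<le> j" by (simp add: algebra_simps)
      then have "K powr (p - 1) * (b powr p * K) \<le> K powr (p - 1) * j" by (intro mult_left_mono) auto
      moreover have "r powr p = K powr (p - 1) * (b powr p * K)" using b K by (simp add: powr_mult powr_diff)
      ultimately have "ennreal (r powr p) \<le> ennreal (K powr (p - 1) * j)" by (intro ennreal_leI) simp
      then show ?thesis using real \<open>J = ennreal j\<close> \<open>0 \<le> j\<close> by (simp add: epow_ennreal ennreal_mult)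
    qed
  qed
  then show ?thesis unfolding F_def J_def .
qed

text \<open>Jensen's inequality is applied at each \<open>x\<close> with the same weight
  \<open>g\<close>, the bound for the norms of the \<open>f s\<close>. After exchanging the
  integrals \<open>g s powr (1 - p) * g s powr p = g s\<close>, so that only \<open>K\<close>
  remains.\<close>

lemma minkowski_epow:
  fixes f :: "'s \<Rightarrow> 'x \<Rightarrow> ennreal" and w :: "'s \<Rightarrow> ennreal" and g :: "'s \<Rightarrow> real"
  assumes p: "1 < p" and M: "sigma_finite_measure M" and N: "sigma_finite_measure N"
    and f: "case_prod f \<in> borel_measurable (M \<Otimes>\<^sub>M N)" and w[measurable]: "w \<in> borel_measurable M"
    and g[measurable]: "g \<in> borel_measurable M" and g0: "\<And>s. w s \<noteq> 0 \<Longrightarrow> 0 < g s"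
    and bnd: "\<And>s. w s \<noteq> 0 \<Longrightarrow> (\<integral>\<^sup>+x. epow p (f s x) \<partial>N) \<le> ennreal (g s powr p)"
    and K: "(\<integral>\<^sup>+s. w s * ennreal (g s) \<partial>M) \<le> ennreal K" "0 < K"
  shows "(\<integral>\<^sup>+x. epow p (\<integral>\<^sup>+s. w s * f s x \<partial>M) \<partial>N) \<le> ennreal (K powr p)"
proof -
  interpret M: sigma_finite_measure M by fact
  interpret N: sigma_finite_measure N by fact
  interpret pair_sigma_finite M N ..
  note [measurable] = f
  have [measurable]: "(\<lambda>s. f s x) \<in> borel_measurable M" if "x \<in> space N" for x
    using that by measurable
  define F where "F x = (\<integral>\<^sup>+s. w s * f s x \<partial>M)" for x
  define J where "J x = (\<integral>\<^sup>+s. w s * (ennreal (g s powr (1 - p)) * epow p (f s x)) \<partial>M)" for x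
  have pw: "epow p (F x) \<le> ennreal (K powr (p - 1)) * J x" if x: "x \<in> space N" for x
    unfolding F_def J_def using x by (intro jensen_epow[OF p _ w g g0 K]) auto
  have "(\<integral>\<^sup>+x. epow p (F x) \<partial>N) \<le> (\<integral>\<^sup>+x. ennreal (K powr (p - 1)) * J x \<partial>N)"
    by (intro nn_integral_mono pw)
  also have "\<dots> = ennreal (K powr (p - 1)) * (\<integral>\<^sup>+x. J x \<partial>N)"
    unfolding J_def by (subst nn_integral_cmult) auto
  also have "(\<integral>\<^sup>+x. J x \<partial>N) = (\<integral>\<^sup>+s. (\<integral>\<^sup>+x. w s * (ennreal (g s powr (1 - p)) * epow p (f s x)) \<partial>N) \<partial>M)"
    unfolding J_def by (rule Fubini') measurable
  also have "\<dots> \<le> (\<integral>\<^sup>+s. w s * ennreal (g s) \<partial>M)"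
  proof (intro nn_integral_mono)
    fix s assume s: "s \<in> space M"
    have "(\<integral>\<^sup>+x. w s * (ennreal (g s powr (1 - p)) * epow p (f s x)) \<partial>N) = w s * (ennreal (g s powr (1 - p)) * (\<integral>\<^sup>+x. epow p (f s x) \<partial>N))"
      using s by (subst nn_integral_cmult, measurable, subst nn_integral_cmult) auto
    also have "\<dots> \<le> w s * ennreal (g s)"
    proof (cases "w s = 0")
      case False
      have "ennreal (g s powr (1 - p)) * (\<integral>\<^sup>+x. epow p (f s x) \<partial>N) \<le> ennreal (g s powr (1 - p)) * ennreal (g s powr p)"
        using bnd[OF False] by (intro mult_left_mono) auto
      also have "\<dots> = ennreal (g s)" using g0[OF False] by (simp add: ennreal_mult'[symmetric] powr_add[symmetric])
      finally show ?thesis by (intro mult_left_mono) auto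
    qed simp
    finally show "(\<integral>\<^sup>+x. w s * (ennreal (g s powr (1 - p)) * epow p (f s x)) \<partial>N) \<le> w s * ennreal (g s)" .
  qed
  also have "\<dots> \<le> ennreal K" by fact
  finally have "(\<integral>\<^sup>+x. epow p (F x) \<partial>N) \<le> ennreal (K powr (p - 1)) * ennreal K"
    by (simp add: mult_left_mono)
  also have "\<dots> = ennreal (K powr p)" using K by (simp add: ennreal_mult'[symmetric] powr_diff)
  finally show ?thesis unfolding F_def .
qed

section \<open>The Gaussian kernel and its subordination\<close>

lemma heat_kernel_measurable[measurable]:
  "case_prod (heat_kernel :: real \<Rightarrow> 'a::euclidean_space \<Rightarrow> real) \<in> borel_measurable (borel \<Otimes>\<^sub>M borel)"
  unfolding heat_kernel_def by measurable

lemma heat_kernel_nonneg [simp]: "0 \<le> heat_kernel t x"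
  by (simp add: heat_kernel_def)

lemma heat_kernel_le:
  fixes x :: "'a::euclidean_space"
  shows "0 < t \<Longrightarrow> heat_kernel t x \<le> (4 * pi * t) powr (- (real DIM('a) / 2))"
  by (simp add: heat_kernel_def mult_left_le)

lemma heat_kernel_commute: "heat_kernel t (x - y) = heat_kernel t (y - x)"
  by (simp add: heat_kernel_def norm_minus_commute)

text \<open>The kernel is a product over the coordinates of normal densities with variance
  \<open>2 * t\<close>.\<close>

lemma nn_integral_heat_kernel:
  fixes y :: "'a::euclidean_space"
  assumes t: "0 < t"
  shows "(\<integral>\<^sup>+x. ennreal (heat_kernel t (x - y)) \<partial>lborel) = 1"
proof -
  have prod: "heat_kernel t (x - y) = (\<Prod>b\<in>Basis. normal_density (y \<bullet> b) (sqrt (2 * t)) (x \<bullet> b))" for x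
  proof -
    have "(\<Prod>b\<in>(Basis::'a set). normal_density (y \<bullet> b) (sqrt (2 * t)) (x \<bullet> b))
      = (\<Prod>b\<in>(Basis::'a set). 1 / sqrt (4 * pi * t)) * (\<Prod>b\<in>(Basis::'a set). exp (- ((x \<bullet> b - y \<bullet> b)\<^sup>2 / (4 * t))))"
      unfolding normal_density_def prod.distrib[symmetric] using t by (intro prod.cong) (auto simp: mult_ac)
    also have "(\<Prod>b\<in>(Basis::'a set). 1 / sqrt (4 * pi * t)) = (4 * pi * t) powr (- (real DIM('a) / 2))"
    proof -
      have "1 / sqrt (4 * pi * t) = (4 * pi * t) powr (- 1 / 2)"
        using t by (simp add: powr_half_sqrt[symmetric] powr_minus_divide)
      then show ?thesis using t by (simp add: powr_realpow[symmetric] powr_powr)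
    qed
    also have "(\<Prod>b\<in>(Basis::'a set). exp (- ((x \<bullet> b - y \<bullet> b)\<^sup>2 / (4 * t)))) = exp (\<Sum>b\<in>(Basis::'a set). - ((x \<bullet> b - y \<bullet> b)\<^sup>2 / (4 * t)))"
      by (simp add: exp_sum)
    also have "(\<Sum>b\<in>(Basis::'a set). - ((x \<bullet> b - y \<bullet> b)\<^sup>2 / (4 * t))) = - ((norm (x - y))\<^sup>2 / (4 * t))"
      unfolding power2_norm_eq_inner euclidean_inner[of "x - y" "x - y"]
      by (simp add: sum_negf sum_divide_distrib inner_diff_left power2_eq_square)
    finally show ?thesis by (simp add: heat_kernel_def)
  qed
  have "(\<integral>\<^sup>+x. ennreal (heat_kernel t (x - y)) \<partial>lborel)
    = (\<integral>\<^sup>+x. (\<Prod>b\<in>Basis. ennreal (normal_density (y \<bullet> b) (sqrt (2 * t)) (x \<bullet> b))) \<partial>lborel)"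
    unfolding prod by (subst prod_ennreal) auto
  also have "\<dots> = (\<Prod>b\<in>(Basis::'a set). (\<integral>\<^sup>+x. ennreal (normal_density (y \<bullet> b) (sqrt (2 * t)) x) \<partial>lborel))"
    by (rule nn_integral_lborel_prod) auto
  also have "\<dots> = 1"
    using t by (simp add: nn_integral_eq_integral)
  finally show ?thesis .
qed

text \<open>Arguments with values in \<open>ennreal\<close> allow Picard iterates to be inserted
  before anything is known about their finiteness.\<close>

definition heat_conv :: "real \<Rightarrow> ('a::euclidean_space \<Rightarrow> ennreal) \<Rightarrow> 'a \<Rightarrow> ennreal" where
  "heat_conv t g x = (\<integral>\<^sup>+y. ennreal (heat_kernel t (x - y)) * g y \<partial>lborel)"

lemma heat_semigroup_density:
  assumes [measurable]: "g \<in> borel_measurable borel"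
  shows "heat_semigroup t (density lborel g) x = heat_conv t g x"
  unfolding heat_semigroup_def heat_conv_def by (subst nn_integral_density) (auto simp: mult.commute)

lemma heat_conv_measurable[measurable (raw)]:
  fixes g :: "'z \<Rightarrow> 'a::euclidean_space \<Rightarrow> ennreal"
  assumes [measurable]: "case_prod g \<in> borel_measurable (M \<Otimes>\<^sub>M borel)" "\<tau> \<in> borel_measurable M" "x \<in> borel_measurable M"
  shows "(\<lambda>z. heat_conv (\<tau> z) (g z) (x z)) \<in> borel_measurable M"
  unfolding heat_conv_def by measurable

lemma nn_integral_heat_conv:
  fixes g :: "'a::euclidean_space \<Rightarrow> ennreal"
  assumes t: "0 < t" and [measurable]: "g \<in> borel_measurable borel"
  shows "(\<integral>\<^sup>+x. heat_conv t g x \<partial>lborel) = (\<integral>\<^sup>+y. g y \<partial>lborel)"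
proof -
  have "(\<integral>\<^sup>+x. heat_conv t g x \<partial>lborel) = (\<integral>\<^sup>+y. (\<integral>\<^sup>+x. ennreal (heat_kernel t (x - y)) * g y \<partial>lborel) \<partial>lborel)"
    unfolding heat_conv_def by (rule lborel_pair.Fubini'[symmetric]) measurable
  also have "\<dots> = (\<integral>\<^sup>+y. g y \<partial>lborel)"
    using t by (intro nn_integral_cong) (simp add: nn_integral_multc nn_integral_heat_kernel)
  finally show ?thesis .
qed

lemma heat_conv_const: "0 < t \<Longrightarrow> heat_conv t (\<lambda>_. c) x = c"
  unfolding heat_conv_def by (subst heat_kernel_commute) (simp add: nn_integral_multc nn_integral_heat_kernel)

lemma heat_conv_mono: "(\<And>y. f y \<le> g y) \<Longrightarrow> heat_conv t f x \<le> heat_conv t g x"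
  unfolding heat_conv_def by (intro nn_integral_mono mult_left_mono) auto

lemma heat_conv_mono_AE: "AE y in lborel. f y \<le> g y \<Longrightarrow> heat_conv t f x \<le> heat_conv t g x"
  unfolding heat_conv_def by (rule nn_integral_mono_AE, erule eventually_mono, rule mult_left_mono) auto

text \<open>Interpolation between the bounds in \<open>L\<^sup>1\<close> and \<open>L\<^sup>\<infinity>\<close>; for the Fujita exponent the decay rate of the \<open>p\<close>-th power is exactly \<open>1 / t\<close>.\<close>

lemma heat_conv_Lp:
  fixes g :: "'a::euclidean_space \<Rightarrow> ennreal"
  assumes p: "p = 1 + 2 / real DIM('a)" and t: "0 < t" and [measurable]: "g \<in> borel_measurable borel"
    and g: "(\<integral>\<^sup>+y. g y \<partial>lborel) \<le> ennreal M" and M: "0 < M"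
  shows "(\<integral>\<^sup>+x. epow p (heat_conv t g x) \<partial>lborel) \<le> ennreal (((4 * pi * t) powr (- 1 / p) * M) powr p)"
proof -
  define c where "c = (4 * pi * t) powr (- (real DIM('a) / 2))"
  have c: "0 < c" using t by (simp add: c_def)
  have p1: "1 < p" using p by simp
  have sup: "heat_conv t g x \<le> ennreal (c * M)" for x
  proof -
    have "heat_conv t g x \<le> (\<integral>\<^sup>+y. ennreal c * g y \<partial>lborel)"
      unfolding heat_conv_def c_def using t by (intro nn_integral_mono mult_right_mono ennreal_leI heat_kernel_le) auto
    also have "\<dots> = ennreal c * (\<integral>\<^sup>+y. g y \<partial>lborel)" by (rule nn_integral_cmult) simp
    also have "\<dots> \<le> ennreal c * ennreal M" by (intro mult_left_mono g) simp
    finally show ?thesis using c M by (simp add: ennreal_mult)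
  qed
  have "epow p (heat_conv t g x) \<le> ennreal ((c * M) powr (p - 1)) * heat_conv t g x" for x
  proof (cases "heat_conv t g x")
    case (real r)
    then have r: "r \<le> c * M" using sup[of x] c M by simp
    have "r powr p = r powr (p - 1) * r" using real by (cases "r = 0") (auto simp: powr_diff)
    also have "\<dots> \<le> (c * M) powr (p - 1) * r" using r real p1 by (intro mult_right_mono powr_mono2) auto
    finally show ?thesis using real by (simp add: epow_ennreal ennreal_mult'[symmetric] ennreal_leI)
  next
    case top
    then show ?thesis using sup[of x] by (simp add: top_unique)
  qed
  then have "(\<integral>\<^sup>+x. epow p (heat_conv t g x) \<partial>lborel) \<le> (\<integral>\<^sup>+x. ennreal ((c * M) powr (p - 1)) * heat_conv t g x \<partial>lborel)"
    by (intro nn_integral_mono)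
  also have "\<dots> = ennreal ((c * M) powr (p - 1)) * (\<integral>\<^sup>+y. g y \<partial>lborel)"
    using t by (subst nn_integral_cmult) (auto simp: nn_integral_heat_conv)
  also have "\<dots> \<le> ennreal ((c * M) powr (p - 1)) * ennreal M" by (intro mult_left_mono g) simp
  also have "\<dots> = ennreal ((c * M) powr (p - 1) * M)" by (simp add: ennreal_mult')
  also have "(c * M) powr (p - 1) * M = ((4 * pi * t) powr (- 1 / p) * M) powr p"
  proof -
    have "c powr (p - 1) = (4 * pi * t) powr (- 1)" using t by (simp add: c_def powr_powr p)
    moreover have "((4 * pi * t) powr (- 1 / p)) powr p = (4 * pi * t) powr (- 1)" using p1 by (simp add: powr_powr)
    moreover have "M powr (p - 1) * M = M powr p" using M by (simp add: powr_diff)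
    moreover have "(c * M) powr (p - 1) = c powr (p - 1) * M powr (p - 1)"
      "((4 * pi * t) powr (- 1 / p) * M) powr p = ((4 * pi * t) powr (- 1 / p)) powr p * M powr p"
      using c M by (intro powr_mult; simp)+
    ultimately show ?thesis by (simp only: mult.assoc)
  qed
  finally show ?thesis .
qed

text \<open>Minkowski's inequality in \<open>\<theta>\<close>: the norm of
  \<open>heat_conv (t * \<theta>) g\<close> decays like
  \<open>(t * \<theta>) powr (- 1 / p)\<close>, so the average needs the negative moment of order
  \<open>1 / p\<close> of the weight.\<close>

lemma subordinated_heat_Lp:
  fixes g :: "'a::euclidean_space \<Rightarrow> ennreal" and w :: "real \<Rightarrow> ennreal"
  assumes p: "p = 1 + 2 / real DIM('a)" and t: "0 < t" and [measurable]: "g \<in> borel_measurable borel" "w \<in> borel_measurable borel"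
    and w0: "\<And>\<theta>. \<theta> \<le> 0 \<Longrightarrow> w \<theta> = 0" and C: "(\<integral>\<^sup>+\<theta>. w \<theta> * ennreal (\<theta> powr (- 1 / p)) \<partial>lborel) \<le> ennreal C" "0 < C"
    and g: "(\<integral>\<^sup>+y. g y \<partial>lborel) \<le> ennreal M" and M: "0 < M"
  shows "(\<integral>\<^sup>+x. epow p (\<integral>\<^sup>+\<theta>. w \<theta> * heat_conv (t * \<theta>) g x \<partial>lborel) \<partial>lborel) \<le> ennreal (((4 * pi * t) powr (- 1 / p) * M * C) powr p)"
proof -
  have w1: "0 < \<theta>" if "w \<theta> \<noteq> 0" for \<theta> using w0[of \<theta>] that by fastforce
  show ?thesis
  proof (rule minkowski_epow[where g = "\<lambda>\<theta>. (4 * pi * (t * \<theta>)) powr (- 1 / p) * M"])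
    show "1 < p" using p by simp
    show "sigma_finite_measure (lborel :: real measure)" "sigma_finite_measure (lborel :: 'a measure)"
      by (rule lborel.sigma_finite_measure_axioms)+
    show "0 < (4 * pi * (t * \<theta>)) powr (- 1 / p) * M" if "w \<theta> \<noteq> 0" for \<theta>
      using w1[OF that] t M by simp
    show "(\<integral>\<^sup>+x. epow p (heat_conv (t * \<theta>) g x) \<partial>lborel) \<le> ennreal (((4 * pi * (t * \<theta>)) powr (- 1 / p) * M) powr p)" if "w \<theta> \<noteq> 0" for \<theta>
      using w1[OF that] t M g p by (intro heat_conv_Lp) auto
    have "(\<integral>\<^sup>+\<theta>. w \<theta> * ennreal ((4 * pi * (t * \<theta>)) powr (- 1 / p) * M) \<partial>lborel)
      = (\<integral>\<^sup>+\<theta>. ennreal ((4 * pi * t) powr (- 1 / p) * M) * (w \<theta> * ennreal (\<theta> powr (- 1 / p))) \<partial>lborel)"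
    proof (intro nn_integral_cong)
      fix \<theta>
      show "w \<theta> * ennreal ((4 * pi * (t * \<theta>)) powr (- 1 / p) * M) = ennreal ((4 * pi * t) powr (- 1 / p) * M) * (w \<theta> * ennreal (\<theta> powr (- 1 / p)))"
      proof (cases "w \<theta> = 0")
        case False
        have "(4 * pi * (t * \<theta>)) powr (- 1 / p) = (4 * pi * t) powr (- 1 / p) * \<theta> powr (- 1 / p)"
          using w1[OF False] t by (simp add: powr_mult)
        then show ?thesis using M by (simp add: ennreal_mult' mult_ac)
      qed simp
    qed
    also have "\<dots> = ennreal ((4 * pi * t) powr (- 1 / p) * M) * (\<integral>\<^sup>+\<theta>. w \<theta> * ennreal (\<theta> powr (- 1 / p)) \<partial>lborel)"
      by (rule nn_integral_cmult) measurable
    also have "\<dots> \<le> ennreal ((4 * pi * t) powr (- 1 / p) * M) * ennreal C" by (intro mult_left_mono C) simp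
    finally show "(\<integral>\<^sup>+\<theta>. w \<theta> * ennreal ((4 * pi * (t * \<theta>)) powr (- 1 / p) * M) \<partial>lborel) \<le> ennreal ((4 * pi * t) powr (- 1 / p) * M * C)"
      using C M by (simp add: ennreal_mult)
    show "0 < (4 * pi * t) powr (- 1 / p) * M * C" using t M C by simp
  qed measurable
qed

section \<open>The minimal solution by monotone iteration\<close>

lemma AE_case_prod_mp:
  assumes "AE (t, x) in M. P t x" "\<And>t x. P t x \<Longrightarrow> Q t x"
  shows "AE (t, x) in M. Q t x"
  using assms by (auto elim!: eventually_mono)

locale fractional =
  fixes a :: real
  assumes a01: "0 < a" "a < 1"

sublocale fractional \<subseteq> subordination a "subordination_density a"
proof
  have "is_subordination_density a (subordination_density a)"
    unfolding subordination_density_def using ex_is_subordination_density[OF a01] by (rule someI_ex)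
  then show "is_subordination_density a (subordination_density a)" .
qed (use a01 in auto)

context fractional
begin

section \<open>The operators of the integral equation on extended-valued functions\<close>

definition w0 :: "real \<Rightarrow> ennreal" where
  "w0 \<theta> = ennreal (subordination_density a \<theta>) * indicator {0<..} \<theta>"

definition w1 :: "real \<Rightarrow> ennreal" where
  "w1 \<theta> = ennreal (\<theta> * subordination_density a \<theta>) * indicator {0<..} \<theta>"

lemma w_measurable[measurable]: "w0 \<in> borel_measurable borel" "w1 \<in> borel_measurable borel"
  unfolding w0_def w1_def by measurable

definition evolution :: "('a::euclidean_space \<Rightarrow> ennreal) \<Rightarrow> real \<Rightarrow> 'a \<Rightarrow> ennreal" where
  "evolution f t x = (\<integral>\<^sup>+\<theta>. w0 \<theta> * heat_conv (t powr a * \<theta>) f x \<partial>lborel)"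

definition smoothing :: "real \<Rightarrow> ('a::euclidean_space \<Rightarrow> ennreal) \<Rightarrow> 'a \<Rightarrow> ennreal" where
  "smoothing t f x = (\<integral>\<^sup>+\<theta>. w1 \<theta> * heat_conv (t powr a * \<theta>) f x \<partial>lborel)"

definition duhamel :: "(real \<Rightarrow> 'a::euclidean_space \<Rightarrow> ennreal) \<Rightarrow> real \<Rightarrow> 'a \<Rightarrow> ennreal" where
  "duhamel g t x = ennreal a * (\<integral>\<^sup>+s. (ennreal ((t - s) powr (a - 1)) * indicator {0<..<t} s) * smoothing (t - s) (g s) x \<partial>lborel)"

lemma P_op_density:
  assumes "f \<in> borel_measurable borel"
  shows "P_op a t (density lborel f) x = evolution f t x"
  unfolding P_op_def evolution_def heat_semigroup_density[OF assms] w0_def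
  by (intro nn_integral_cong) (simp add: mult_ac)

lemma S_op_density:
  assumes "f \<in> borel_measurable borel"
  shows "S_op a t (density lborel f) x = smoothing t f x"
  unfolding S_op_def smoothing_def heat_semigroup_density[OF assms] w1_def
  by (intro nn_integral_cong) (simp add: mult_ac)

lemma duhamel_eq:
  assumes "\<And>s. 0 < s \<Longrightarrow> s < t \<Longrightarrow> u s \<in> borel_measurable borel"
  shows "ennreal a * (\<integral>\<^sup>+ s\<in>{0<..<t}. ennreal ((t - s) powr (a - 1))
              * S_op a (t - s) (fun_measure (\<lambda>y. u s y powr p)) x \<partial>lborel)
    = duhamel (\<lambda>s y. ennreal (u s y powr p)) t x"
proof -
  have "S_op a (t - s) (fun_measure (\<lambda>y. u s y powr p)) x = smoothing (t - s) (\<lambda>y. ennreal (u s y powr p)) x"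
    if "0 < s" "s < t" for s
  proof -
    have [measurable]: "u s \<in> borel_measurable borel" using assms that by auto
    show ?thesis unfolding fun_measure_def by (rule S_op_density) measurable
  qed
  then show ?thesis unfolding duhamel_def
    by (intro arg_cong[where f = "\<lambda>z. ennreal a * z"] nn_integral_cong) (auto split: split_indicator)
qed

lemma evolution_measurable[measurable (raw)]:
  fixes f :: "'z \<Rightarrow> 'a::euclidean_space \<Rightarrow> ennreal"
  assumes [measurable]: "case_prod f \<in> borel_measurable (M \<Otimes>\<^sub>M borel)" "t \<in> borel_measurable M" "x \<in> borel_measurable M"
  shows "(\<lambda>z. evolution (f z) (t z) (x z)) \<in> borel_measurable M"
  unfolding evolution_def by measurable

lemma smoothing_measurable[measurable (raw)]:
  fixes f :: "'z \<Rightarrow> 'a::euclidean_space \<Rightarrow> ennreal"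
  assumes [measurable]: "case_prod f \<in> borel_measurable (M \<Otimes>\<^sub>M borel)" "t \<in> borel_measurable M" "x \<in> borel_measurable M"
  shows "(\<lambda>z. smoothing (t z) (f z) (x z)) \<in> borel_measurable M"
  unfolding smoothing_def by measurable

lemma duhamel_measurable[measurable (raw)]:
  fixes g :: "real \<Rightarrow> 'a::euclidean_space \<Rightarrow> ennreal"
  assumes [measurable]: "case_prod g \<in> borel_measurable (borel \<Otimes>\<^sub>M borel)" "t \<in> borel_measurable M" "x \<in> borel_measurable M"
  shows "(\<lambda>z. duhamel g (t z) (x z)) \<in> borel_measurable M"
proof -
  have *: "indicator {0<..<t} s = (if 0 < s \<and> s < t then 1 else (0::ennreal))" for s t :: real
    by (auto split: split_indicator)
  show ?thesis unfolding duhamel_def * by measurable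
qed

lemma smoothing_mono_AE: "AE y in lborel. f y \<le> g y \<Longrightarrow> smoothing t f x \<le> smoothing t g x"
  unfolding smoothing_def by (intro nn_integral_mono mult_left_mono heat_conv_mono_AE) auto

text \<open>Almost every slice suffices; this is what lets the iteration be compared with functions
  that satisfy the equation only up to null sets.\<close>

lemma duhamel_mono_AE:
  assumes "AE s in lborel. 0 < s \<and> s < t \<longrightarrow> (AE y in lborel. f s y \<le> g s y)"
  shows "duhamel f t x \<le> duhamel g t x"
  unfolding duhamel_def
proof (intro mult_left_mono nn_integral_mono_AE)
  show "AE s in lborel. ennreal ((t - s) powr (a - 1)) * indicator {0<..<t} s * smoothing (t - s) (f s) x
    \<le> ennreal ((t - s) powr (a - 1)) * indicator {0<..<t} s * smoothing (t - s) (g s) x"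
    using assms by eventually_elim (auto split: split_indicator intro!: mult_left_mono smoothing_mono_AE)
qed simp

lemma duhamel_mono: "(\<And>s y. 0 < s \<Longrightarrow> s < t \<Longrightarrow> f s y \<le> g s y) \<Longrightarrow> duhamel f t x \<le> duhamel g t x"
  by (intro duhamel_mono_AE) auto

lemma heat_conv_SUP:
  assumes inc: "\<And>n y. g n y \<le> g (Suc n) y" and [measurable]: "\<And>n. g n \<in> borel_measurable borel"
  shows "heat_conv t (\<lambda>y. SUP n. g n y) x = (SUP n. heat_conv t (g n) x)"
  unfolding heat_conv_def SUP_mult_left_ennreal[symmetric]
  by (subst nn_integral_monotone_convergence_SUP[symmetric])
     (auto intro!: incseq_SucI le_funI mult_left_mono inc nn_integral_cong simp: SUP_mult_left_ennreal)

lemma smoothing_SUP: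
  assumes inc: "\<And>n y. g n y \<le> g (Suc n) y" and [measurable]: "\<And>n. g n \<in> borel_measurable borel"
  shows "smoothing t (\<lambda>y. SUP n. g n y) x = (SUP n. smoothing t (g n) x)"
  unfolding smoothing_def heat_conv_SUP[where g = g, OF assms]
  by (subst nn_integral_monotone_convergence_SUP[symmetric])
     (auto intro!: incseq_SucI le_funI mult_left_mono heat_conv_mono inc nn_integral_cong simp: SUP_mult_left_ennreal)

lemma duhamel_SUP:
  assumes inc: "\<And>n s y. g n s y \<le> g (Suc n) s y" and m[measurable]: "\<And>n. case_prod (g n) \<in> borel_measurable (borel \<Otimes>\<^sub>M borel)"
  shows "duhamel (\<lambda>s y. SUP n. g n s y) t x = (SUP n. duhamel (g n) t x)"
proof -
  have [measurable]: "g n s \<in> borel_measurable borel" for n s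
    using measurable_compose[OF measurable_Pair1' m, of s] by simp
  have "smoothing (t - s) (\<lambda>y. SUP n. g n s y) x = (SUP n. smoothing (t - s) (g n s) x)" for s
    by (rule smoothing_SUP) (auto simp: inc)
  then show ?thesis
    unfolding duhamel_def SUP_mult_left_ennreal[symmetric]
    by (subst nn_integral_monotone_convergence_SUP[symmetric])
       (auto intro!: incseq_SucI le_funI mult_left_mono smoothing_mono_AE inc nn_integral_cong simp: SUP_mult_left_ennreal)
qed

text \<open>The factor \<open>c\<close> is 1 for the equation itself. For the singular part of the
  data \<open>c = 2 powr (p - 1)\<close> absorbs the splitting of the nonlinearity. Starting from 0
  makes the iterates increasing and, for \<open>c = 1\<close>, keeps them below every
  solution.\<close>

primrec picard :: "real \<Rightarrow> real \<Rightarrow> ('a::euclidean_space \<Rightarrow> ennreal) \<Rightarrow> nat \<Rightarrow> real \<Rightarrow> 'a \<Rightarrow> ennreal" where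
  "picard p c f 0 = (\<lambda>t x. 0)"
| "picard p c f (Suc n) = (\<lambda>t x. evolution f t x + ennreal c * duhamel (\<lambda>s y. epow p (picard p c f n s y)) t x)"

lemma picard_measurable[measurable]:
  assumes [measurable]: "f \<in> borel_measurable borel"
  shows "case_prod (picard p c f n) \<in> borel_measurable (borel \<Otimes>\<^sub>M borel)"
proof (induction n)
  case (Suc n)
  note [measurable] = Suc
  show ?case by simp
qed simp

lemma picard_mono:
  assumes "0 \<le> p"
  shows "picard p c f n t x \<le> picard p c f (Suc n) t x"
proof (induction n arbitrary: t x)
  case (Suc n)
  show ?case
    unfolding picard.simps(2)[of p c f "Suc n"] picard.simps(2)[of p c f n]
    using Suc.IH assms by (intro add_left_mono mult_left_mono duhamel_mono epow_mono) auto
qed simp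

definition picard_lim :: "real \<Rightarrow> real \<Rightarrow> ('a::euclidean_space \<Rightarrow> ennreal) \<Rightarrow> real \<Rightarrow> 'a \<Rightarrow> ennreal" where
  "picard_lim p c f t x = (SUP n. picard p c f n t x)"

lemma picard_lim_measurable[measurable]:
  assumes [measurable]: "f \<in> borel_measurable borel"
  shows "case_prod (picard_lim p c f) \<in> borel_measurable (borel \<Otimes>\<^sub>M borel)"
  unfolding picard_lim_def by (simp add: split_beta')

text \<open>Monotone convergence through \<open>epow\<close> and \<open>duhamel\<close>. The
  equation holds at every point of \<open>[0, \<infinity>]\<close>-valued functions, before any
  smallness or finiteness is known.\<close>

lemma picard_lim_eq:
  assumes p: "0 < p" and f[measurable]: "f \<in> borel_measurable borel"
  shows "picard_lim p c f t x = evolution f t x + ennreal c * duhamel (\<lambda>s y. epow p (picard_lim p c f s y)) t x"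
proof -
  have "picard_lim p c f t x = (SUP n. picard p c f (Suc n) t x)"
    unfolding picard_lim_def
  proof (rule antisym)
    show "(SUP n. picard p c f n t x) \<le> (SUP n. picard p c f (Suc n) t x)"
    proof (rule SUP_mono)
      show "\<exists>m\<in>UNIV. picard p c f n t x \<le> picard p c f (Suc m) t x" for n
        using p by (intro bexI[of _ n] picard_mono) auto
    qed
    show "(SUP n. picard p c f (Suc n) t x) \<le> (SUP n. picard p c f n t x)"
      by (intro SUP_mono) (auto simp del: picard.simps)
  qed
  also have "\<dots> = evolution f t x + ennreal c * (SUP n. duhamel (\<lambda>s y. epow p (picard p c f n s y)) t x)"
    by (simp add: ennreal_SUP_add_right SUP_mult_left_ennreal)
  also have "(SUP n. duhamel (\<lambda>s y. epow p (picard p c f n s y)) t x) = duhamel (\<lambda>s y. SUP n. epow p (picard p c f n s y)) t x"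
  proof (rule duhamel_SUP[symmetric])
    fix n
    show "epow p (picard p c f n s y) \<le> epow p (picard p c f (Suc n) s y)" for s y
      using picard_mono[of p c f n s y] p by (intro epow_mono) (auto simp del: picard.simps)
    show "(\<lambda>(s, y). epow p (picard p c f n s y)) \<in> borel_measurable (borel \<Otimes>\<^sub>M borel)"
      by measurable
  qed
  also have "(\<lambda>s y. SUP n. epow p (picard p c f n s y)) = (\<lambda>s y. epow p (picard_lim p c f s y))"
    using p by (simp add: picard_lim_def epow_SUP)
  finally show ?thesis .
qed

section \<open>Comparison of the iterates with arbitrary solutions\<close>

lemma solution_slice_measurable:
  assumes u: "is_solution a p T \<mu> u" and s: "0 < s" "ennreal s < T"
  shows "u s \<in> borel_measurable borel"
proof -
  have "(\<lambda>(t, x). u t x) \<in> borel_measurable (restrict_space borel (cylinder T))"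
    using u by (simp add: is_solution_def)
  moreover have "(\<lambda>y. (s, y)) \<in> borel \<rightarrow>\<^sub>M restrict_space borel (cylinder T)"
    using s by (intro measurable_restrict_space2) (auto simp: cylinder_def borel_prod[symmetric])
  ultimately show ?thesis by (auto dest: measurable_compose[rotated])
qed

lemma AE_cylinder:
  fixes Q :: "real \<Rightarrow> 'a::euclidean_space \<Rightarrow> bool"
  assumes "AE (t, x) in lborel. (t, x) \<in> cylinder T \<longrightarrow> Q t x"
  shows "AE t in lborel. 0 < t \<and> ennreal t < T \<longrightarrow> (AE x in lborel. Q t x)"
proof -
  have "AE z in lborel \<Otimes>\<^sub>M lborel. case z of (t, x :: 'a) \<Rightarrow> (t, x) \<in> cylinder T \<longrightarrow> Q t x"
    unfolding lborel_prod by (rule assms)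
  from lborel_pair.AE_pair[OF this] show ?thesis
    by eventually_elim (auto simp: cylinder_def)
qed

lemma solution_eq:
  fixes f :: "'a::euclidean_space \<Rightarrow> real"
  assumes u: "is_solution a p T (fun_measure f) u" and [measurable]: "f \<in> borel_measurable borel"
  shows "AE (t, x) in lborel. (t, x) \<in> cylinder T \<longrightarrow>
    ennreal (u t x) = evolution (\<lambda>y. ennreal (f y)) t x + duhamel (\<lambda>s y. ennreal (u s y powr p)) t x"
proof -
  have "AE (t, x) in lborel. (t, x) \<in> cylinder T \<longrightarrow>
        ennreal (u t x) =
          P_op a t (fun_measure f) x
          + ennreal a * (\<integral>\<^sup>+ s\<in>{0<..<t}. ennreal ((t - s) powr (a - 1))
              * S_op a (t - s) (fun_measure (\<lambda>y. u s y powr p)) x \<partial>lborel)"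
    using u by (simp add: is_solution_def)
  then show ?thesis
  proof (rule AE_case_prod_mp, intro impI)
    fix t :: real and x :: 'a
    assume eq: "(t, x) \<in> cylinder T \<longrightarrow> ennreal (u t x) = P_op a t (fun_measure f) x
          + ennreal a * (\<integral>\<^sup>+ s\<in>{0<..<t}. ennreal ((t - s) powr (a - 1))
              * S_op a (t - s) (fun_measure (\<lambda>y. u s y powr p)) x \<partial>lborel)" and cyl: "(t, x) \<in> cylinder T"
    then have t: "0 < t" "ennreal t < T" by (auto simp: cylinder_def)
    have "P_op a t (fun_measure f) x = evolution (\<lambda>y. ennreal (f y)) t x"
      unfolding fun_measure_def by (rule P_op_density) measurable
    moreover have "ennreal a * (\<integral>\<^sup>+ s\<in>{0<..<t}. ennreal ((t - s) powr (a - 1))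
              * S_op a (t - s) (fun_measure (\<lambda>y. u s y powr p)) x \<partial>lborel) = duhamel (\<lambda>s y. ennreal (u s y powr p)) t x"
      using t by (intro duhamel_eq solution_slice_measurable[OF u]) (auto intro: le_less_trans ennreal_leI[OF less_imp_le])
    ultimately show "ennreal (u t x) = evolution (\<lambda>y. ennreal (f y)) t x + duhamel (\<lambda>s y. ennreal (u s y powr p)) t x"
      using eq cyl by simp
  qed
qed

text \<open>Induction starting from \<open>0 \<le> u\<close>, by monotonicity of
  \<open>duhamel\<close>. As \<open>duhamel\<close> integrates over the past, the induction
  hypothesis is first turned by \<open>AE_cylinder\<close> into a statement about almost every time
  slice.\<close>

lemma picard_le_solution:
  fixes f :: "'a::euclidean_space \<Rightarrow> real"
  assumes p: "0 < p" and u: "is_solution a p T (fun_measure f) u" and f[measurable]: "f \<in> borel_measurable borel"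
  shows "AE (t, x) in lborel. (t, x) \<in> cylinder T \<longrightarrow> picard p 1 (\<lambda>y. ennreal (f y)) n t x \<le> ennreal (u t x)"
proof (induction n)
  case (Suc n)
  have u0: "0 \<le> u s y" if "0 < s" "ennreal s < T" for s y
    using u that by (auto simp: is_solution_def cylinder_def)
  have *: "AE s in lborel. 0 < s \<and> ennreal s < T \<longrightarrow> (AE y in lborel. picard p 1 (\<lambda>y. ennreal (f y)) n s y \<le> ennreal (u s y))"
    using Suc.IH by (rule AE_cylinder)
  show ?case
    using solution_eq[OF u f]
  proof (rule AE_case_prod_mp, intro impI)
    fix t :: real and x :: 'a
    assume eq: "(t, x) \<in> cylinder T \<longrightarrow> ennreal (u t x)
        = evolution (\<lambda>y. ennreal (f y)) t x + duhamel (\<lambda>s y. ennreal (u s y powr p)) t x"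
      and cyl: "(t, x) \<in> cylinder T"
    then have t: "0 < t" "ennreal t < T" by (auto simp: cylinder_def)
    have "duhamel (\<lambda>s y. epow p (picard p 1 (\<lambda>y. ennreal (f y)) n s y)) t x \<le> duhamel (\<lambda>s y. ennreal (u s y powr p)) t x"
    proof (rule duhamel_mono_AE, use * in eventually_elim, intro impI)
      fix s
      assume s: "0 < s \<and> s < t" and "0 < s \<and> ennreal s < T \<longrightarrow> (AE y in lborel. picard p 1 (\<lambda>y. ennreal (f y)) n s y \<le> ennreal (u s y))"
      moreover have sT: "ennreal s < T" using s t by (auto intro: le_less_trans ennreal_leI[OF less_imp_le])
      ultimately have "AE y in lborel. picard p 1 (\<lambda>y. ennreal (f y)) n s y \<le> ennreal (u s y)" by auto
      then show "AE y in lborel. epow p (picard p 1 (\<lambda>y. ennreal (f y)) n s y) \<le> ennreal (u s y powr p)"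
      proof eventually_elim
        fix y assume "picard p 1 (\<lambda>y. ennreal (f y)) n s y \<le> ennreal (u s y)"
        then have "epow p (picard p 1 (\<lambda>y. ennreal (f y)) n s y) \<le> epow p (ennreal (u s y))"
          using p by (intro epow_mono) auto
        then show "epow p (picard p 1 (\<lambda>y. ennreal (f y)) n s y) \<le> ennreal (u s y powr p)"
          using u0[of s y] s sT by (simp add: epow_ennreal)
      qed
    qed
    then show "picard p 1 (\<lambda>y. ennreal (f y)) (Suc n) t x \<le> ennreal (u t x)"
      using eq cyl by (simp add: add_left_mono)
  qed
qed (simp add: case_prod_beta)

text \<open>By \<open>picard_lim_eq\<close> the limit satisfies the equation in
  \<open>ennreal\<close>, so finiteness is the only obstacle: \<open>enn2real\<close> sends
  \<open>top\<close> to 0 and would destroy the equation there. Minimality holds because all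
  iterates lie below every solution.\<close>

lemma minimal_solution_if_finite:
  fixes f :: "'a::euclidean_space \<Rightarrow> real"
  assumes p: "0 < p" and T: "0 < T" and f[measurable]: "f \<in> borel_measurable borel" and rad: "radon_measure (fun_measure f)"
    and fin: "AE (t, x) in lborel. (t, x) \<in> cylinder T \<longrightarrow> picard_lim p 1 (\<lambda>y. ennreal (f y)) t x < top"
  shows "is_minimal_solution a p T (fun_measure f) (\<lambda>t x. enn2real (picard_lim p 1 (\<lambda>y. ennreal (f y)) t x))"
proof -
  let ?f = "\<lambda>y. ennreal (f y)"
  let ?U = "picard_lim p 1 ?f"
  let ?u = "\<lambda>t x. enn2real (?U t x)"
  have m: "(\<lambda>(t, x). ?u t x) \<in> borel_measurable (borel \<Otimes>\<^sub>M borel)" by measurable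
  have slice: "?u s \<in> borel_measurable borel" for s
    using measurable_compose[OF measurable_Pair1' m, of s] by simp
  have *: "AE s in lborel. 0 < s \<and> ennreal s < T \<longrightarrow> (AE y in lborel. ?U s y < top)"
    using fin by (rule AE_cylinder)
  have sol: "is_solution a p T (fun_measure f) ?u"
    unfolding is_solution_def
  proof (intro conjI T rad)
    show "(\<lambda>(t, x). ?u t x) \<in> borel_measurable (restrict_space borel (cylinder T))"
      using m unfolding borel_prod by (rule measurable_restrict_space1)
    show "\<forall>(t, x)\<in>cylinder T. 0 \<le> ?u t x" by auto
    show "AE (t, x) in lborel. (t, x) \<in> cylinder T \<longrightarrow>
        ennreal (?u t x) =
          P_op a t (fun_measure f) x
          + ennreal a * (\<integral>\<^sup>+ s\<in>{0<..<t}. ennreal ((t - s) powr (a - 1))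
              * S_op a (t - s) (fun_measure (\<lambda>y. ?u s y powr p)) x \<partial>lborel)"
      using fin
    proof (rule AE_case_prod_mp, intro impI)
      fix t :: real and x :: 'a
      assume Uf: "(t, x) \<in> cylinder T \<longrightarrow> ?U t x < top" and cyl: "(t, x) \<in> cylinder T"
      then have Ufin: "?U t x < top" by blast
      from cyl have t: "0 < t" "ennreal t < T" by (auto simp: cylinder_def)
      have 1: "P_op a t (fun_measure f) x = evolution ?f t x"
        unfolding fun_measure_def by (rule P_op_density) measurable
      have 2: "ennreal a * (\<integral>\<^sup>+ s\<in>{0<..<t}. ennreal ((t - s) powr (a - 1))
              * S_op a (t - s) (fun_measure (\<lambda>y. ?u s y powr p)) x \<partial>lborel) = duhamel (\<lambda>s y. ennreal (?u s y powr p)) t x"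
        by (rule duhamel_eq[OF slice])
      have ae: "AE s in lborel. 0 < s \<and> s < t \<longrightarrow> (AE y in lborel. ennreal (?u s y powr p) = epow p (?U s y))"
        using *
      proof (eventually_elim, intro impI)
        fix s
        assume s: "0 < s \<and> s < t" and "0 < s \<and> ennreal s < T \<longrightarrow> (AE y in lborel. ?U s y < top)"
        moreover have "ennreal s < T" using s t by (auto intro: le_less_trans ennreal_leI[OF less_imp_le])
        ultimately have "AE y in lborel. ?U s y < top" by auto
        then show "AE y in lborel. ennreal (?u s y powr p) = epow p (?U s y)"
          by eventually_elim (auto simp: epow_def)
      qed
      have "duhamel (\<lambda>s y. ennreal (?u s y powr p)) t x = duhamel (\<lambda>s y. epow p (?U s y)) t x"
        by (rule antisym; rule duhamel_mono_AE; use ae in eventually_elim) (auto elim: eventually_mono)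
      then show "ennreal (?u t x) = P_op a t (fun_measure f) x
          + ennreal a * (\<integral>\<^sup>+ s\<in>{0<..<t}. ennreal ((t - s) powr (a - 1))
              * S_op a (t - s) (fun_measure (\<lambda>y. ?u s y powr p)) x \<partial>lborel)"
        unfolding 1 2 using Ufin picard_lim_eq[OF p, of ?f 1 t x] by simp
    qed
  qed
  moreover have "AE (t, x) in lborel. (t, x) \<in> cylinder T \<longrightarrow> ?u t x \<le> v t x" if v: "is_solution a p T (fun_measure f) v" for v
  proof -
    have "AE z in lborel. \<forall>n. z \<in> cylinder T \<longrightarrow> picard p 1 ?f n (fst z) (snd z) \<le> ennreal (v (fst z) (snd z))"
      using picard_le_solution[OF p v f] by (subst AE_all_countable) (simp add: case_prod_beta)
    then show ?thesis
    proof (eventually_elim, clarsimp)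
      fix t :: real and x :: 'a
      assume "(t, x) \<in> cylinder T" and le: "\<forall>n. picard p 1 ?f n t x \<le> ennreal (v t x)"
      then have "0 \<le> v t x" using v by (auto simp: is_solution_def)
      moreover have "?U t x \<le> ennreal (v t x)" unfolding picard_lim_def using le by (intro SUP_least) auto
      ultimately show "?u t x \<le> v t x" using enn2real_mono[of "?U t x" "ennreal (v t x)"] by simp
    qed
  qed
  ultimately show ?thesis unfolding is_minimal_solution_def by auto
qed

end

section \<open>Existence for data of small local mass\<close>

lemma nn_integral_powr_from_0:
  fixes r c :: real
  assumes "- 1 < r" "0 \<le> c"
  shows "(\<integral>\<^sup>+s. ennreal (s powr r) * indicator {0<..c} s \<partial>lborel) = ennreal (c powr (r + 1) / (r + 1))"
proof -
  have "(\<integral>\<^sup>+s. ennreal (indicator {0..c} s * s powr r) \<partial>lborel) = ennreal (c powr (r + 1) / (r + 1))"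
    using nn_integral_has_integral_lebesgue[OF _ has_integral_powr_from_0[OF assms]] by simp
  also have "(\<integral>\<^sup>+s. ennreal (indicator {0..c} s * s powr r) \<partial>lborel) = (\<integral>\<^sup>+s. ennreal (s powr r) * indicator {0<..c} s \<partial>lborel)"
    by (intro nn_integral_cong) (auto split: split_indicator)
  finally show ?thesis .
qed

lemma nn_integral_powr_to:
  fixes g c t :: real
  assumes "0 < g" "0 \<le> c"
  shows "(\<integral>\<^sup>+s. ennreal ((t - s) powr (g - 1)) * indicator {t - c..<t} s \<partial>lborel) = ennreal (c powr g / g)"
proof -
  have "(\<integral>\<^sup>+s. ennreal ((t - s) powr (g - 1)) * indicator {t - c..<t} s \<partial>lborel)
    = (\<integral>\<^sup>+s. ennreal (s powr (g - 1)) * indicator {0<..c} s \<partial>lborel)"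
    by (subst nn_integral_real_affine[where c = "- 1" and t = t]) (auto intro!: nn_integral_cong split: split_indicator)
  also have "\<dots> = ennreal (c powr g / g)" using nn_integral_powr_from_0[of "g - 1" c] assms by simp
  finally show ?thesis .
qed

text \<open>Splitting at \<open>t / 2\<close>: on each half one of the two factors is at most its
  value at \<open>t / 2\<close>. The half near 0 contributes \<open>1 / (1 - a)\<close>, the half
  near \<open>t\<close> contributes \<open>1 / g\<close>.\<close>

lemma nn_integral_singular_le:
  fixes g a t :: real
  assumes g: "0 < g" "g \<le> 1" and a: "0 < a" "a < 1" and t: "0 < t"
  shows "(\<integral>\<^sup>+s. ennreal ((t - s) powr (g - 1) * s powr (- a)) * indicator {0<..<t} s \<partial>lborel)
    \<le> ennreal ((t / 2) powr (g - a) * (1 / (1 - a) + 1 / g))"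
proof -
  define c where "c = t / 2"
  have c: "0 < c" using t by (simp add: c_def)
  have "(\<integral>\<^sup>+s. ennreal ((t - s) powr (g - 1) * s powr (- a)) * indicator {0<..<t} s \<partial>lborel)
    \<le> (\<integral>\<^sup>+s. ennreal (c powr (g - 1)) * (ennreal (s powr (- a)) * indicator {0<..c} s)
        + ennreal (c powr (- a)) * (ennreal ((t - s) powr (g - 1)) * indicator {t - c..<t} s) \<partial>lborel)"
  proof (intro nn_integral_mono)
    fix s
    consider "s \<in> {0<..c}" | "s \<in> {c<..<t}" | "s \<notin> {0<..<t}" using c t by (force simp: c_def)
    then show "ennreal ((t - s) powr (g - 1) * s powr (- a)) * indicator {0<..<t} s
      \<le> ennreal (c powr (g - 1)) * (ennreal (s powr (- a)) * indicator {0<..c} s)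
        + ennreal (c powr (- a)) * (ennreal ((t - s) powr (g - 1)) * indicator {t - c..<t} s)"
    proof cases
      case 1
      then have "(t - s) powr (g - 1) \<le> c powr (g - 1)"
        using g c by (intro powr_mono2') (auto simp: c_def)
      then have "ennreal ((t - s) powr (g - 1) * s powr (- a)) \<le> ennreal (c powr (g - 1)) * ennreal (s powr (- a))"
        by (simp add: ennreal_mult'[symmetric] ennreal_leI mult_right_mono)
      then show ?thesis using 1 t by (auto simp: c_def add_increasing2)
    next
      case 2
      then have "s powr (- a) \<le> c powr (- a)" using a c by (intro powr_mono2') auto
      then have "ennreal ((t - s) powr (g - 1) * s powr (- a)) \<le> ennreal (c powr (- a)) * ennreal ((t - s) powr (g - 1))"
        by (simp add: ennreal_mult'[symmetric] ennreal_leI mult.commute mult_right_mono)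
      then show ?thesis using 2 c by (auto simp: c_def add_increasing)
    qed simp
  qed
  also have "\<dots> = ennreal (c powr (g - 1)) * ennreal (c powr (- a + 1) / (- a + 1)) + ennreal (c powr (- a)) * ennreal (c powr g / g)"
    using nn_integral_powr_from_0[of "- a" c] nn_integral_powr_to[of g c t] a g c
    by (subst nn_integral_add, measurable, subst (1 2) nn_integral_cmult) auto
  also have "\<dots> = ennreal (c powr (g - 1) * (c powr (- a + 1) / (- a + 1)) + c powr (- a) * (c powr g / g))"
    using a g by (simp add: ennreal_mult'[symmetric] ennreal_plus[symmetric] del: ennreal_plus)
  also have "c powr (g - 1) * (c powr (- a + 1) / (- a + 1)) + c powr (- a) * (c powr g / g) = c powr (g - a) * (1 / (1 - a) + 1 / g)"
    by (simp add: distrib_left powr_add[symmetric] times_divide_eq_right)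
  finally show ?thesis by (simp add: c_def)
qed

text \<open>The bound of \<open>neg_moment\<close> for the order \<open>1 / p\<close>.\<close>

definition evol_const :: "real \<Rightarrow> real" where
  "evol_const p = 1 + 6 * 2 powr (1 / p) / (1 - 2 powr (1 / p - 1))"

text \<open>\<open>8 = 4 * 2\<close>: the negative moment of \<open>w1\<close> is at most 4, and
  replacing \<open>t / 2\<close> by \<open>t\<close> costs at most 2. The bracket collects the two
  halves of \<open>nn_integral_singular_le\<close> after a factor \<open>1 / (1 - a)\<close> is
  split off.\<close>

definition duhamel_const :: "real \<Rightarrow> real" where
  "duhamel_const p = 8 * (1 + 2 * p / (p - 1))"

lemma evol_const_pos: "1 < p \<Longrightarrow> 0 < evol_const p"
proof -
  assume p: "1 < p"
  then have "2 powr (1 / p - 1) < 2 powr (0 :: real)" by (intro powr_less_mono) (auto simp: field_simps)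
  then have "0 \<le> 6 * 2 powr (1 / p) / (1 - 2 powr (1 / p - 1))" by (intro divide_nonneg_pos) auto
  then show ?thesis by (simp add: evol_const_def)
qed

lemma duhamel_const_pos: "1 < p \<Longrightarrow> 0 < duhamel_const p"
  by (simp add: duhamel_const_def add_pos_nonneg)

context fractional
begin

section \<open>Integrated powers of the two operators\<close>

lemma w0_mass: "(\<integral>\<^sup>+\<theta>. w0 \<theta> \<partial>lborel) = 1"
  using h_mass by (simp add: w0_def)

lemma w1_mass: "(\<integral>\<^sup>+\<theta>. w1 \<theta> \<partial>lborel) \<le> 3"
  using first_moment by (simp add: w1_def)

lemma w0_neg_moment:
  assumes p: "1 < p"
  shows "(\<integral>\<^sup>+\<theta>. w0 \<theta> * ennreal (\<theta> powr (- 1 / p)) \<partial>lborel) \<le> ennreal (evol_const p)"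
proof -
  have "(\<integral>\<^sup>+\<theta>. w0 \<theta> * ennreal (\<theta> powr (- 1 / p)) \<partial>lborel) = (\<integral>\<^sup>+\<theta>\<in>{0<..}. ennreal (\<theta> powr (- (1 / p)) * subordination_density a \<theta>) \<partial>lborel)"
    by (intro nn_integral_cong) (auto simp: w0_def ennreal_mult'' mult_ac split: split_indicator)
  also have "\<dots> \<le> ennreal (evol_const p)"
    using neg_moment[of "1 / p"] p by (simp add: evol_const_def)
  finally show ?thesis .
qed

text \<open>\<open>\<theta> powr (1 - 1 / p) \<le> 1 + \<theta>\<close>: the additional factor
  \<open>\<theta>\<close> in \<open>w1\<close> absorbs the singularity, and the masses of
  \<open>w0\<close> and \<open>w1\<close> add up to at most 4.\<close>

lemma w1_neg_moment:
  assumes p: "1 < p"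
  shows "(\<integral>\<^sup>+\<theta>. w1 \<theta> * ennreal (\<theta> powr (- 1 / p)) \<partial>lborel) \<le> ennreal 4"
proof -
  have "(\<integral>\<^sup>+\<theta>. w1 \<theta> * ennreal (\<theta> powr (- 1 / p)) \<partial>lborel) \<le> (\<integral>\<^sup>+\<theta>. w0 \<theta> + w1 \<theta> \<partial>lborel)"
  proof (intro nn_integral_mono)
    fix \<theta>
    show "w1 \<theta> * ennreal (\<theta> powr (- 1 / p)) \<le> w0 \<theta> + w1 \<theta>"
    proof (cases "0 < \<theta>")
      case True
      have "\<theta> * \<theta> powr (- 1 / p) = \<theta> powr (1 - 1 / p)" using True by (simp add: powr_diff powr_minus_divide)
      also have "\<dots> \<le> 1 + \<theta>"
      proof (cases "\<theta> \<le> 1")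
        case True
        then have "\<theta> powr (1 - 1 / p) \<le> 1 powr (1 - 1 / p)" using \<open>0 < \<theta>\<close> p by (intro powr_mono2) auto
        then show ?thesis using \<open>0 < \<theta>\<close> by simp
      next
        case False
        then have "\<theta> powr (1 - 1 / p) \<le> \<theta> powr 1" using p by (intro powr_mono) auto
        then show ?thesis using False by simp
      qed
      finally have "\<theta> * \<theta> powr (- 1 / p) * subordination_density a \<theta> \<le> (1 + \<theta>) * subordination_density a \<theta>"
        using h_pos[OF True] by (intro mult_right_mono) auto
      then have "ennreal (\<theta> * subordination_density a \<theta> * \<theta> powr (- 1 / p)) \<le> ennreal (subordination_density a \<theta> + \<theta> * subordination_density a \<theta>)"
        by (intro ennreal_leI) (simp add: algebra_simps)
      then show ?thesis using True h_pos[OF True] by (simp add: w0_def w1_def ennreal_mult'[symmetric] mult.commute)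
    qed (simp add: w0_def w1_def)
  qed
  also have "\<dots> = 1 + (\<integral>\<^sup>+\<theta>. w1 \<theta> \<partial>lborel)"
    by (subst nn_integral_add) (auto simp: w0_mass)
  also have "\<dots> \<le> 1 + 3" by (intro add_left_mono w1_mass)
  finally show ?thesis by simp
qed

lemma evolution_Lp:
  fixes f :: "'a::euclidean_space \<Rightarrow> ennreal"
  assumes p: "p = 1 + 2 / real DIM('a)" and t: "0 < t" and f[measurable]: "f \<in> borel_measurable borel"
    and fM: "(\<integral>\<^sup>+y. f y \<partial>lborel) \<le> ennreal M" and M: "0 < M"
  shows "(\<integral>\<^sup>+x. epow p (evolution f t x) \<partial>lborel) \<le> ennreal ((evol_const p * M) powr p * t powr (- a))"
proof -
  have p1: "1 < p" using p by simp
  have "(\<integral>\<^sup>+x. epow p (evolution f t x) \<partial>lborel) \<le> ennreal (((4 * pi * t powr a) powr (- 1 / p) * M * evol_const p) powr p)"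
    unfolding evolution_def
    by (rule subordinated_heat_Lp[OF p]) (use t fM M w0_neg_moment[OF p1] evol_const_pos[OF p1] in \<open>auto simp: w0_def\<close>)
  also have "\<dots> \<le> ennreal ((evol_const p * M) powr p * t powr (- a))"
  proof (rule ennreal_leI)
    have "(4 * pi * t powr a) powr (- 1 / p) \<le> (t powr a) powr (- 1 / p)"
      using p1 t pi_gt3 by (intro powr_mono2') auto
    then have "(4 * pi * t powr a) powr (- 1 / p) * (M * evol_const p) \<le> (t powr a) powr (- 1 / p) * (M * evol_const p)"
      using M evol_const_pos[OF p1] by (intro mult_right_mono) auto
    then have "((4 * pi * t powr a) powr (- 1 / p) * M * evol_const p) powr p \<le> ((evol_const p * M) * t powr (- a / p)) powr p"
      using p1 M evol_const_pos[OF p1] by (intro powr_mono2) (auto simp: powr_powr mult_ac)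
    also have "\<dots> = (evol_const p * M) powr p * (t powr (- a / p)) powr p"
      using M evol_const_pos[OF p1] by (simp only: powr_mult)
    also have "(t powr (- a / p)) powr p = t powr (- a)" using p1 by (simp add: powr_powr)
    finally show "((4 * pi * t powr a) powr (- 1 / p) * M * evol_const p) powr p \<le> (evol_const p * M) powr p * t powr (- a)" .
  qed
  finally show ?thesis .
qed

text \<open>This is where the factor \<open>1 / (1 - a)\<close> enters: \<open>s powr (- a)\<close> is barely integrable at \<open>0\<close>.\<close>

lemma duhamel_Lp:
  fixes g :: "real \<Rightarrow> 'a::euclidean_space \<Rightarrow> ennreal"
  assumes p: "p = 1 + 2 / real DIM('a)" and t: "0 < t" and g[measurable]: "case_prod g \<in> borel_measurable (borel \<Otimes>\<^sub>M borel)"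
    and gA: "\<And>s. 0 < s \<Longrightarrow> (\<integral>\<^sup>+y. g s y \<partial>lborel) \<le> ennreal (A * s powr (- a))" and A: "0 < A" and a2: "1 / 2 \<le> a"
  shows "(\<integral>\<^sup>+x. epow p (duhamel g t x) \<partial>lborel) \<le> ennreal ((duhamel_const p * A / (1 - a)) powr p * t powr (- a))"
proof -
  have p1: "1 < p" using p by simp
  have slice[measurable]: "g s \<in> borel_measurable borel" for s
    using measurable_compose[OF measurable_Pair1' g, of s] by simp
  let ?w = "\<lambda>s. ennreal ((t - s) powr (a - 1)) * indicator {0<..<t} s"
  let ?K = "duhamel_const p * A / (1 - a) * t powr (- a / p)"
  have K0: "0 < ?K" using t A a01 duhamel_const_pos[OF p1] by simp
  have "(\<integral>\<^sup>+x. epow p (duhamel g t x) \<partial>lborel) \<le> (\<integral>\<^sup>+x. epow p (\<integral>\<^sup>+s. ?w s * smoothing (t - s) (g s) x \<partial>lborel) \<partial>lborel)"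
  proof (intro nn_integral_mono epow_mono)
    fix x
    have "ennreal a * (\<integral>\<^sup>+s. ?w s * smoothing (t - s) (g s) x \<partial>lborel) \<le> 1 * (\<integral>\<^sup>+s. ?w s * smoothing (t - s) (g s) x \<partial>lborel)"
      using a01 by (intro mult_right_mono) (auto simp flip: ennreal_1 intro!: ennreal_leI)
    then show "duhamel g t x \<le> (\<integral>\<^sup>+s. ?w s * smoothing (t - s) (g s) x \<partial>lborel)"
      by (simp add: duhamel_def)
  qed (use p1 in simp)
  also have "\<dots> \<le> ennreal (?K powr p)"
  proof (rule minkowski_epow[where g = "\<lambda>s. (4 * pi * (t - s) powr a) powr (- 1 / p) * (A * s powr (- a)) * 4"])
    show "1 < p" by fact
    show "sigma_finite_measure (lborel :: real measure)" "sigma_finite_measure (lborel :: 'a measure)"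
      by (rule lborel.sigma_finite_measure_axioms)+
    fix s assume "?w s \<noteq> 0"
    then have s: "0 < s" "s < t" by (auto split: split_indicator_asm)
    show "0 < (4 * pi * (t - s) powr a) powr (- 1 / p) * (A * s powr (- a)) * 4"
      using s A by simp
    show "(\<integral>\<^sup>+x. epow p (smoothing (t - s) (g s) x) \<partial>lborel) \<le> ennreal (((4 * pi * (t - s) powr a) powr (- 1 / p) * (A * s powr (- a)) * 4) powr p)"
      unfolding smoothing_def
      by (rule subordinated_heat_Lp[OF p]) (use s A gA[OF s(1)] w1_neg_moment[OF p1] in \<open>auto simp: w1_def\<close>)
  next
    \<comment> \<open>The kernel exponent \<open>a - 1\<close> and the decay exponent
      \<open>- a / p\<close> of \<open>smoothing\<close> add up to \<open>\<gamma> - 1\<close>.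
      Since \<open>\<gamma> - a = - a / p\<close>, the time integral reproduces the decay required
      for \<open>t powr (- a)\<close>.\<close>
    define \<gamma> where "\<gamma> = a * (1 - 1 / p)"
    have \<gamma>: "0 < \<gamma>" "\<gamma> \<le> 1" using a01 p1 by (auto simp: \<gamma>_def intro!: mult_le_one)
    have "(\<integral>\<^sup>+s. ?w s * ennreal ((4 * pi * (t - s) powr a) powr (- 1 / p) * (A * s powr (- a)) * 4) \<partial>lborel)
      \<le> (\<integral>\<^sup>+s. ennreal (4 * A) * (ennreal ((t - s) powr (\<gamma> - 1) * s powr (- a)) * indicator {0<..<t} s) \<partial>lborel)"
    proof (intro nn_integral_mono)
      fix s
      show "?w s * ennreal ((4 * pi * (t - s) powr a) powr (- 1 / p) * (A * s powr (- a)) * 4)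
        \<le> ennreal (4 * A) * (ennreal ((t - s) powr (\<gamma> - 1) * s powr (- a)) * indicator {0<..<t} s)"
      proof (cases "s \<in> {0<..<t}")
        case True
        have "(4 * pi * (t - s) powr a) powr (- 1 / p) \<le> ((t - s) powr a) powr (- 1 / p)"
          using p1 True pi_gt3 by (intro powr_mono2') auto
        then have "(t - s) powr (a - 1) * (4 * pi * (t - s) powr a) powr (- 1 / p) \<le> (t - s) powr (a - 1) * ((t - s) powr a) powr (- 1 / p)"
          by (intro mult_left_mono) auto
        also have "\<dots> = (t - s) powr (\<gamma> - 1)"
          by (simp add: powr_powr powr_add[symmetric] \<gamma>_def algebra_simps)
        finally have "((t - s) powr (a - 1) * (4 * pi * (t - s) powr a) powr (- 1 / p)) * (4 * A * s powr (- a)) \<le> (t - s) powr (\<gamma> - 1) * (4 * A * s powr (- a))"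
          using A by (intro mult_right_mono) auto
        then have "ennreal ((t - s) powr (a - 1) * ((4 * pi * (t - s) powr a) powr (- 1 / p) * (A * s powr (- a)) * 4))
          \<le> ennreal (4 * A * ((t - s) powr (\<gamma> - 1) * s powr (- a)))"
          by (intro ennreal_leI) (simp add: mult_ac)
        then show ?thesis using True A by (simp add: ennreal_mult')
      qed simp
    qed
    also have "\<dots> = ennreal (4 * A) * (\<integral>\<^sup>+s. ennreal ((t - s) powr (\<gamma> - 1) * s powr (- a)) * indicator {0<..<t} s \<partial>lborel)"
      by (rule nn_integral_cmult) measurable
    also have "\<dots> \<le> ennreal (4 * A) * ennreal ((t / 2) powr (\<gamma> - a) * (1 / (1 - a) + 1 / \<gamma>))"
      by (intro mult_left_mono nn_integral_singular_le \<gamma> a01 t) simp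
    also have "\<dots> = ennreal (4 * A * ((t / 2) powr (\<gamma> - a) * (1 / (1 - a) + 1 / \<gamma>)))"
      using A by (simp add: ennreal_mult')
    also have "\<dots> \<le> ennreal ?K"
    proof (rule ennreal_leI)
      define B where "B = 1 + 2 * p / (p - 1)"
      have dc: "duhamel_const p = 8 * B" by (simp only: duhamel_const_def B_def)
      have e: "\<gamma> - a = - a / p" by (simp add: \<gamma>_def algebra_simps)
      have "(t / 2) powr (- a / p) = t powr (- a / p) * 2 powr (a / p)"
        using t by (simp add: powr_divide powr_minus_divide)
      moreover have "2 powr (a / p) \<le> 2 powr 1" using a01 p1 by (intro powr_mono) (auto simp: field_simps)
      ultimately have 1: "(t / 2) powr (\<gamma> - a) \<le> t powr (- a / p) * 2"
        unfolding e by (simp add: mult_left_mono)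
      \<comment> \<open>Here \<open>1 / 2 \<le> a\<close> enters: it bounds
        \<open>1 / \<gamma>\<close> in terms of \<open>p\<close>, so that \<open>1 - a\<close> is
        the only small denominator.\<close>
      have "1 / \<gamma> = 1 / a * (p / (p - 1))" using p1 a01 by (simp add: \<gamma>_def field_simps)
      also have "\<dots> \<le> 2 * (p / (p - 1))" using p1 a2 a01 by (intro mult_right_mono) (auto simp: field_simps)
      also have "\<dots> \<le> 2 * (p / (p - 1)) / (1 - a)" using p1 a01 by (simp add: le_divide_eq mult_left_le)
      finally have "1 / (1 - a) + 1 / \<gamma> \<le> B / (1 - a)" by (simp add: B_def add_divide_distrib)
      with 1 have "(t / 2) powr (\<gamma> - a) * (1 / (1 - a) + 1 / \<gamma>) \<le> t powr (- a / p) * 2 * (B / (1 - a))"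
        using \<gamma> a01 by (intro mult_mono) auto
      then have "4 * A * ((t / 2) powr (\<gamma> - a) * (1 / (1 - a) + 1 / \<gamma>)) \<le> 4 * A * (t powr (- a / p) * 2 * (B / (1 - a)))"
        using A by (intro mult_left_mono) auto
      then show "4 * A * ((t / 2) powr (\<gamma> - a) * (1 / (1 - a) + 1 / \<gamma>)) \<le> ?K"
        by (simp add: dc mult_ac)
    qed
    finally show "(\<integral>\<^sup>+s. ?w s * ennreal ((4 * pi * (t - s) powr a) powr (- 1 / p) * (A * s powr (- a)) * 4) \<partial>lborel) \<le> ennreal ?K" .
    show "0 < ?K" by fact
  qed measurable
  also have "?K powr p = (duhamel_const p * A / (1 - a)) powr p * t powr (- a)"
  proof -
    have "?K powr p = (duhamel_const p * A / (1 - a)) powr p * (t powr (- a / p)) powr p"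
      using A a01 duhamel_const_pos[OF p1] by (simp only: powr_mult)
    also have "(t powr (- a / p)) powr p = t powr (- a)" using p1 by (simp add: powr_powr)
    finally show ?thesis .
  qed
  finally show ?thesis .
qed

end

context fractional
begin

section \<open>Bounded data and the splitting of the iteration\<close>

lemma evolution_add:
  assumes [measurable]: "f \<in> borel_measurable borel" "g \<in> borel_measurable borel"
  shows "evolution (\<lambda>y. f y + g y) t x = evolution f t x + evolution g t x"
proof -
  have "heat_conv s (\<lambda>y. f y + g y) x = heat_conv s f x + heat_conv s g x" for s
    unfolding heat_conv_def distrib_left by (rule nn_integral_add) measurable
  then show ?thesis unfolding evolution_def distrib_left by (simp add: distrib_left nn_integral_add)
qed

lemma evolution_le_const:
  assumes "\<And>y. f y \<le> c" "0 < t"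
  shows "evolution f t x \<le> c"
proof -
  have "evolution f t x \<le> (\<integral>\<^sup>+\<theta>. w0 \<theta> * c \<partial>lborel)"
    unfolding evolution_def
  proof (intro nn_integral_mono)
    fix \<theta>
    show "w0 \<theta> * heat_conv (t powr a * \<theta>) f x \<le> w0 \<theta> * c"
      using heat_conv_mono[of f "\<lambda>_. c" "t powr a * \<theta>" x] heat_conv_const[of "t powr a * \<theta>" c x] assms
      by (cases "0 < \<theta>") (auto simp: w0_def intro!: mult_left_mono)
  qed
  also have "\<dots> = c" by (simp add: nn_integral_multc w0_mass)
  finally show ?thesis .
qed

lemma smoothing_const_le:
  assumes "0 < t"
  shows "smoothing t (\<lambda>_. c) x \<le> 3 * c"
proof -
  have "smoothing t (\<lambda>_. c) x = (\<integral>\<^sup>+\<theta>. w1 \<theta> * c \<partial>lborel)"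
    unfolding smoothing_def using assms
    by (intro nn_integral_cong) (auto simp: w1_def heat_conv_const split: split_indicator)
  also have "\<dots> \<le> 3 * c" using w1_mass by (simp add: nn_integral_multc mult_right_mono)
  finally show ?thesis .
qed

lemma duhamel_const_le:
  assumes t: "0 < t"
  shows "duhamel (\<lambda>_ _. c) t x \<le> ennreal (3 * t powr a) * c"
proof -
  \<comment> \<open>The lower end is written \<open>t - t\<close> so that
    \<open>nn_integral_powr_to\<close> applies with \<open>c = t\<close>; including
    \<open>s = 0\<close> is harmless for an upper bound.\<close>
  have "duhamel (\<lambda>_ _. c) t x \<le> ennreal a * (\<integral>\<^sup>+s. (ennreal ((t - s) powr (a - 1)) * indicator {t - t..<t} s) * (3 * c) \<partial>lborel)"
    unfolding duhamel_def
  proof (intro mult_left_mono nn_integral_mono)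
    fix s
    show "ennreal ((t - s) powr (a - 1)) * indicator {0<..<t} s * smoothing (t - s) (\<lambda>_. c) x
      \<le> ennreal ((t - s) powr (a - 1)) * indicator {t - t..<t} s * (3 * c)"
      by (cases "s \<in> {0<..<t}") (auto intro!: mult_left_mono smoothing_const_le)
  qed simp
  also have "\<dots> = ennreal a * (ennreal (t powr a / a) * (3 * c))"
    using a01 t nn_integral_powr_to[of a t t] by (subst nn_integral_multc) auto
  also have "\<dots> = ennreal (3 * t powr a) * c"
  proof -
    have "ennreal a * ennreal (t powr a / a) = ennreal (t powr a)" using a01 by (simp add: ennreal_mult'[symmetric])
    then show ?thesis by (simp add: mult.assoc[symmetric] ennreal_mult') (simp add: mult_ac)
  qed
  finally show ?thesis .
qed

lemma smoothing_affine:
  assumes [measurable]: "g \<in> borel_measurable borel"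
  shows "smoothing t (\<lambda>y. c * (g y + k)) x = c * (smoothing t g x + smoothing t (\<lambda>_. k) x)"
proof -
  have "heat_conv s (\<lambda>y. c * (g y + k)) x = c * (heat_conv s g x + heat_conv s (\<lambda>_. k) x)" for s
  proof -
    have "heat_conv s (\<lambda>y. c * (g y + k)) x = (\<integral>\<^sup>+y. c * (ennreal (heat_kernel s (x - y)) * g y + ennreal (heat_kernel s (x - y)) * k) \<partial>lborel)"
      unfolding heat_conv_def by (intro nn_integral_cong) (simp add: distrib_left mult_ac)
    also have "\<dots> = c * (heat_conv s g x + heat_conv s (\<lambda>_. k) x)"
      unfolding heat_conv_def by (subst nn_integral_cmult, measurable, subst nn_integral_add) auto
    finally show ?thesis .
  qed
  then have "smoothing t (\<lambda>y. c * (g y + k)) x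
    = (\<integral>\<^sup>+\<theta>. c * (w1 \<theta> * heat_conv (t powr a * \<theta>) g x + w1 \<theta> * heat_conv (t powr a * \<theta>) (\<lambda>_. k) x) \<partial>lborel)"
    unfolding smoothing_def by (intro nn_integral_cong) (simp add: distrib_left mult_ac)
  also have "\<dots> = c * (smoothing t g x + smoothing t (\<lambda>_. k) x)"
    unfolding smoothing_def by (subst nn_integral_cmult, measurable, subst nn_integral_add) auto
  finally show ?thesis .
qed

lemma duhamel_affine:
  fixes g :: "real \<Rightarrow> 'a::euclidean_space \<Rightarrow> ennreal"
  assumes g[measurable]: "case_prod g \<in> borel_measurable (borel \<Otimes>\<^sub>M borel)"
  shows "duhamel (\<lambda>s y. c * (g s y + k)) t x = c * (duhamel g t x + duhamel (\<lambda>_ _. k) t x)"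
proof -
  have [measurable]: "g s \<in> borel_measurable borel" for s
    using measurable_compose[OF measurable_Pair1' g, of s] by simp
  let ?w = "\<lambda>s. ennreal ((t - s) powr (a - 1)) * indicator {0<..<t} s"
  have sm: "smoothing (t - s) (\<lambda>y. c * (g s y + k)) x = c * (smoothing (t - s) (g s) x + smoothing (t - s) (\<lambda>_. k) x)" for s
    by (rule smoothing_affine) measurable
  have "duhamel (\<lambda>s y. c * (g s y + k)) t x
    = ennreal a * (\<integral>\<^sup>+s. c * (?w s * smoothing (t - s) (g s) x + ?w s * smoothing (t - s) (\<lambda>_. k) x) \<partial>lborel)"
    unfolding duhamel_def sm
    by (intro arg_cong[where f = "\<lambda>z. ennreal a * z"] nn_integral_cong) (simp add: distrib_left mult_ac)
  also have "\<dots> = c * (duhamel g t x + duhamel (\<lambda>_ _. k) t x)"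
    unfolding duhamel_def
    by (subst nn_integral_cmult, measurable, subst nn_integral_add) (auto simp: distrib_left mult_ac)
  finally show ?thesis .
qed

text \<open>The factor \<open>2 powr (p - 1)\<close> is the price of splitting a \<open>p\<close>-th power by convexity.\<close>

lemma picard_le_split:
  fixes f1 f2 :: "'a::euclidean_space \<Rightarrow> ennreal"
  assumes p: "1 < p" and f[measurable]: "f1 \<in> borel_measurable borel" "f2 \<in> borel_measurable borel"
    and f2: "\<And>y. f2 y \<le> ennreal b" and b: "0 < b" and small: "3 * 2 powr (p - 1) * (2 * b) powr p * T powr a \<le> b"
  shows "0 < t \<Longrightarrow> t \<le> T \<Longrightarrow> picard p 1 (\<lambda>y. f1 y + f2 y) n t x \<le> picard p (2 powr (p - 1)) f1 n t x + ennreal (2 * b)"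
proof (induction n arbitrary: t x)
  case (Suc n)
  let ?c = "2 powr (p - 1)"
  let ?V = "picard p ?c f1 n"
  have m: "(\<lambda>(s, y). epow p (?V s y)) \<in> borel_measurable (borel \<Otimes>\<^sub>M borel)" by measurable
  have "duhamel (\<lambda>s y. epow p (picard p 1 (\<lambda>y. f1 y + f2 y) n s y)) t x
    \<le> duhamel (\<lambda>s y. ennreal ?c * (epow p (?V s y) + epow p (ennreal (2 * b)))) t x"
  proof (rule duhamel_mono)
    fix s y assume s: "0 < s" "s < t"
    have "epow p (picard p 1 (\<lambda>y. f1 y + f2 y) n s y) \<le> epow p (?V s y + ennreal (2 * b))"
      using Suc.IH[of s y] s Suc.prems p by (intro epow_mono) auto
    also have "\<dots> \<le> ennreal ?c * (epow p (?V s y) + epow p (ennreal (2 * b)))" by (rule epow_add_le[OF p])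
    finally show "epow p (picard p 1 (\<lambda>y. f1 y + f2 y) n s y) \<le> ennreal ?c * (epow p (?V s y) + epow p (ennreal (2 * b)))" .
  qed
  also have "\<dots> = ennreal ?c * (duhamel (\<lambda>s y. epow p (?V s y)) t x + duhamel (\<lambda>_ _. epow p (ennreal (2 * b))) t x)"
    by (rule duhamel_affine[OF m])
  also have "\<dots> \<le> ennreal ?c * duhamel (\<lambda>s y. epow p (?V s y)) t x + ennreal b"
  proof -
    have "ennreal ?c * duhamel (\<lambda>_ _. epow p (ennreal (2 * b))) t x \<le> ennreal ?c * (ennreal (3 * t powr a) * ennreal ((2 * b) powr p))"
      using duhamel_const_le[OF Suc.prems(1), of "epow p (ennreal (2 * b))" x] b by (intro mult_left_mono) (auto simp: epow_ennreal)
    also have "\<dots> = ennreal (3 * ?c * (2 * b) powr p * t powr a)"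
      by (simp add: ennreal_mult'[symmetric] mult_ac)
    also have "\<dots> \<le> ennreal (3 * ?c * (2 * b) powr p * T powr a)"
      using Suc.prems a01 by (intro ennreal_leI mult_left_mono powr_mono2) auto
    also have "\<dots> \<le> ennreal b" using small by (rule ennreal_leI)
    finally show ?thesis by (simp add: distrib_left add_left_mono)
  qed
  finally have "picard p 1 (\<lambda>y. f1 y + f2 y) (Suc n) t x
    \<le> (evolution f1 t x + evolution f2 t x) + (ennreal ?c * duhamel (\<lambda>s y. epow p (?V s y)) t x + ennreal b)"
    by (simp add: evolution_add add_left_mono)
  \<comment> \<open>The evolution of \<open>f2\<close> contributes one \<open>b\<close>, the
    constant part of the nonlinearity the other by \<open>small\<close>; together they restore
    \<open>2 * b\<close>.\<close>
  also have "\<dots> \<le> (evolution f1 t x + ennreal b) + (ennreal ?c * duhamel (\<lambda>s y. epow p (?V s y)) t x + ennreal b)"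
    using f2 Suc.prems by (intro add_right_mono add_left_mono evolution_le_const) auto
  also have "\<dots> = picard p ?c f1 (Suc n) t x + (ennreal b + ennreal b)" by (simp add: add_ac)
  also have "ennreal b + ennreal b = ennreal (2 * b)" using b by (simp flip: ennreal_plus)
  finally show ?case .
qed simp

end

text \<open>Chosen such that the Duhamel term takes at most half of the bound that is propagated in
  \<open>picard_Lp\<close>.\<close>

definition mass_const :: "real \<Rightarrow> real" where
  "mass_const p = 1 / ((2 * evol_const p) powr (p - 1) * (2 * 2 powr (p - 1) * duhamel_const p))"

text \<open>The hypothesis \<open>small\<close> of \<open>picard_le_split\<close>, divided by
  \<open>b\<close>, as a bound for \<open>b powr (p - 1) * T powr a\<close>.\<close>

definition sup_const :: "real \<Rightarrow> real" where
  "sup_const p = 1 / (3 * 2 powr (p - 1) * 2 powr p)"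

lemma mass_const_pos: "1 < p \<Longrightarrow> 0 < mass_const p"
  using evol_const_pos[of p] duhamel_const_pos[of p] by (simp add: mass_const_def)

lemma sup_const_pos: "0 < sup_const p"
  by (simp add: sup_const_def)

context fractional
begin

text \<open>The bound reproduces itself with \<open>A = (2 * evol_const p * M) powr p\<close>. After
  the power of the sum is split, the evolution contributes \<open>A / 2\<close>; the Duhamel term
  scales like \<open>A powr p\<close>, and the smallness of \<open>M\<close> brings it down to
  another \<open>A / 2\<close>.\<close>

lemma picard_Lp:
  fixes f :: "'a::euclidean_space \<Rightarrow> ennreal"
  assumes p: "p = 1 + 2 / real DIM('a)" and a2: "1 / 2 \<le> a" and f[measurable]: "f \<in> borel_measurable borel"
    and fM: "(\<integral>\<^sup>+y. f y \<partial>lborel) \<le> ennreal M" and M: "0 < M" and small: "M powr (p - 1) \<le> mass_const p * (1 - a)"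
  shows "0 < t \<Longrightarrow> (\<integral>\<^sup>+x. epow p (picard p (2 powr (p - 1)) f n t x) \<partial>lborel) \<le> ennreal ((2 * evol_const p * M) powr p * t powr (- a))"
proof (induction n arbitrary: t)
  case (Suc n)
  have p1: "1 < p" using p by simp
  define c where "c = 2 powr (p - 1)"
  define d where "d = duhamel_const p"
  define m where "m = evol_const p * M"
  define A where "A = (2 * m) powr p"
  have c: "0 < c" and d: "0 < d" and m: "0 < m" and A: "0 < A"
    using M evol_const_pos[OF p1] duhamel_const_pos[OF p1] by (auto simp: c_def d_def m_def A_def)
  let ?V = "picard p c f n"
  have meas: "(\<lambda>(s, y). epow p (?V s y)) \<in> borel_measurable (borel \<Otimes>\<^sub>M borel)" by measurable
  have IH: "(\<integral>\<^sup>+x. epow p (?V s x) \<partial>lborel) \<le> ennreal (A * s powr (- a))" if "0 < s" for s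
    using Suc.IH[OF that] by (simp add: c_def A_def m_def mult.assoc)
  have real: "c * (m powr p + c powr p * (d * A / (1 - a)) powr p) \<le> A"
  proof -
    have h1: "c * m powr p = A / 2" using m by (simp add: c_def A_def powr_mult powr_diff)
    have "M powr (p - 1) * ((2 * evol_const p) powr (p - 1) * (2 * c * d)) \<le> 1 - a"
      using small evol_const_pos[OF p1] c d unfolding mass_const_def c_def[symmetric] d_def[symmetric]
      by (simp add: field_simps)
    moreover have "M powr (p - 1) * (2 * evol_const p) powr (p - 1) = (2 * m) powr (p - 1)"
      unfolding m_def by (simp add: powr_mult[symmetric] mult_ac)
    ultimately have "(2 * m) powr (p - 1) * (2 * c * d) \<le> 1 - a" by (simp add: mult.assoc[symmetric])
    then have "(2 * m) powr (p - 1) * (2 * c * d) * (2 * m) \<le> (1 - a) * (2 * m)" using m by (intro mult_right_mono) auto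
    moreover have "2 * c * d * A = (2 * m) powr (p - 1) * (2 * c * d) * (2 * m)"
      using m by (simp add: A_def powr_diff)
    ultimately have "2 * c * d * A \<le> (1 - a) * (2 * m)" by (simp only:)
    then have "2 * (c * (d * A / (1 - a))) \<le> 2 * m" using a01 by (simp add: field_simps)
    then have "(2 * (c * (d * A / (1 - a)))) powr p \<le> A"
      unfolding A_def using p1 c d A a01 by (intro powr_mono2) (auto simp: A_def[symmetric])
    moreover have "(2 * (c * (d * A / (1 - a)))) powr p = 2 * (c * (c powr p * (d * A / (1 - a)) powr p))"
    proof -
      have "2 powr p = 2 * c" by (simp add: c_def powr_diff)
      then show ?thesis by (simp only: powr_mult mult.assoc)
    qed
    ultimately show ?thesis using h1 by (simp add: distrib_left)
  qed
  have "(\<integral>\<^sup>+x. epow p (picard p c f (Suc n) t x) \<partial>lborel)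
    \<le> (\<integral>\<^sup>+x. ennreal c * (epow p (evolution f t x) + ennreal (c powr p) * epow p (duhamel (\<lambda>s y. epow p (?V s y)) t x)) \<partial>lborel)"
  proof (intro nn_integral_mono)
    fix x
    show "epow p (picard p c f (Suc n) t x) \<le> ennreal c * (epow p (evolution f t x) + ennreal (c powr p) * epow p (duhamel (\<lambda>s y. epow p (?V s y)) t x))"
      using epow_add_le[OF p1, of "evolution f t x" "ennreal c * duhamel (\<lambda>s y. epow p (?V s y)) t x"] c
      by (simp add: epow_mult c_def)
  qed
  also have "\<dots> = ennreal c * ((\<integral>\<^sup>+x. epow p (evolution f t x) \<partial>lborel) + ennreal (c powr p) * (\<integral>\<^sup>+x. epow p (duhamel (\<lambda>s y. epow p (?V s y)) t x) \<partial>lborel))"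
    using meas by (subst nn_integral_cmult, measurable, subst nn_integral_add, measurable, subst nn_integral_cmult) auto
  also have "\<dots> \<le> ennreal c * (ennreal (m powr p * t powr (- a)) + ennreal (c powr p) * ennreal ((d * A / (1 - a)) powr p * t powr (- a)))"
    unfolding m_def d_def
    by (intro mult_left_mono add_mono evolution_Lp[OF p Suc.prems f fM M] duhamel_Lp[OF p Suc.prems meas IH A a2]) auto
  also have "\<dots> = ennreal (c * (m powr p + c powr p * (d * A / (1 - a)) powr p) * t powr (- a))"
    using c by (simp add: ennreal_mult'[symmetric] ennreal_plus[symmetric] algebra_simps del: ennreal_plus)
  also have "\<dots> \<le> ennreal (A * t powr (- a))"
    using real by (intro ennreal_leI mult_right_mono) auto
  finally show ?case by (simp add: c_def A_def m_def mult.assoc del: picard.simps)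
qed simp

text \<open>The bound of \<open>picard_Lp\<close> is uniform in \<open>n\<close> and survives
  monotone convergence; a finite integral excludes the value \<open>top\<close> almost
  everywhere.\<close>

lemma picard_lim_finite:
  fixes f :: "'a::euclidean_space \<Rightarrow> ennreal"
  assumes p: "p = 1 + 2 / real DIM('a)" and a2: "1 / 2 \<le> a" and f[measurable]: "f \<in> borel_measurable borel"
    and fM: "(\<integral>\<^sup>+y. f y \<partial>lborel) \<le> ennreal M" and M: "0 < M" and small: "M powr (p - 1) \<le> mass_const p * (1 - a)"
    and t: "0 < t"
  shows "AE x in lborel. picard_lim p (2 powr (p - 1)) f t x < top"
proof -
  have p1: "1 < p" using p by simp
  let ?c = "2 powr (p - 1)"
  have slice[measurable]: "picard p ?c f n t \<in> borel_measurable borel" for n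
    using measurable_compose[OF measurable_Pair1' picard_measurable[OF f, of p ?c n], of t] by simp
  have "(\<integral>\<^sup>+x. epow p (picard_lim p ?c f t x) \<partial>lborel) = (\<integral>\<^sup>+x. (SUP n. epow p (picard p ?c f n t x)) \<partial>lborel)"
    using p1 by (simp add: picard_lim_def epow_SUP)
  also have "\<dots> = (SUP n. \<integral>\<^sup>+x. epow p (picard p ?c f n t x) \<partial>lborel)"
  proof (rule nn_integral_monotone_convergence_SUP)
    show "incseq (\<lambda>n x. epow p (picard p ?c f n t x))"
      using p1 by (intro incseq_SucI le_funI epow_mono picard_mono) auto
  qed measurable
  also have "\<dots> \<le> ennreal ((2 * evol_const p * M) powr p * t powr (- a))"
    by (intro SUP_least picard_Lp[OF p a2 f fM M small t])
  finally have "(\<integral>\<^sup>+x. epow p (picard_lim p ?c f t x) \<partial>lborel) \<noteq> \<infinity>" by (auto simp: top_unique)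
  moreover have "(\<lambda>x. epow p (picard_lim p ?c f t x)) \<in> borel_measurable lborel"
    using measurable_compose[OF measurable_Pair1' picard_lim_measurable[OF f, of p ?c], of t] by simp
  ultimately have "AE x in lborel. epow p (picard_lim p ?c f t x) \<noteq> \<infinity>"
    by (intro nn_integral_PInf_AE) auto
  then show ?thesis
  proof eventually_elim
    case (elim x)
    then show ?case by (cases "picard_lim p ?c f t x = top") (auto simp: less_top)
  qed
qed

lemma ex_minimal_solution:
  fixes f1 f2 :: "'a::euclidean_space \<Rightarrow> real"
  assumes p: "p = 1 + 2 / real DIM('a)" and a2: "1 / 2 \<le> a" and f[measurable]: "f1 \<in> borel_measurable borel" "f2 \<in> borel_measurable borel"
    and f0: "\<And>x. 0 \<le> f1 x" "\<And>x. 0 \<le> f2 x"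
    and fin: "(\<integral>\<^sup>+x. ennreal (f1 x + f2 x) \<partial>lborel) < \<infinity>"
    and M: "(\<integral>\<^sup>+x. ennreal (f1 x) \<partial>lborel) \<le> ennreal M" "0 < M" "M powr (p - 1) \<le> mass_const p * (1 - a)"
    and b: "\<And>x. f2 x \<le> b" "0 < b" "b powr (p - 1) * T powr a \<le> sup_const p" and T: "0 < T"
  shows "\<exists>u. is_minimal_solution a p (ennreal T) (fun_measure (\<lambda>x. f1 x + f2 x)) u"
proof -
  have p1: "1 < p" using p by simp
  let ?c = "2 powr (p - 1)"
  let ?f1 = "\<lambda>x. ennreal (f1 x)"
  let ?f = "\<lambda>x. ennreal (f1 x + f2 x)"
  have small: "3 * ?c * (2 * b) powr p * T powr a \<le> b"
  proof -
    have "(2 * b) powr p = 2 powr p * (b powr (p - 1) * b)" using b by (simp add: powr_mult powr_diff)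
    then have "3 * ?c * (2 * b) powr p * T powr a = (3 * ?c * 2 powr p) * b * (b powr (p - 1) * T powr a)" by (simp add: mult_ac)
    also have "\<dots> \<le> (3 * ?c * 2 powr p) * b * sup_const p" using b by (intro mult_left_mono) auto
    also have "\<dots> = b" by (simp add: sup_const_def)
    finally show ?thesis .
  qed
  have le: "picard_lim p 1 ?f t x \<le> picard_lim p ?c ?f1 t x + ennreal (2 * b)" if "0 < t" "t \<le> T" for t x
    unfolding picard_lim_def
  proof (rule SUP_least)
    fix n
    have "picard p 1 (\<lambda>y. ennreal (f1 y) + ennreal (f2 y)) n t x \<le> picard p ?c ?f1 n t x + ennreal (2 * b)"
      using b by (intro picard_le_split[OF p1 _ _ _ _ small] that) (auto intro: ennreal_leI)
    also have "\<dots> \<le> (SUP n. picard p ?c ?f1 n t x) + ennreal (2 * b)" by (intro add_right_mono SUP_upper) simp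
    finally show "picard p 1 ?f n t x \<le> (SUP n. picard p ?c ?f1 n t x) + ennreal (2 * b)" using f0 by simp
  qed
  have cyl: "(t, x) \<in> cylinder (ennreal T) \<longleftrightarrow> 0 < t \<and> t < T" for t and x :: 'a
    by (auto simp: cylinder_def ennreal_less_iff)
  have ae0: "AE t in lborel. AE x in lborel. 0 < t \<and> t < T \<longrightarrow> picard_lim p 1 ?f t x < top"
  proof (rule AE_I2)
    fix t :: real
    show "AE x in lborel. 0 < t \<and> t < T \<longrightarrow> picard_lim p 1 ?f t x < top"
    proof (cases "0 < t \<and> t < T")
      case True
      then have "AE x in lborel. picard_lim p ?c ?f1 t x < top"
        by (intro picard_lim_finite[OF p a2 _ M]) auto
      then show ?thesis
        by eventually_elim (use True in \<open>auto intro!: le_less_trans[OF le]\<close>)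
    next
      case False
      then show ?thesis by auto
    qed
  qed
  have U[measurable]: "(\<lambda>z. picard_lim p 1 ?f (fst z) (snd z)) \<in> borel_measurable (lborel \<Otimes>\<^sub>M (lborel :: 'a measure))"
  proof -
    have s: "sets (lborel \<Otimes>\<^sub>M (lborel :: 'a measure)) = sets (borel \<Otimes>\<^sub>M borel)"
      by (intro sets_pair_measure_cong) auto
    show ?thesis
      unfolding measurable_cong_sets[OF s refl] case_prod_beta'[symmetric] by (rule picard_lim_measurable) measurable
  qed
  \<comment> \<open>Null sets in almost every slice combine to a null set of the product once the
    exceptional set is known to be measurable.\<close>
  have S: "{z \<in> space (lborel \<Otimes>\<^sub>M lborel). 0 < fst z \<and> fst z < T \<longrightarrow> picard_lim p 1 ?f (fst z) (snd z) < top} \<in> sets (lborel \<Otimes>\<^sub>M lborel)"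
    by measurable
  have "AE z in lborel \<Otimes>\<^sub>M lborel. 0 < fst z \<and> fst z < T \<longrightarrow> picard_lim p 1 ?f (fst z) (snd z) < top"
    by (rule lborel_pair.AE_pair_measure[OF S]) (simp only: fst_conv snd_conv ae0)
  then have ae: "AE (t, x) in lborel. (t, x) \<in> cylinder (ennreal T) \<longrightarrow> picard_lim p 1 ?f t x < top"
    unfolding lborel_prod case_prod_beta cyl by (simp add: cyl case_prod_beta)
  have rad: "radon_measure (fun_measure (\<lambda>x. f1 x + f2 x))"
    unfolding radon_measure_def fun_measure_def
  proof (intro conjI allI impI)
    fix K :: "'a set" assume "compact K"
    then have "K \<in> sets lborel" by (simp add: borel_compact)
    then have "emeasure (density lborel ?f) K \<le> (\<integral>\<^sup>+x. ?f x \<partial>lborel)"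
      by (subst emeasure_density) (auto intro!: nn_integral_mono split: split_indicator)
    then show "emeasure (density lborel ?f) K < \<infinity>" using fin by (rule le_less_trans)
  qed simp
  show ?thesis
    using minimal_solution_if_finite[OF _ _ _ rad ae] p1 T by auto
qed

end

section \<open>Nonexistence for data of large local mass\<close>

lemma ball_in_sets_borel[measurable]: "ball (c :: 'a::euclidean_space) r \<in> sets borel"
  by auto

text \<open>The volume of a ball of radius \<open>sqrt (\<tau> / 12)\<close> times a lower bound for
  the heat kernel at time \<open>\<tau>\<close> up to distance
  \<open>2 * sqrt (\<tau> / 12)\<close>. The powers of \<open>\<tau>\<close> cancel since
  \<open>4 * pi * \<tau> = 48 * pi * (\<tau> / 12)\<close>.\<close>

definition heat_ball_const :: "nat \<Rightarrow> real" where
  "heat_ball_const n = unit_ball_vol (real n) * (48 * pi) powr (- (real n / 2)) * exp (- 1 / 12)"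

lemma heat_ball_const_pos: "0 < heat_ball_const n"
  by (simp add: heat_ball_const_def unit_ball_vol_pos)

text \<open>A ball of radius \<open>sqrt (\<tau> / 12)\<close> inside \<open>ball 0 r\<close> and within distance \<open>2 * sqrt (\<tau> / 12)\<close> of \<open>y\<close> already carries enough of the heat kernel.\<close>

lemma heat_kernel_ball_ge:
  fixes y :: "'a::euclidean_space"
  assumes \<tau>: "0 < \<tau>" "\<tau> \<le> 12 * r\<^sup>2" and r: "0 < r" and y: "y \<in> ball 0 r"
  shows "ennreal (heat_ball_const DIM('a)) \<le> (\<integral>\<^sup>+x\<in>ball 0 r. ennreal (heat_kernel \<tau> (x - y)) \<partial>lborel)"
proof -
  define \<rho> where "\<rho> = sqrt (\<tau> / 12)"
  have \<rho>: "0 < \<rho>" "\<rho>\<^sup>2 = \<tau> / 12" using \<tau> by (auto simp: \<rho>_def)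
  have \<rho>r: "\<rho> \<le> r" unfolding \<rho>_def using \<tau> r by (intro real_le_lsqrt) auto
  \<comment> \<open>\<open>y\<close> is moved towards the origin by at most \<open>\<rho>\<close>,
    just enough for the ball of radius \<open>\<rho>\<close> about \<open>z\<close> to fit into
    \<open>ball 0 r\<close> even if \<open>y\<close> is close to the boundary.\<close>
  define z where "z = (1 - \<rho> / r) *\<^sub>R y"
  have ny: "norm y < r" using y by simp
  have zb: "x \<in> ball 0 r" "norm (x - y) \<le> 2 * \<rho>" if x: "x \<in> ball z \<rho>" for x
  proof -
    have xz: "norm (x - z) < \<rho>" using x by (simp add: dist_norm norm_minus_commute)
    have "norm z = (1 - \<rho> / r) * norm y" using \<rho>r r by (simp add: z_def)
    also have "\<dots> \<le> (1 - \<rho> / r) * r" using \<rho>r r ny by (intro mult_left_mono) auto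
    also have "\<dots> = r - \<rho>" using r by (simp add: field_simps)
    finally have "norm x < r" using xz norm_triangle_ineq[of "x - z" z] by simp
    then show "x \<in> ball 0 r" by simp
    have "z - y = - ((\<rho> / r) *\<^sub>R y)" by (simp add: z_def algebra_simps)
    then have "norm (z - y) = \<rho> / r * norm y" using \<rho> r by simp
    also have "\<dots> \<le> \<rho> / r * r" using \<rho> r ny by (intro mult_left_mono) auto
    finally have "norm (z - y) \<le> \<rho>" using r by simp
    then show "norm (x - y) \<le> 2 * \<rho>" using xz norm_triangle_ineq[of "x - z" "z - y"] by simp
  qed
  let ?k = "(4 * pi * \<tau>) powr (- (real DIM('a) / 2)) * exp (- 1 / 12)"
  have k: "?k \<le> heat_kernel \<tau> (x - y)" if "x \<in> ball z \<rho>" for x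
  proof -
    have "(norm (x - y))\<^sup>2 \<le> (2 * \<rho>)\<^sup>2" using zb(2)[OF that] by (intro power_mono) auto
    then have "(norm (x - y))\<^sup>2 / (4 * \<tau>) \<le> 1 / 12" using \<rho> \<tau> by (simp add: power_mult_distrib field_simps)
    then show ?thesis unfolding heat_kernel_def by (intro mult_left_mono) auto
  qed
  have "heat_ball_const DIM('a) = ?k * (unit_ball_vol (real DIM('a)) * \<rho> ^ DIM('a))"
  proof -
    have "\<rho> ^ DIM('a) = (\<tau> / 12) powr (real DIM('a) / 2)"
      using \<tau> by (simp add: \<rho>_def powr_half_sqrt[symmetric] powr_realpow[symmetric] powr_powr)
    moreover have "(4 * pi * \<tau>) powr (- (real DIM('a) / 2)) = (48 * pi) powr (- (real DIM('a) / 2)) * (\<tau> / 12) powr (- (real DIM('a) / 2))"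
    proof -
      have e: "4 * pi * \<tau> = (48 * pi) * (\<tau> / 12)" by simp
      show ?thesis unfolding e by (rule powr_mult)
    qed
    moreover have "(\<tau> / 12) powr (- (real DIM('a) / 2)) * (\<tau> / 12) powr (real DIM('a) / 2) = 1"
      using \<tau> by (simp flip: powr_add)
    ultimately show ?thesis unfolding heat_ball_const_def by (simp only: mult_ac) simp
  qed
  then have "ennreal (heat_ball_const DIM('a)) = ennreal ?k * emeasure lborel (ball z \<rho>)"
    using \<rho> by (simp add: emeasure_ball ennreal_mult' del: exp_minus)
  also have "\<dots> = (\<integral>\<^sup>+x\<in>ball z \<rho>. ennreal ?k \<partial>lborel)" by (simp add: nn_integral_cmult_indicator)
  also have "\<dots> \<le> (\<integral>\<^sup>+x\<in>ball 0 r. ennreal (heat_kernel \<tau> (x - y)) \<partial>lborel)"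
    using zb(1) k by (intro nn_integral_mono) (auto split: split_indicator simp del: mem_ball intro!: ennreal_leI)
  finally show ?thesis .
qed

lemma heat_conv_ball_ge:
  fixes g :: "'a::euclidean_space \<Rightarrow> ennreal"
  assumes \<tau>: "0 < \<tau>" "\<tau> \<le> 12 * r\<^sup>2" and r: "0 < r" and [measurable]: "g \<in> borel_measurable borel"
  shows "ennreal (heat_ball_const DIM('a)) * (\<integral>\<^sup>+y\<in>ball 0 r. g y \<partial>lborel) \<le> (\<integral>\<^sup>+x\<in>ball 0 r. heat_conv \<tau> g x \<partial>lborel)"
proof -
  have "ennreal (heat_ball_const DIM('a)) * (\<integral>\<^sup>+y\<in>ball 0 r. g y \<partial>lborel) = (\<integral>\<^sup>+y. ennreal (heat_ball_const DIM('a)) * (g y * indicator (ball 0 r) y) \<partial>lborel)"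
    by (rule nn_integral_cmult[symmetric]) measurable
  also have "\<dots> \<le> (\<integral>\<^sup>+y. (\<integral>\<^sup>+x. ennreal (heat_kernel \<tau> (x - y)) * g y * indicator (ball 0 r) x \<partial>lborel) \<partial>lborel)"
  proof (intro nn_integral_mono)
    fix y :: 'a
    have "(\<integral>\<^sup>+x. ennreal (heat_kernel \<tau> (x - y)) * g y * indicator (ball 0 r) x \<partial>lborel)
      = (\<integral>\<^sup>+x\<in>ball 0 r. ennreal (heat_kernel \<tau> (x - y)) \<partial>lborel) * g y"
      by (subst nn_integral_multc[symmetric]) (auto intro!: nn_integral_cong simp: mult_ac)
    then show "ennreal (heat_ball_const DIM('a)) * (g y * indicator (ball 0 r) y)
      \<le> (\<integral>\<^sup>+x. ennreal (heat_kernel \<tau> (x - y)) * g y * indicator (ball 0 r) x \<partial>lborel)"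
      using heat_kernel_ball_ge[OF \<tau> r, of y] by (auto split: split_indicator intro!: mult_right_mono)
  qed
  also have "\<dots> = (\<integral>\<^sup>+x. (\<integral>\<^sup>+y. ennreal (heat_kernel \<tau> (x - y)) * g y * indicator (ball 0 r) x \<partial>lborel) \<partial>lborel)"
    by (rule lborel_pair.Fubini') measurable
  also have "\<dots> = (\<integral>\<^sup>+x\<in>ball 0 r. heat_conv \<tau> g x \<partial>lborel)"
    unfolding heat_conv_def by (intro nn_integral_cong) (auto split: split_indicator)
  finally show ?thesis .
qed

text \<open>Only \<open>\<theta> \<le> 12\<close> is kept. Then
  \<open>\<tau> * \<theta> \<le> 12 * r\<^sup>2\<close>, so each heat flow leaves a fixed fraction
  of the mass in the ball; \<open>bulk_mass\<close> supplies the weight \<open>k\<close> of these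
  \<open>\<theta>\<close>.\<close>

lemma subordinated_ball_ge:
  fixes g :: "'a::euclidean_space \<Rightarrow> ennreal" and w :: "real \<Rightarrow> ennreal"
  assumes \<tau>: "0 < \<tau>" "\<tau> \<le> r\<^sup>2" and r: "0 < r" and [measurable]: "g \<in> borel_measurable borel" "w \<in> borel_measurable borel"
    and k: "k \<le> (\<integral>\<^sup>+\<theta>\<in>{0<..12}. w \<theta> \<partial>lborel)"
  shows "k * (ennreal (heat_ball_const DIM('a)) * (\<integral>\<^sup>+y\<in>ball 0 r. g y \<partial>lborel))
    \<le> (\<integral>\<^sup>+x\<in>ball 0 r. (\<integral>\<^sup>+\<theta>. w \<theta> * heat_conv (\<tau> * \<theta>) g x \<partial>lborel) \<partial>lborel)"
proof -
  let ?I = "ennreal (heat_ball_const DIM('a)) * (\<integral>\<^sup>+y\<in>ball 0 r. g y \<partial>lborel)"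
  have "k * ?I \<le> (\<integral>\<^sup>+\<theta>\<in>{0<..12}. w \<theta> \<partial>lborel) * ?I" by (intro mult_right_mono k) simp
  also have "\<dots> = (\<integral>\<^sup>+\<theta>. (w \<theta> * indicator {0<..12} \<theta>) * ?I \<partial>lborel)" by (subst nn_integral_multc) auto
  also have "\<dots> \<le> (\<integral>\<^sup>+\<theta>. (\<integral>\<^sup>+x. w \<theta> * heat_conv (\<tau> * \<theta>) g x * indicator (ball 0 r) x \<partial>lborel) \<partial>lborel)"
  proof (intro nn_integral_mono)
    fix \<theta> :: real
    have "(\<integral>\<^sup>+x. w \<theta> * heat_conv (\<tau> * \<theta>) g x * indicator (ball 0 r) x \<partial>lborel) = w \<theta> * (\<integral>\<^sup>+x\<in>ball 0 r. heat_conv (\<tau> * \<theta>) g x \<partial>lborel)"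
      unfolding mult.assoc by (rule nn_integral_cmult) measurable
    moreover have "?I \<le> (\<integral>\<^sup>+x\<in>ball 0 r. heat_conv (\<tau> * \<theta>) g x \<partial>lborel)" if "0 < \<theta>" "\<theta> \<le> 12"
    proof (rule heat_conv_ball_ge)
      have "\<tau> * \<theta> \<le> r\<^sup>2 * 12" using \<tau> that by (intro mult_mono) auto
      then show "\<tau> * \<theta> \<le> 12 * r\<^sup>2" by simp
    qed (use \<tau> r that in auto)
    ultimately show "(w \<theta> * indicator {0<..12} \<theta>) * ?I \<le> (\<integral>\<^sup>+x. w \<theta> * heat_conv (\<tau> * \<theta>) g x * indicator (ball 0 r) x \<partial>lborel)"
      by (auto split: split_indicator intro!: mult_left_mono)
  qed
  also have "\<dots> = (\<integral>\<^sup>+x. (\<integral>\<^sup>+\<theta>. w \<theta> * heat_conv (\<tau> * \<theta>) g x * indicator (ball 0 r) x \<partial>lborel) \<partial>lborel)"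
    by (rule lborel_pair.Fubini'[symmetric]) measurable
  also have "\<dots> = (\<integral>\<^sup>+x\<in>ball 0 r. (\<integral>\<^sup>+\<theta>. w \<theta> * heat_conv (\<tau> * \<theta>) g x \<partial>lborel) \<partial>lborel)"
    by (intro nn_integral_cong) (simp add: nn_integral_multc)
  finally show ?thesis .
qed

section \<open>Blow-up of the local mass\<close>

lemma AE_lborel_ex_between:
  fixes s t :: real
  assumes "AE x in lborel. P x" "s < t"
  obtains x where "s < x" "x < t" "P x"
proof -
  have "\<exists>x. s < x \<and> x < t \<and> P x"
  proof (rule ccontr)
    assume n: "\<not> ?thesis"
    have "AE x in lborel. x \<notin> {s<..<t}"
      using assms(1) by eventually_elim (use n in auto)
    then have "emeasure lborel {s<..<t} = 0"
      by (subst (asm) AE_iff_measurable[where N = "{s<..<t}"]) auto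
    then show False using assms(2) by simp
  qed
  then show ?thesis using that by blast
qed

text \<open>Bootstrapping the integral inequality for \<open>m\<close>: each round multiplies the lower bound by a fixed factor, while
  the waiting times \<open>ln (t\<^sub>k\<^sub>+\<^sub>1 / t\<^sub>k) = 2 powr (- k) / (1 - a)\<close> are summable.\<close>

lemma integral_inequality_blowup:
  fixes m :: "real \<Rightarrow> ennreal" and a b c p t0 T :: real
  assumes a: "0 < a" "a < 1" and p: "1 < p" and t0: "0 < t0" and b: "0 < b" and c: "0 < c"
    and large: "2 * 2 powr (1 / (p - 1)) * (1 - a) \<le> c * b powr (p - 1)"
    and init: "AE t in lborel. t0 < t \<and> t < T \<longrightarrow> ennreal b \<le> m t"
    and ineq: "AE t in lborel. 0 < t \<and> t < T \<longrightarrow>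
      ennreal c * (\<integral>\<^sup>+s\<in>{0<..<t}. ennreal ((t - s) powr (a - 1) * s powr (- a)) * epow p (m s) \<partial>lborel) \<le> m t"
  shows "AE t in lborel. t0 * exp (2 / (1 - a)) < t \<and> t < T \<longrightarrow> m t = top"
proof -
  \<comment> \<open>\<open>\<Lambda> powr (p - 1) = 2\<close>: a lower bound grown by
    \<open>\<Lambda> ^ k\<close> yields a factor \<open>2 ^ k\<close> in
    \<open>B powr (p - 1)\<close>, which compensates for the waiting times shrinking like
    \<open>2 powr (- k)\<close>.\<close>
  define \<Lambda> where "\<Lambda> = 2 powr (1 / (p - 1))"
  define \<tau> where "\<tau> k = t0 * exp ((2 - 2 / 2 ^ k) / (1 - a))" for k :: nat
  have \<Lambda>1: "1 < \<Lambda>" using p by (simp add: \<Lambda>_def)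
  have \<tau>pos: "0 < \<tau> k" for k using t0 by (simp add: \<tau>_def)
  have step: "AE t in lborel. \<tau> k < t \<and> t < T \<longrightarrow> ennreal (b * \<Lambda> ^ k) \<le> m t" for k
  proof (induction k)
    case 0
    then show ?case using init by (simp add: \<tau>_def)
  next
    case (Suc k)
    define B where "B = b * \<Lambda> ^ k"
    have B: "0 < B" using b \<Lambda>1 by (simp add: B_def)
    show ?case using ineq
    proof (eventually_elim, intro impI)
      fix t
      assume i: "0 < t \<and> t < T \<longrightarrow>
        ennreal c * (\<integral>\<^sup>+s\<in>{0<..<t}. ennreal ((t - s) powr (a - 1) * s powr (- a)) * epow p (m s) \<partial>lborel) \<le> m t"
        and t: "\<tau> (Suc k) < t \<and> t < T"
      have \<tau>S: "\<tau> (Suc k) = \<tau> k * exp (1 / 2 ^ k / (1 - a))"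
        unfolding \<tau>_def mult.assoc exp_add[symmetric] add_divide_distrib[symmetric] by (simp add: field_simps)
      have "\<tau> k * 1 \<le> \<tau> k * exp (1 / 2 ^ k / (1 - a))"
        using \<tau>pos[of k] a by (intro mult_left_mono) auto
      then have \<tau>t: "\<tau> k < t" using \<tau>S t by simp
      have t0': "0 < t" using \<tau>t \<tau>pos[of k] by linarith
      have ratio: "(\<tau> k) powr (1 - a) \<le> exp (- (1 / 2 ^ k)) * t powr (1 - a)"
      proof -
        have "(\<tau> (Suc k)) powr (1 - a) \<le> t powr (1 - a)" using t a \<tau>pos[of "Suc k"] by (intro powr_mono2) auto
        moreover have "(\<tau> (Suc k)) powr (1 - a) = (\<tau> k) powr (1 - a) * exp (1 / 2 ^ k)"
          unfolding \<tau>S using \<tau>pos[of k] a by (simp add: powr_mult exp_powr_real)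
        ultimately show ?thesis by (simp add: exp_minus field_simps)
      qed
      \<comment> \<open>Turns the waiting time into a linear gain: the integral of
        \<open>s powr (- a)\<close> over the waiting period is at least \<open>1 / 2 ^ k / 2\<close>
        of \<open>t powr (1 - a) / (1 - a)\<close>.\<close>
      have half: "exp (- x) \<le> 1 - x / 2" if "0 \<le> x" "x \<le> 1" for x :: real
      proof -
        have "exp (- x) \<le> 1 / (1 + x)"
          using exp_ge_add_one_self[of x] that by (simp add: exp_minus inverse_eq_divide frac_le)
        also have "\<dots> \<le> 1 - x / 2"
        proof -
          have "x * x \<le> x" using that by (intro mult_left_le) auto
          then have "1 \<le> (1 - x / 2) * (1 + x)" by (simp add: algebra_simps)
          then show ?thesis using that by (simp add: divide_le_eq)
        qed
        finally show ?thesis .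
      qed
      have "ennreal (t powr (a - 1) * B powr p * ((t powr (1 - a) - (\<tau> k) powr (1 - a)) / (1 - a)))
        = (\<integral>\<^sup>+s. ennreal (t powr (a - 1) * B powr p) * (ennreal (s powr (- a)) * indicator {\<tau> k..t} s) \<partial>lborel)"
      proof -
        have *: "(\<integral>\<^sup>+s. ennreal (s powr (- a)) * indicator {\<tau> k..t} s \<partial>lborel) = ennreal (t powr (1 - a) / (1 - a) - (\<tau> k) powr (1 - a) / (1 - a))"
        proof (rule nn_integral_FTC_Icc)
          fix x assume "x \<in> {\<tau> k..t}"
          then have "0 < x" using \<tau>pos[of k] by auto
          then show "((\<lambda>x. x powr (1 - a) / (1 - a)) has_real_derivative x powr (- a)) (at x)"
            using a by (auto intro!: derivative_eq_intros)
        qed (use \<tau>t in auto)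
        show ?thesis
          by (subst nn_integral_cmult, measurable) (simp only: * ennreal_mult'[symmetric] diff_divide_distrib[symmetric] mult_nonneg_nonneg powr_ge_zero)
      qed
      also have "\<dots> \<le> (\<integral>\<^sup>+s\<in>{0<..<t}. ennreal ((t - s) powr (a - 1) * s powr (- a)) * epow p (m s) \<partial>lborel)"
      proof (rule nn_integral_mono_AE)
        \<comment> \<open>The endpoints \<open>\<tau> k\<close> and \<open>t\<close> are discarded
          as null sets, because the induction hypothesis holds only strictly beyond
          \<open>\<tau> k\<close>.\<close>
        show "AE s in lborel. ennreal (t powr (a - 1) * B powr p) * (ennreal (s powr (- a)) * indicator {\<tau> k..t} s)
          \<le> ennreal ((t - s) powr (a - 1) * s powr (- a)) * epow p (m s) * indicator {0<..<t} s"
          using Suc.IH AE_lborel_singleton[of "\<tau> k"] AE_lborel_singleton[of t]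
        proof eventually_elim
          case (elim s)
          show ?case
          proof (cases "s \<in> {\<tau> k<..<t}")
            case True
            then have s: "0 < s" "s < t" using \<tau>pos[of k] by auto
            have "epow p (ennreal B) \<le> epow p (m s)"
              using elim True t p unfolding B_def by (intro epow_mono) auto
            then have 1: "ennreal (B powr p) \<le> epow p (m s)" using B by (simp add: epow_ennreal)
            \<comment> \<open>The kernel is replaced by its smallest value. Nothing essential is
              lost, since the factor \<open>1 / (1 - a)\<close> stems from
              \<open>s powr (- a)\<close>.\<close>
            have e: "t powr (a - 1) * s powr (- a) \<le> (t - s) powr (a - 1) * s powr (- a)"
              using s a by (intro mult_right_mono powr_mono2') auto
            have "ennreal (t powr (a - 1) * s powr (- a)) * ennreal (B powr p) \<le> ennreal ((t - s) powr (a - 1) * s powr (- a)) * epow p (m s)"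
              by (rule mult_mono[OF ennreal_leI[OF e] 1]) auto
            then show ?thesis using True s by (simp add: ennreal_mult' mult_ac)
          next
            case False
            then have "s \<notin> {\<tau> k..t}" using elim by auto
            then show ?thesis by simp
          qed
        qed
      qed
      finally have "ennreal c * ennreal (t powr (a - 1) * B powr p * ((t powr (1 - a) - (\<tau> k) powr (1 - a)) / (1 - a))) \<le> m t"
        using i t t0' by (meson mult_left_mono order_trans zero_le)
      then have "ennreal (c * (t powr (a - 1) * B powr p * ((t powr (1 - a) - (\<tau> k) powr (1 - a)) / (1 - a)))) \<le> m t"
        by (simp only: ennreal_mult'[OF less_imp_le[OF c]])
      moreover have "b * \<Lambda> ^ Suc k \<le> c * (t powr (a - 1) * B powr p * ((t powr (1 - a) - (\<tau> k) powr (1 - a)) / (1 - a)))"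
      proof -
        have "1 / 2 ^ k / 2 * t powr (1 - a) \<le> t powr (1 - a) - (\<tau> k) powr (1 - a)"
          using ratio mult_right_mono[OF half[of "1 / 2 ^ k"], of "t powr (1 - a)"] by (simp add: algebra_simps)
        then have "c * (t powr (a - 1) * B powr p * ((1 / 2 ^ k / 2 * t powr (1 - a)) / (1 - a)))
          \<le> c * (t powr (a - 1) * B powr p * ((t powr (1 - a) - (\<tau> k) powr (1 - a)) / (1 - a)))"
          using c a by (intro mult_left_mono divide_right_mono) auto
        moreover have "c * (t powr (a - 1) * B powr p * ((1 / 2 ^ k / 2 * t powr (1 - a)) / (1 - a)))
          = (c * b powr (p - 1)) / (2 * (1 - a)) * (b * \<Lambda> ^ k)"
        proof -
          have "t powr (a - 1) * t powr (1 - a) = 1" using t0' by (simp flip: powr_add)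
          moreover have "B powr p = b powr (p - 1) * (2 ^ k) * (b * \<Lambda> ^ k)"
          proof -
            have "B powr p = B powr (p - 1) * B" using B by (simp add: powr_diff)
            also have "B powr (p - 1) = b powr (p - 1) * (\<Lambda> ^ k) powr (p - 1)" unfolding B_def by (rule powr_mult)
            also have "(\<Lambda> ^ k) powr (p - 1) = 2 ^ k"
              using p by (simp add: \<Lambda>_def powr_realpow[symmetric] powr_powr)
            finally show ?thesis by (simp add: B_def)
          qed
          ultimately have "c * (t powr (a - 1) * B powr p * ((1 / 2 ^ k / 2 * t powr (1 - a)) / (1 - a)))
            = c * ((t powr (a - 1) * t powr (1 - a)) * (b powr (p - 1) * (2 ^ k) * (b * \<Lambda> ^ k)) * ((1 / 2 ^ k / 2) / (1 - a)))"
            by simp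
          also have "\<dots> = (c * b powr (p - 1)) / (2 * (1 - a)) * (b * \<Lambda> ^ k)"
            unfolding \<open>t powr (a - 1) * t powr (1 - a) = 1\<close> by simp
          finally show ?thesis .
        qed
        moreover have "\<Lambda> * (b * \<Lambda> ^ k) \<le> (c * b powr (p - 1)) / (2 * (1 - a)) * (b * \<Lambda> ^ k)"
          using large a B unfolding \<Lambda>_def[symmetric] B_def[symmetric]
          by (intro mult_right_mono) (auto simp: field_simps)
        ultimately show ?thesis by (simp add: mult_ac)
      qed
      ultimately show "ennreal (b * \<Lambda> ^ Suc k) \<le> m t" by (blast intro: order_trans ennreal_leI)
    qed
  qed
  have "AE t in lborel. \<forall>k. \<tau> k < t \<and> t < T \<longrightarrow> ennreal (b * \<Lambda> ^ k) \<le> m t"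
    using step by (simp add: AE_all_countable)
  then show ?thesis
  proof (eventually_elim, intro impI)
    fix t
    assume le: "\<forall>k. \<tau> k < t \<and> t < T \<longrightarrow> ennreal (b * \<Lambda> ^ k) \<le> m t" and t: "t0 * exp (2 / (1 - a)) < t \<and> t < T"
    have "\<tau> k \<le> t0 * exp (2 / (1 - a))" for k
      unfolding \<tau>_def using t0 a by (intro mult_left_mono) (auto intro!: divide_right_mono)
    then have "\<tau> k < t" for k using t by (meson le_less_trans)
    then have bk: "ennreal (b * \<Lambda> ^ k) \<le> m t" for k using le t by blast
    show "m t = top"
    proof (rule ccontr)
      assume "m t \<noteq> top"
      then obtain r where r: "m t = ennreal r" "0 \<le> r" by (cases "m t") auto
      then have "b * \<Lambda> ^ k \<le> r" for k using bk[of k] by simp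
      moreover obtain k where "r / b < \<Lambda> ^ k" using real_arch_pow[OF \<Lambda>1] by blast
      ultimately show False using b by (metis divide_less_eq mult.commute not_less)
    qed
  qed
qed

text \<open>\<open>real DIM('a) * (p - 1) = 2\<close> for the Fujita exponent, so the volume of the
  ball enters as \<open>r\<^sup>2\<close>, which is \<open>s powr a\<close> for
  \<open>r = s powr (a / 2)\<close>.\<close>

lemma jensen_ball:
  fixes f :: "'a::euclidean_space \<Rightarrow> ennreal"
  assumes p: "p = 1 + 2 / real DIM('a)" and r: "0 < r" and [measurable]: "f \<in> borel_measurable borel"
  shows "epow p (\<integral>\<^sup>+y\<in>ball 0 r. f y \<partial>lborel)
    \<le> ennreal (unit_ball_vol (real DIM('a)) powr (p - 1) * r\<^sup>2) * (\<integral>\<^sup>+y\<in>ball 0 r. epow p (f y) \<partial>lborel)"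
proof -
  define V where "V = unit_ball_vol (real DIM('a))"
  have V: "0 < V" by (simp add: V_def)
  have "(V * r ^ DIM('a)) powr (p - 1) = V powr (p - 1) * r\<^sup>2"
  proof -
    have "real DIM('a) * (p - 1) = 2" by (simp add: p)
    then have "(r ^ DIM('a)) powr (p - 1) = r powr 2"
      by (simp only: powr_realpow[OF r, symmetric] powr_powr)
    also have "\<dots> = r\<^sup>2" using r by simp
    finally show ?thesis by (simp only: powr_mult)
  qed
  moreover have "epow p (\<integral>\<^sup>+y. indicator (ball 0 r) y * f y \<partial>lborel)
    \<le> ennreal ((V * r ^ DIM('a)) powr (p - 1)) * (\<integral>\<^sup>+y. indicator (ball 0 r) y * (ennreal (1 powr (1 - p)) * epow p (f y)) \<partial>lborel)"
    by (rule jensen_epow[where w = "indicator (ball 0 r)" and g = "\<lambda>_. 1"])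
       (use p V r in \<open>auto simp: emeasure_ball V_def\<close>)
  ultimately show ?thesis by (simp add: V_def mult.commute)
qed

text \<open>The factor in the integral inequality for the local mass:
  \<open>heat_ball_const n / 96\<close> from \<open>duhamel_ball_ge\<close>, divided by the volume
  factor of \<open>jensen_ball\<close>.\<close>

definition blowup_rate :: "nat \<Rightarrow> real \<Rightarrow> real" where
  "blowup_rate n p = heat_ball_const n / 96 / unit_ball_vol (real n) powr (p - 1)"

text \<open>The hypothesis \<open>large\<close> of \<open>integral_inequality_blowup\<close> solved
  for \<open>1 - a\<close>, with \<open>b = heat_ball_const n / 2 * M\<close> and the factor
  \<open>M powr (p - 1)\<close> split off.\<close>

definition blowup_const :: "nat \<Rightarrow> real \<Rightarrow> real" where
  "blowup_const n p = blowup_rate n p * (heat_ball_const n / 2) powr (p - 1) / (2 * 2 powr (1 / (p - 1)))"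

lemma blowup_rate_pos: "0 < blowup_rate n p"
proof -
  have "0 < unit_ball_vol (real n)" by simp
  then have "0 < unit_ball_vol (real n) powr (p - 1)" by (simp del: unit_ball_vol_pos)
  then show ?thesis using heat_ball_const_pos[of n] by (simp add: blowup_rate_def)
qed

lemma blowup_const_pos: "0 < blowup_const n p"
  using blowup_rate_pos[of n p] heat_ball_const_pos[of n] by (simp add: blowup_const_def)

context fractional
begin

lemma evolution_ball_ge:
  fixes f :: "'a::euclidean_space \<Rightarrow> ennreal"
  assumes t: "0 < t" and [measurable]: "f \<in> borel_measurable borel"
  shows "ennreal (heat_ball_const DIM('a) / 2) * (\<integral>\<^sup>+y\<in>ball 0 (t powr (a / 2)). f y \<partial>lborel)
    \<le> (\<integral>\<^sup>+x\<in>ball 0 (t powr (a / 2)). evolution f t x \<partial>lborel)"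
proof -
  have r2: "(t powr (a / 2))\<^sup>2 = t powr a" by (simp add: power2_eq_square flip: powr_add)
  have "(\<integral>\<^sup>+\<theta>\<in>{0<..12}. w0 \<theta> \<partial>lborel) = (\<integral>\<^sup>+\<theta>\<in>{0<..12}. ennreal (subordination_density a \<theta>) \<partial>lborel)"
    by (intro nn_integral_cong) (auto simp: w0_def split: split_indicator)
  then have k: "ennreal (1 / 2) \<le> (\<integral>\<^sup>+\<theta>\<in>{0<..12}. w0 \<theta> \<partial>lborel)" using bulk_mass(1) by simp
  have "ennreal (1 / 2) * (ennreal (heat_ball_const DIM('a)) * (\<integral>\<^sup>+y\<in>ball 0 (t powr (a / 2)). f y \<partial>lborel))
    \<le> (\<integral>\<^sup>+x\<in>ball 0 (t powr (a / 2)). evolution f t x \<partial>lborel)"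
    unfolding evolution_def by (rule subordinated_ball_ge[OF _ _ _ _ _ k]) (use t r2 in auto)
  moreover have "ennreal (heat_ball_const DIM('a) / 2) = ennreal (1 / 2) * ennreal (heat_ball_const DIM('a))"
    by (subst ennreal_mult'[symmetric]) auto
  ultimately show ?thesis by (simp only: mult.assoc)
qed

text \<open>The balls grow with time, so the mass at time \<open>s\<close> in its own ball is also
  mass in the ball belonging to \<open>t\<close>. The constant is \<open>96 = 2 * 48\<close>, from
  \<open>1 / 2 \<le> a\<close> and the second part of \<open>bulk_mass\<close>.\<close>

lemma duhamel_ball_ge:
  fixes g :: "real \<Rightarrow> 'a::euclidean_space \<Rightarrow> ennreal"
  assumes a2: "1 / 2 \<le> a" and t: "0 < t" and g[measurable]: "case_prod g \<in> borel_measurable (borel \<Otimes>\<^sub>M borel)"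
  shows "ennreal (heat_ball_const DIM('a) / 96) * (\<integral>\<^sup>+s. (ennreal ((t - s) powr (a - 1)) * indicator {0<..<t} s)
      * (\<integral>\<^sup>+y\<in>ball 0 (s powr (a / 2)). g s y \<partial>lborel) \<partial>lborel)
    \<le> (\<integral>\<^sup>+x\<in>ball 0 (t powr (a / 2)). duhamel g t x \<partial>lborel)"
proof -
  let ?r = "t powr (a / 2)"
  let ?w = "\<lambda>s. ennreal ((t - s) powr (a - 1)) * indicator {0<..<t} s"
  let ?I = "\<lambda>s. \<integral>\<^sup>+y\<in>ball 0 (s powr (a / 2)). g s y \<partial>lborel"
  let ?H = "ennreal (heat_ball_const DIM('a))"
  have slice[measurable]: "g s \<in> borel_measurable borel" for s
    using measurable_compose[OF measurable_Pair1' g, of s] by simp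
  have r2: "?r\<^sup>2 = t powr a" by (simp add: power2_eq_square flip: powr_add)
  have "(\<integral>\<^sup>+\<theta>\<in>{0<..12}. w1 \<theta> \<partial>lborel) = (\<integral>\<^sup>+\<theta>\<in>{0<..12}. ennreal (\<theta> * subordination_density a \<theta>) \<partial>lborel)"
    by (intro nn_integral_cong) (auto simp: w1_def split: split_indicator)
  then have k: "ennreal (1 / 48) \<le> (\<integral>\<^sup>+\<theta>\<in>{0<..12}. w1 \<theta> \<partial>lborel)" using bulk_mass(2) by simp
  have ind[measurable]: "(\<lambda>x. indicator (ball 0 (s powr (a / 2))) x :: ennreal) \<in> borel_measurable (borel :: 'a measure)" for s
    by measurable
  have sm: "ennreal (1 / 48) * (?H * ?I s) \<le> (\<integral>\<^sup>+x\<in>ball 0 ?r. smoothing (t - s) (g s) x \<partial>lborel)"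
    if s: "0 < s" "s < t" for s
  proof -
    have "?I s \<le> (\<integral>\<^sup>+y\<in>ball 0 ?r. g s y \<partial>lborel)"
    proof (intro nn_integral_mono mult_left_mono)
      have "s powr (a / 2) \<le> ?r" using s a01 by (intro powr_mono2) auto
      then show "indicator (ball 0 (s powr (a / 2))) y \<le> (indicator (ball 0 ?r) y :: ennreal)" for y :: 'a
        by (auto split: split_indicator)
    qed simp
    then have "ennreal (1 / 48) * (?H * ?I s) \<le> ennreal (1 / 48) * (?H * (\<integral>\<^sup>+y\<in>ball 0 ?r. g s y \<partial>lborel))"
      by (intro mult_left_mono) auto
    also have "\<dots> \<le> (\<integral>\<^sup>+x\<in>ball 0 ?r. smoothing (t - s) (g s) x \<partial>lborel)"
      unfolding smoothing_def
    proof (rule subordinated_ball_ge[OF _ _ _ _ _ k])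
      have "(t - s) powr a \<le> t powr a" using s a01 by (intro powr_mono2) auto
      then show "(t - s) powr a \<le> ?r\<^sup>2" by (simp add: r2)
    qed (use t s in auto)
    finally show ?thesis .
  qed
  have "ennreal (heat_ball_const DIM('a) / 96) = ennreal (1 / 2) * (ennreal (1 / 48) * ?H)"
    by (simp only: ennreal_mult'[symmetric] zero_le_divide_1_iff zero_le_numeral) simp
  then have "ennreal (heat_ball_const DIM('a) / 96) * (\<integral>\<^sup>+s. ?w s * ?I s \<partial>lborel)
    = ennreal (1 / 2) * ((ennreal (1 / 48) * ?H) * (\<integral>\<^sup>+s. ?w s * ?I s \<partial>lborel))"
    by (simp only: mult.assoc)
  also have "\<dots> \<le> ennreal a * ((ennreal (1 / 48) * ?H) * (\<integral>\<^sup>+s. ?w s * ?I s \<partial>lborel))"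
    using a2 by (intro mult_right_mono ennreal_leI) auto
  also have "(ennreal (1 / 48) * ?H) * (\<integral>\<^sup>+s. ?w s * ?I s \<partial>lborel)
    = (\<integral>\<^sup>+s. (ennreal (1 / 48) * ?H) * (?w s * ?I s) \<partial>lborel)"
  proof (rule nn_integral_cmult[symmetric])
    have *: "indicator (ball 0 (s powr (a / 2))) y = (if norm y < s powr (a / 2) then 1 else (0::ennreal))" for s and y :: 'a
      by (auto split: split_indicator)
    show "(\<lambda>s. ?w s * ?I s) \<in> borel_measurable lborel"
      unfolding * by measurable
  qed
  also have "\<dots> \<le> (\<integral>\<^sup>+s. (\<integral>\<^sup>+x. ?w s * smoothing (t - s) (g s) x * indicator (ball 0 ?r) x \<partial>lborel) \<partial>lborel)"
  proof (intro nn_integral_mono)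
    fix s :: real
    have eq: "(\<integral>\<^sup>+x. ?w s * smoothing (t - s) (g s) x * indicator (ball 0 ?r) x \<partial>lborel) = ?w s * (\<integral>\<^sup>+x\<in>ball 0 ?r. smoothing (t - s) (g s) x \<partial>lborel)"
      by (subst nn_integral_cmult[symmetric]) (auto intro!: nn_integral_cong simp: mult_ac)
    show "(ennreal (1 / 48) * ?H) * (?w s * ?I s)
      \<le> (\<integral>\<^sup>+x. ?w s * smoothing (t - s) (g s) x * indicator (ball 0 ?r) x \<partial>lborel)"
    proof (cases "s \<in> {0<..<t}")
      case True
      have "?w s * (ennreal (1 / 48) * (?H * ?I s)) \<le> ?w s * (\<integral>\<^sup>+x\<in>ball 0 ?r. smoothing (t - s) (g s) x \<partial>lborel)"
        using True by (intro mult_left_mono sm) auto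
      then show ?thesis unfolding eq by (simp only: mult_ac)
    qed simp
  qed
  also have "\<dots> = (\<integral>\<^sup>+x. (\<integral>\<^sup>+s. ?w s * smoothing (t - s) (g s) x * indicator (ball 0 ?r) x \<partial>lborel) \<partial>lborel)"
    by (rule lborel_pair.Fubini'[symmetric]) measurable
  also have "ennreal a * \<dots> = (\<integral>\<^sup>+x\<in>ball 0 ?r. duhamel g t x \<partial>lborel)"
  proof -
    have "(\<integral>\<^sup>+s. ?w s * smoothing (t - s) (g s) x * indicator (ball 0 ?r) x \<partial>lborel)
      = (\<integral>\<^sup>+s. ?w s * smoothing (t - s) (g s) x \<partial>lborel) * indicator (ball 0 ?r) x" for x
      by (rule nn_integral_multc) measurable
    then show ?thesis
      unfolding duhamel_def by (subst nn_integral_cmult[symmetric], measurable) (simp only: mult.assoc)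
  qed
  finally show ?thesis by (simp add: mult_left_mono)
qed

text \<open>The kernel has a positive lower bound on every ball, hence infinite mass in one ball
  makes every heat flow infinite everywhere.\<close>

lemma smoothing_top:
  fixes g :: "'a::euclidean_space \<Rightarrow> ennreal"
  assumes t: "0 < t" and [measurable]: "g \<in> borel_measurable borel" and top: "(\<integral>\<^sup>+y\<in>ball 0 r. g y \<partial>lborel) = top"
  shows "smoothing t g x = top"
proof -
  have hc: "heat_conv \<tau> g x = top" if \<tau>: "0 < \<tau>" for \<tau>
  proof -
    define k where "k = (4 * pi * \<tau>) powr (- (real DIM('a) / 2)) * exp (- ((norm x + r)\<^sup>2 / (4 * \<tau>)))"
    have k: "0 < k" using \<tau> by (simp add: k_def)
    have "top = ennreal k * (\<integral>\<^sup>+y\<in>ball 0 r. g y \<partial>lborel)" using k top by (simp add: ennreal_mult_top)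
    also have "\<dots> = (\<integral>\<^sup>+y. ennreal k * (g y * indicator (ball 0 r) y) \<partial>lborel)" by (subst nn_integral_cmult) auto
    also have "\<dots> \<le> heat_conv \<tau> g x"
      unfolding heat_conv_def
    proof (intro nn_integral_mono)
      fix y
      have "k \<le> heat_kernel \<tau> (x - y)" if "norm y < r"
      proof -
        have "(norm (x - y))\<^sup>2 \<le> (norm x + r)\<^sup>2"
          using that norm_triangle_ineq4[of x y] by (intro power_mono) auto
        then show ?thesis unfolding k_def heat_kernel_def using \<tau> by (intro mult_left_mono) (auto intro!: divide_right_mono)
      qed
      then show "ennreal k * (g y * indicator (ball 0 r) y) \<le> ennreal (heat_kernel \<tau> (x - y)) * g y"
        by (auto split: split_indicator intro!: mult_right_mono ennreal_leI)
    qed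
    finally show ?thesis by (simp add: top_unique)
  qed
  have "smoothing t g x = (\<integral>\<^sup>+\<theta>. w1 \<theta> * top \<partial>lborel)"
    unfolding smoothing_def using t by (intro nn_integral_cong) (auto simp: w1_def hc split: split_indicator)
  also have "\<dots> = (\<integral>\<^sup>+\<theta>. w1 \<theta> \<partial>lborel) * top" by (simp add: nn_integral_multc)
  also have "(\<integral>\<^sup>+\<theta>. w1 \<theta> \<partial>lborel) \<noteq> 0"
  proof
    assume 0: "(\<integral>\<^sup>+\<theta>. w1 \<theta> \<partial>lborel) = 0"
    have "ennreal (1 / 48) \<le> (\<integral>\<^sup>+\<theta>\<in>{0<..12}. ennreal (\<theta> * subordination_density a \<theta>) \<partial>lborel)" by (rule bulk_mass)
    also have "\<dots> \<le> (\<integral>\<^sup>+\<theta>. w1 \<theta> \<partial>lborel)"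
      by (intro nn_integral_mono) (auto simp: w1_def split: split_indicator)
    finally show False using 0 by simp
  qed
  then have "(\<integral>\<^sup>+\<theta>. w1 \<theta> \<partial>lborel) * top = top" by (simp add: ennreal_mult_top)
  finally show ?thesis .
qed

text \<open>Infinite local mass alone does not contradict a real-valued \<open>u\<close>. But if it
  persists during a time interval, \<open>smoothing_top\<close> makes the Duhamel term infinite at
  every point at a later time, where the equation demands a finite value.\<close>

lemma no_solution:
  fixes f :: "'a::euclidean_space \<Rightarrow> real"
  assumes p: "p = 1 + 2 / real DIM('a)" and a2: "1 / 2 \<le> a" and f[measurable]: "f \<in> borel_measurable borel"
    and \<sigma>: "0 < \<sigma>" and M: "0 < M" "ennreal M \<le> (\<integral>\<^sup>+y\<in>ball 0 \<sigma>. ennreal (f y) \<partial>lborel)"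
    and large: "1 - a \<le> blowup_const DIM('a) p * M powr (p - 1)"
    and T: "ennreal (\<sigma> powr (2 / a) * exp (2 / (1 - a))) < T"
  shows "\<not> is_solution a p T (fun_measure f) u"
proof
  assume u: "is_solution a p T (fun_measure f) u"
  have p1: "1 < p" using p by simp
  define t0 where "t0 = \<sigma> powr (2 / a)"
  define t1 where "t1 = t0 * exp (2 / (1 - a))"
  have t0: "0 < t0" using \<sigma> by (simp add: t0_def)
  have t1: "0 < t1" using t0 by (simp add: t1_def)
  \<comment> \<open>\<open>T\<close> may be \<open>top\<close>; a finite \<open>T'\<close> beyond
    the blow-up time suffices.\<close>
  obtain R where R: "ennreal t1 < R" "R < T" using T dense unfolding t1_def t0_def by blast
  then have "R \<noteq> top" by (auto simp: top_unique)
  then obtain T' where T': "R = ennreal T'" "0 \<le> T'" by (cases R) auto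
  have t1T: "t1 < T'" using R T' t1 by (simp add: ennreal_less_iff)
  have sT: "ennreal s < T" if "s < T'" for s
    using that R T' by (metis ennreal_leI less_imp_le order_le_less_trans)
  let ?f = "\<lambda>y. ennreal (f y)" and ?B = "\<lambda>t. ball (0 :: 'a) (t powr (a / 2))"
  \<comment> \<open>\<open>u\<close> is measurable only on the cylinder. Cutting off outside
    \<open>{0<..<T'}\<close> gives a measurable function for all times without changing
    \<open>duhamel\<close> before \<open>T'\<close>.\<close>
  define v where "v s y = (if 0 < s \<and> s < T' then ennreal (u s y powr p) else 0)" for s y
  let ?E = "\<lambda>t. \<integral>\<^sup>+x\<in>?B t. evolution ?f t x \<partial>lborel" and ?D = "\<lambda>t. \<integral>\<^sup>+x\<in>?B t. duhamel v t x \<partial>lborel"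
  let ?H = "\<lambda>s. \<integral>\<^sup>+y\<in>?B s. v s y \<partial>lborel"
  define m where "m t = (\<integral>\<^sup>+x\<in>?B t. ennreal (u t x) \<partial>lborel)" for t
  have slice: "u s \<in> borel_measurable borel" if "0 < s" "s < T'" for s
    using solution_slice_measurable[OF u] that sT by blast
  have u0: "0 \<le> u s y" if "0 < s" "s < T'" for s y
    using u sT[OF that(2)] that by (auto simp: is_solution_def cylinder_def)
  have v[measurable]: "case_prod v \<in> borel_measurable (borel \<Otimes>\<^sub>M borel)"
  proof -
    have "(\<lambda>(t, x). u t x) \<in> borel_measurable (restrict_space borel (cylinder T))"
      using u by (simp add: is_solution_def)
    moreover have "({0<..<T'} \<times> (UNIV :: 'a set)) \<subseteq> cylinder T" using sT by (auto simp: cylinder_def)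
    ultimately have "(\<lambda>(t, x). u t x) \<in> borel_measurable (restrict_space borel ({0<..<T'} \<times> UNIV))"
      using measurable_restrict_mono by blast
    then have "(\<lambda>z. if z \<in> {0<..<T'} \<times> UNIV then (\<lambda>(t, x). u t x) z else 0) \<in> borel_measurable (borel :: (real \<times> 'a) measure)"
      by (subst (asm) measurable_restrict_space_iff) (auto simp: borel_open open_Times)
    then have 1: "(\<lambda>z. if z \<in> {0<..<T'} \<times> UNIV then (\<lambda>(t, x). u t x) z else 0) \<in> borel_measurable (borel \<Otimes>\<^sub>M (borel :: 'a measure))"
      by (simp only: borel_prod)
    have "case_prod v = (\<lambda>z. ennreal ((if z \<in> {0<..<T'} \<times> UNIV then (\<lambda>(t, x). u t x) z else 0) powr p))"
      by (auto simp: fun_eq_iff v_def)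
    then show ?thesis using 1 by simp
  qed
  have eq: "AE t in lborel. 0 < t \<and> t < T' \<longrightarrow> (AE x in lborel. ennreal (u t x) = evolution ?f t x + duhamel v t x)"
    using AE_cylinder[OF solution_eq[OF u f]]
  proof (eventually_elim, intro impI)
    fix t
    assume e: "0 < t \<and> ennreal t < T \<longrightarrow> (AE x in lborel. ennreal (u t x) = evolution ?f t x + duhamel (\<lambda>s y. ennreal (u s y powr p)) t x)"
      and t: "0 < t \<and> t < T'"
    have "duhamel (\<lambda>s y. ennreal (u s y powr p)) t x = duhamel v t x" for x
      using t by (intro antisym duhamel_mono) (auto simp: v_def)
    then show "AE x in lborel. ennreal (u t x) = evolution ?f t x + duhamel v t x"
      using e t sT by auto
  qed
  have split: "AE t in lborel. 0 < t \<and> t < T' \<longrightarrow>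
      m t = ?E t + ?D t"
    using eq
  proof (eventually_elim, intro impI)
    fix t
    assume "0 < t \<and> t < T' \<longrightarrow> (AE x in lborel. ennreal (u t x) = evolution ?f t x + duhamel v t x)" and "0 < t \<and> t < T'"
    then have e: "AE x in lborel. ennreal (u t x) = evolution ?f t x + duhamel v t x" by blast
    have "m t = (\<integral>\<^sup>+x. evolution ?f t x * indicator (?B t) x + duhamel v t x * indicator (?B t) x \<partial>lborel)"
      unfolding m_def using e by (intro nn_integral_cong_AE) (auto elim!: eventually_mono simp: distrib_right)
    also have "\<dots> = ?E t + ?D t"
      by (rule nn_integral_add) measurable
    finally show "m t = ?E t + ?D t" .
  qed
  define V where "V = unit_ball_vol (real DIM('a)) powr (p - 1)"
  have "0 < unit_ball_vol (real DIM('a))" by simp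
  then have V: "0 < V" by (simp add: V_def del: unit_ball_vol_pos)
  have jensen: "epow p (m s) \<le> ennreal (V * s powr a) * ?H s" if s: "0 < s" "s < T'" for s
  proof -
    have [measurable]: "u s \<in> borel_measurable borel" by (rule slice[OF s])
    have "(s powr (a / 2))\<^sup>2 = s powr a" by (simp add: power2_eq_square flip: powr_add)
    then show ?thesis
      unfolding m_def V_def using jensen_ball[OF p, of "s powr (a / 2)" "\<lambda>y. ennreal (u s y)"] s u0[OF s]
      by (simp add: epow_ennreal v_def)
  qed
  have init: "AE t in lborel. t0 < t \<and> t < T' \<longrightarrow> ennreal (heat_ball_const DIM('a) / 2 * M) \<le> m t"
    using split
  proof (eventually_elim, intro impI)
    fix t
    assume i: "0 < t \<and> t < T' \<longrightarrow> m t = ?E t + ?D t"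
      and t: "t0 < t \<and> t < T'"
    have t': "0 < t" using t t0 by linarith
    have "t0 powr (a / 2) \<le> t powr (a / 2)" using t t0 a01 by (intro powr_mono2) auto
    moreover have "t0 powr (a / 2) = \<sigma>" using \<sigma> a01 by (simp add: t0_def powr_powr)
    ultimately have \<sigma>t: "\<sigma> \<le> t powr (a / 2)" by simp
    have "ennreal (heat_ball_const DIM('a) / 2 * M) = ennreal (heat_ball_const DIM('a) / 2) * ennreal M"
      using heat_ball_const_pos[of "DIM('a)"] by (simp add: ennreal_mult'[symmetric])
    also have "\<dots> \<le> ennreal (heat_ball_const DIM('a) / 2) * (\<integral>\<^sup>+y\<in>?B t. ennreal (f y) \<partial>lborel)"
    proof (intro mult_left_mono order_trans[OF M(2)] nn_integral_mono)
      show "indicator (ball 0 \<sigma>) y \<le> (indicator (?B t) y :: ennreal)" for y :: 'a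
        using \<sigma>t by (auto split: split_indicator)
    qed auto
    also have "\<dots> \<le> ?E t"
      by (rule evolution_ball_ge[OF t']) measurable
    also have "\<dots> \<le> m t" using i t t' by simp
    finally show "ennreal (heat_ball_const DIM('a) / 2 * M) \<le> m t" .
  qed
  have ineq: "AE t in lborel. 0 < t \<and> t < T' \<longrightarrow>
      ennreal (blowup_rate DIM('a) p) * (\<integral>\<^sup>+s\<in>{0<..<t}. ennreal ((t - s) powr (a - 1) * s powr (- a)) * epow p (m s) \<partial>lborel) \<le> m t"
    using split
  proof (eventually_elim, intro impI)
    fix t
    assume i: "0 < t \<and> t < T' \<longrightarrow> m t = ?E t + ?D t"
      and t: "0 < t \<and> t < T'"
    let ?G = "\<lambda>s. (ennreal ((t - s) powr (a - 1)) * indicator {0<..<t} s) * ?H s"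
    have Gm: "?G \<in> borel_measurable lborel"
    proof -
      have *: "indicator (?B s) y = (if norm y < s powr (a / 2) then 1 else (0::ennreal))" for s and y :: 'a
        by (auto split: split_indicator)
      show ?thesis unfolding * by measurable
    qed
    have "ennreal (blowup_rate DIM('a) p) * (\<integral>\<^sup>+s\<in>{0<..<t}. ennreal ((t - s) powr (a - 1) * s powr (- a)) * epow p (m s) \<partial>lborel)
      \<le> ennreal (blowup_rate DIM('a) p) * (\<integral>\<^sup>+s. ennreal V * ?G s \<partial>lborel)"
    proof (intro mult_left_mono nn_integral_mono)
      fix s
      show "ennreal ((t - s) powr (a - 1) * s powr (- a)) * epow p (m s) * indicator {0<..<t} s \<le> ennreal V * ?G s"
      proof (cases "s \<in> {0<..<t}")
        case True
        have "ennreal ((t - s) powr (a - 1) * s powr (- a)) * epow p (m s)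
          \<le> ennreal ((t - s) powr (a - 1) * s powr (- a)) * (ennreal (V * s powr a) * ?H s)"
          using True t by (intro mult_left_mono jensen) auto
        also have "\<dots> = ennreal ((t - s) powr (a - 1) * s powr (- a) * (V * s powr a)) * ?H s"
          using V by (subst (3) ennreal_mult) (auto simp: mult.assoc)
        \<comment> \<open>The factor \<open>s powr a\<close> from Jensen's inequality cancels
          \<open>s powr (- a)\<close>; this is the origin of that weight in the inequality for
          \<open>m\<close>.\<close>
        also have "(t - s) powr (a - 1) * s powr (- a) * (V * s powr a) = V * (t - s) powr (a - 1)"
        proof -
          have "s powr (- a) * s powr a = 1" using True by (simp flip: powr_add)
          then show ?thesis by (simp add: algebra_simps)
        qed
        finally show ?thesis using True V by (simp add: ennreal_mult' mult.assoc)
      qed simp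
    qed simp
    also have "\<dots> = ennreal (blowup_rate DIM('a) p * V) * (\<integral>\<^sup>+s. ?G s \<partial>lborel)"
      using Gm V blowup_rate_pos[of "DIM('a)" p] by (subst nn_integral_cmult) (auto simp: ennreal_mult' less_imp_le mult.assoc)
    also have "blowup_rate DIM('a) p * V = heat_ball_const DIM('a) / 96" using V by (simp add: blowup_rate_def V_def)
    also have "ennreal (heat_ball_const DIM('a) / 96) * (\<integral>\<^sup>+s. ?G s \<partial>lborel) \<le> ?D t"
      using t by (intro duhamel_ball_ge[OF a2 _ v]) auto
    also have "\<dots> \<le> m t" using i t by simp
    finally show "ennreal (blowup_rate DIM('a) p) * (\<integral>\<^sup>+s\<in>{0<..<t}. ennreal ((t - s) powr (a - 1) * s powr (- a)) * epow p (m s) \<partial>lborel) \<le> m t" .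
  qed
  have blow: "AE t in lborel. t1 < t \<and> t < T' \<longrightarrow> m t = top"
    unfolding t1_def
  proof (rule integral_inequality_blowup[OF a01 p1 t0 _ blowup_rate_pos _ init ineq])
    show "0 < heat_ball_const DIM('a) / 2 * M" using heat_ball_const_pos[of "DIM('a)"] M by simp
    have "2 * 2 powr (1 / (p - 1)) * (1 - a) \<le> 2 * 2 powr (1 / (p - 1)) * (blowup_const DIM('a) p * M powr (p - 1))"
      by (intro mult_left_mono large) auto
    also have "\<dots> = blowup_rate DIM('a) p * (heat_ball_const DIM('a) / 2 * M) powr (p - 1)"
      by (simp only: blowup_const_def powr_mult) simp
    finally show "2 * 2 powr (1 / (p - 1)) * (1 - a) \<le> blowup_rate DIM('a) p * (heat_ball_const DIM('a) / 2 * M) powr (p - 1)" .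
  qed
  obtain t where t: "t1 < t" "t < T'" "0 < t \<and> t < T' \<longrightarrow> (AE x in lborel. ennreal (u t x) = evolution ?f t x + duhamel v t x)"
    using AE_lborel_ex_between[OF eq t1T] by blast
  then have t': "0 < t" and ae: "AE x in lborel. ennreal (u t x) = evolution ?f t x + duhamel v t x"
    using t1 by auto
  have "duhamel v t x = top" for x
  proof -
    let ?F = "\<lambda>s. (ennreal ((t - s) powr (a - 1)) * indicator {0<..<t} s) * smoothing (t - s) (v s) x"
    have "top = (\<integral>\<^sup>+s. top * indicator {t1<..<t} s \<partial>lborel)"
      using t by (subst nn_integral_cmult_indicator) (auto simp: ennreal_top_mult ennreal_eq_0_iff)
    also have "\<dots> \<le> (\<integral>\<^sup>+s. ?F s \<partial>lborel)"
    proof (rule nn_integral_mono_AE, use blow in eventually_elim)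
      case (elim s)
      show ?case
      proof (cases "s \<in> {t1<..<t}")
        case True
        then have s: "0 < s" "s < t" "s < T'" "m s = top" using elim t t1 by auto
        have [measurable]: "v s \<in> borel_measurable borel"
          using measurable_compose[OF measurable_Pair1' v, of s] by simp
        have "?H s = top"
          using jensen[OF s(1,3)] s(4) by (auto simp: top_unique ennreal_mult_eq_top_iff)
        then have "smoothing (t - s) (v s) x = top" using s by (intro smoothing_top) auto
        then show ?thesis using s True by (simp add: ennreal_mult_top)
      qed simp
    qed
    finally have "(\<integral>\<^sup>+s. ?F s \<partial>lborel) = top" by (simp add: top_unique)
    then show ?thesis unfolding duhamel_def using a01 by (simp add: ennreal_mult_top)
  qed
  with ae have "AE x :: 'a in lborel. False" by simp
  then have "emeasure lborel (UNIV :: 'a set) = 0"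
    by (subst (asm) AE_iff_measurable[where N = UNIV]) auto
  then show False by simp
qed

end

section \<open>The singular initial data\<close>

text \<open>Polar coordinates for radial functions: by the volume of closed balls, the image of
  Lebesgue measure under \<open>norm\<close> agrees with the radial density on all
  half-lines.\<close>

lemma nn_integral_norm:
  fixes f :: "real \<Rightarrow> ennreal"
  assumes [measurable]: "f \<in> borel_measurable borel"
  shows "(\<integral>\<^sup>+x. f (norm (x :: 'a::euclidean_space)) \<partial>lborel)
    = (\<integral>\<^sup>+r\<in>{0..}. ennreal (unit_ball_vol (real DIM('a)) * (real DIM('a) * r ^ (DIM('a) - 1))) * f r \<partial>lborel)"
proof -
  define V where "V = unit_ball_vol (real DIM('a))"
  define n where "n = DIM('a)"
  have n: "0 < n" by (simp add: n_def)
  have V: "0 < V" by (simp add: V_def)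
  let ?d = "\<lambda>r. ennreal (V * (real n * r ^ (n - 1))) * indicator {0..} r"
  have "distr lborel borel (norm :: 'a \<Rightarrow> real) = density lborel ?d"
  proof (rule measure_eqI_generator_eq[where E = "range (\<lambda>a. {..a})" and A = "\<lambda>i. {..real i}" and \<Omega> = UNIV])
    show "Int_stable (range (\<lambda>a::real. {..a}))"
      by (auto simp: Int_stable_def)
    show "sets (distr lborel borel (norm :: 'a \<Rightarrow> real)) = sigma_sets UNIV (range (\<lambda>a. {..a}))"
      "sets (density lborel ?d) = sigma_sets UNIV (range (\<lambda>a. {..a}))"
      by (simp_all add: borel_eq_atMost)
    show "(\<Union>i. {..real i}) = UNIV" by (auto intro: real_arch_simple)
    have 1: "emeasure (distr lborel borel (norm :: 'a \<Rightarrow> real)) {..r} = (if 0 \<le> r then ennreal (V * r ^ n) else 0)" for r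
    proof -
      have "norm -` {..r} = cball (0::'a) r" by (auto simp: dist_norm)
      then have "emeasure (distr lborel borel (norm :: 'a \<Rightarrow> real)) {..r} = emeasure lborel (cball (0::'a) r)"
        by (simp add: emeasure_distr)
      then show ?thesis by (auto simp: emeasure_cball V_def n_def)
    qed
    have 2: "emeasure (density lborel ?d) {..r} = (if 0 \<le> r then ennreal (V * r ^ n) else 0)" for r
    proof (cases "0 \<le> r")
      case True
      have "emeasure (density lborel ?d) {..r} = (\<integral>\<^sup>+s. ennreal (V * (real n * s ^ (n - 1))) * indicator {0..r} s \<partial>lborel)"
        by (subst emeasure_density) (auto intro!: nn_integral_cong split: split_indicator)
      also have "\<dots> = ennreal (V * r ^ n - V * 0 ^ n)"
        by (rule nn_integral_FTC_Icc) (use V True in \<open>auto intro!: derivative_eq_intros\<close>)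
      finally show ?thesis using True n by (simp add: zero_power)
    next
      case False
      have "emeasure (density lborel ?d) {..r} = (\<integral>\<^sup>+s. ?d s * indicator {..r} s \<partial>lborel)"
        by (subst emeasure_density) auto
      also have "\<dots> = (\<integral>\<^sup>+s. 0 \<partial>(lborel :: real measure))"
        by (rule nn_integral_cong) (use False in \<open>auto split: split_indicator\<close>)
      finally show ?thesis using False by simp
    qed
    show "emeasure (distr lborel borel (norm :: 'a \<Rightarrow> real)) X = emeasure (density lborel ?d) X"
      if "X \<in> range (\<lambda>a::real. {..a})" for X
      using that 1 2 by auto
    show "emeasure (distr lborel borel (norm :: 'a \<Rightarrow> real)) {..real i} \<noteq> \<infinity>" for i
      using 1 by simp
  qed auto
  then have "(\<integral>\<^sup>+r. f r \<partial>distr lborel borel (norm :: 'a \<Rightarrow> real)) = (\<integral>\<^sup>+r. f r \<partial>density lborel ?d)" by simp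
  then show ?thesis
    by (simp add: nn_integral_distr nn_integral_density V_def n_def mult_ac)
qed

section \<open>Mass and size of the data\<close>

lemma f_eps_measurable[measurable]: "(f_eps \<epsilon> :: 'a::euclidean_space \<Rightarrow> real) \<in> borel_measurable borel"
  unfolding f_eps_def by measurable

lemma f_eps_nonneg: "0 \<le> f_eps \<epsilon> x"
  by (simp add: f_eps_def)

text \<open>In polar coordinates the integrand is a multiple of
  \<open>(- ln r) powr (- q - 1) / r\<close>, with primitive \<open>(- ln r) powr (- q) / q\<close>;
  thus \<open>q\<close> is the decay exponent of the mass. \<open>3 / 2 \<le> L\<close> keeps the
  ball inside the support of \<open>f_eps\<close>.\<close>

lemma f_eps_mass:
  fixes \<epsilon> L \<kappa> :: real
  assumes q: "q = real DIM('a) / 2 - \<epsilon>" "0 < q" and L: "3 / 2 \<le> L" and \<kappa>: "0 < \<kappa>"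
  shows "(\<integral>\<^sup>+x\<in>ball 0 (exp (- L)). ennreal (\<kappa> * f_eps \<epsilon> (x :: 'a::euclidean_space)) \<partial>lborel)
    = ennreal (\<kappa> * (unit_ball_vol (real DIM('a)) * real DIM('a) / q) * L powr (- q))"
proof -
  define V where "V = unit_ball_vol (real DIM('a))"
  define n where "n = DIM('a)"
  define D where "D = V * real n / q"
  have n: "0 < n" and V: "0 < V" by (auto simp: n_def V_def)
  let ?\<sigma> = "exp (- L)"
  have \<sigma>: "?\<sigma> \<le> exp (- 3 / 2)" using L by simp
  let ?\<phi> = "\<lambda>r. ennreal (\<kappa> * (r powr (- real n) * \<bar>ln r\<bar> powr (- q - 1))) * indicator {..<?\<sigma>} r"
  let ?F = "\<lambda>r. \<kappa> * D * (- ln r) powr (- q)"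
  let ?F' = "\<lambda>r. \<kappa> * (V * real n) / r * (- ln r) powr (- q - 1)"
  have "(\<integral>\<^sup>+x\<in>ball 0 ?\<sigma>. ennreal (\<kappa> * f_eps \<epsilon> (x :: 'a)) \<partial>lborel) = (\<integral>\<^sup>+x. ?\<phi> (norm (x :: 'a)) \<partial>lborel)"
  proof (intro nn_integral_cong)
    fix x :: 'a
    have e: "- (real DIM('a) / 2) - 1 + \<epsilon> = - q - 1" by (simp add: q)
    have s: "norm x < exp (- 3 / 2)" if "norm x < ?\<sigma>" using that \<sigma> by (rule less_le_trans)
    show "ennreal (\<kappa> * f_eps \<epsilon> x) * indicator (ball 0 ?\<sigma>) x = ?\<phi> (norm x)"
      unfolding f_eps_def e n_def using s by (simp split: split_indicator)
  qed
  also have "\<dots> = (\<integral>\<^sup>+r\<in>{0..}. ennreal (V * (real n * r ^ (n - 1))) * ?\<phi> r \<partial>lborel)"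
    unfolding V_def n_def by (rule nn_integral_norm) measurable
  also have "\<dots> = (\<integral>\<^sup>+r. ennreal (indicator {0<..<?\<sigma>} r *\<^sub>R ?F' r) \<partial>lborel)"
  proof (rule nn_integral_cong_AE, use AE_lborel_singleton[of 0] in eventually_elim)
    case (elim r)
    show ?case
    proof (cases "r \<in> {0<..<?\<sigma>}")
      case True
      have "ln r < ln ?\<sigma>" using True by (subst ln_less_cancel_iff) auto
      then have l: "\<bar>ln r\<bar> = - ln r" using L by simp
      have "V * (real n * r ^ (n - 1)) * (\<kappa> * (r powr (- real n) * (- ln r) powr (- q - 1))) = ?F' r"
      proof -
        have "r ^ (n - 1) * r powr (- real n) = 1 / r"
          using True n by (simp add: powr_minus powr_realpow power_diff divide_simps flip: power_Suc2 power_add)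
        then have "V * real n * \<kappa> * (r ^ (n - 1) * r powr (- real n)) * (- ln r) powr (- q - 1) = ?F' r" by simp
        then show ?thesis by (simp only: mult_ac)
      qed
      then show ?thesis using True l V \<kappa> by (simp add: ennreal_mult'[symmetric])
    next
      case False
      then show ?thesis using elim by (auto split: split_indicator)
    qed
  qed
  also have "\<dots> = ennreal (\<kappa> * D * L powr (- q))"
  proof -
    have neg: "ln r < 0" if "0 < r" "r < ?\<sigma>" for r
    proof -
      have "ln r < ln ?\<sigma>" using that by (subst ln_less_cancel_iff) auto
      then show ?thesis using L by simp
    qed
    have F: "(?F has_real_derivative ?F' r) (at r)" if "0 < r" "r < ?\<sigma>" for r
    proof -
      have "((\<lambda>r. - ln r) has_real_derivative - (1 / r)) (at r)"
        using that by (auto intro!: derivative_eq_intros)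
      then have "((\<lambda>r. (- ln r) powr (- q)) has_real_derivative - q * (- ln r) powr (- q - of_nat 1) * - (1 / r)) (at r)"
        using neg[OF that] by (intro DERIV_fun_powr) auto
      then have "(?F has_real_derivative \<kappa> * D * (- q * (- ln r) powr (- q - of_nat 1) * - (1 / r))) (at r)"
        by (rule DERIV_cmult)
      moreover have "\<kappa> * D * (- q * (- ln r) powr (- q - of_nat 1) * - (1 / r)) = ?F' r"
        using q(2) by (simp add: D_def)
      ultimately show ?thesis by (simp only:)
    qed
    have cont: "isCont ?F' r" if "0 < r" "r < ?\<sigma>" for r
      using neg[OF that] that by (intro continuous_intros) auto
    have nn: "0 \<le> ?F' r" if "0 < r" for r using that V \<kappa> by simp
    have F0: "(?F \<longlongrightarrow> 0) (at_right 0)" using q by real_asymp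
    have F1: "(?F \<longlongrightarrow> \<kappa> * D * L powr (- q)) (at_left ?\<sigma>)"
    proof -
      have "(?F \<longlongrightarrow> \<kappa> * D * (- ln ?\<sigma>) powr (- q)) (at_left ?\<sigma>)"
        using L by (intro tendsto_intros) auto
      then show ?thesis by simp
    qed
    note ftc = interval_integral_FTC_nonneg[of "ereal 0" "ereal ?\<sigma>" ?F ?F' 0 "\<kappa> * D * L powr (- q)"]
    have i: "set_integrable lborel (einterval (ereal 0) (ereal ?\<sigma>)) ?F'"
      by (rule ftc(1)) (use F cont nn F0 F1 in \<open>auto simp: ereal_tendsto_simps\<close>)
    have e: "(LBINT r=ereal 0..ereal ?\<sigma>. ?F' r) = \<kappa> * D * L powr (- q) - 0"
      by (rule ftc(2)) (use F cont nn F0 F1 in \<open>auto simp: ereal_tendsto_simps\<close>)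
    have "(\<integral>\<^sup>+r. ennreal (indicator {0<..<?\<sigma>} r *\<^sub>R ?F' r) \<partial>lborel) = ennreal (LINT r|lborel. indicator {0<..<?\<sigma>} r *\<^sub>R ?F' r)"
      using i nn by (intro nn_integral_eq_integral AE_I2) (auto simp: set_integrable_def split: split_indicator)
    also have "(LINT r|lborel. indicator {0<..<?\<sigma>} r *\<^sub>R ?F' r) = \<kappa> * D * L powr (- q)"
      using e by (simp add: interval_lebesgue_integral_def set_lebesgue_integral_def)
    finally show "(\<integral>\<^sup>+r. ennreal (indicator {0<..<?\<sigma>} r *\<^sub>R ?F' r) \<partial>lborel) = ennreal (\<kappa> * D * L powr (- q))" .
  qed
  finally show ?thesis by (simp add: D_def V_def n_def)
qed

text \<open>\<open>N * x - s * ln x\<close> increases for \<open>x \<ge> s / N\<close>. With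
  \<open>x\<close> the negative logarithm of the norm, this says that \<open>f_eps\<close> is
  radially decreasing on its support; the cutoff radius \<open>exp (- 3 / 2)\<close> fits
  \<open>s = q + 1 \<le> 3 / 2 * N\<close>.\<close>

lemma exp_powr_mono:
  fixes N s x y :: real
  assumes "0 \<le> s" "s \<le> 3 / 2 * N" "3 / 2 \<le> x" "x \<le> y"
  shows "exp (N * x) * x powr (- s) \<le> exp (N * y) * y powr (- s)"
proof -
  have "ln (y / x) \<le> y / x - 1" using assms by (intro ln_le_minus_one) auto
  also have "\<dots> = (y - x) / x" using assms by (simp add: field_simps)
  also have "\<dots> \<le> (y - x) / (3 / 2)" using assms by (intro divide_left_mono) auto
  finally have l: "ln (y / x) \<le> 2 / 3 * (y - x)" by simp
  have "s * ln (y / x) \<le> (3 / 2 * N) * (2 / 3 * (y - x))"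
    using assms l by (intro mult_mono) auto
  moreover have "ln (y / x) = ln y - ln x" using assms by (subst ln_div) auto
  moreover have "(3 / 2 * N) * (2 / 3 * (y - x)) = N * (y - x)" by simp
  ultimately have "s * (ln y - ln x) \<le> N * (y - x)" by (simp only:)
  then have "exp (N * x + - s * ln x) \<le> exp (N * y + - s * ln y)" by (simp add: algebra_simps)
  moreover have "exp (N * z) * z powr (- s) = exp (N * z + - s * ln z)" if "0 < z" for z
    using that by (simp add: exp_add powr_def exp_minus exp_diff divide_inverse)
  ultimately show ?thesis using assms by simp
qed

lemma f_eps_le:
  assumes q: "q = real DIM('a) / 2 - \<epsilon>" "0 < q" "0 < \<epsilon>" and L: "3 / 2 \<le> L" and x: "(x :: 'a::euclidean_space) \<notin> ball 0 (exp (- L))"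
  shows "f_eps \<epsilon> x \<le> exp (real DIM('a) * L) * L powr (- (q + 1))"
proof (cases "x \<in> ball 0 (exp (- 3 / 2))")
  case True
  define l where "l = - ln (norm x)"
  have nx: "exp (- L) \<le> norm x" "norm x < exp (- 3 / 2)" using x True by auto
  then have n0: "0 < norm x" using exp_gt_zero[of "- L"] by linarith
  have "ln (exp (- L)) \<le> ln (norm x)" using nx n0 by (subst ln_le_cancel_iff) auto
  then have l1: "l \<le> L" by (simp add: l_def)
  have "ln (norm x) < ln (exp (- 3 / 2))" using nx n0 by (subst ln_less_cancel_iff) auto
  then have l2: "3 / 2 \<le> l" by (simp add: l_def)
  have N1: "1 \<le> real DIM('a)" using DIM_positive[where 'a = 'a] by linarith
  have "norm x powr (- real DIM('a)) = exp (real DIM('a) * l)"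
    using n0 by (simp add: powr_def l_def)
  moreover have "\<bar>ln (norm x)\<bar> = l" using l2 by (simp add: l_def)
  moreover have "- (real DIM('a) / 2) - 1 + \<epsilon> = - (q + 1)" by (simp add: q)
  moreover have "indicator (ball 0 (exp (- 3 / 2))) x = (1 :: real)" using True by simp
  ultimately have "f_eps \<epsilon> x = exp (real DIM('a) * l) * l powr (- (q + 1))"
    by (simp only: f_eps_def mult_1_right)
  also have "\<dots> \<le> exp (real DIM('a) * L) * L powr (- (q + 1))"
  proof (rule exp_powr_mono)
    show "q + 1 \<le> 3 / 2 * real DIM('a)" using q N1 by linarith
  qed (use l1 l2 q in auto)
  finally show ?thesis .
next
  case False
  then show ?thesis by (simp add: f_eps_def)
qed

context fractional
begin

text \<open>The splitting radius \<open>exp (- L)\<close> equals \<open>T powr (a / 2)\<close> for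
  \<open>T = exp (- 2 * L / a)\<close>. The factor \<open>exp (2 * L)\<close> from the size of the
  outer part is cancelled by \<open>T powr a\<close>, so the hypothesis \<open>sup\<close> involves
  only a power of \<open>L\<close>.\<close>

lemma f_eps_solvable:
  fixes \<epsilon> \<kappa> L q :: real
  assumes p: "p = 1 + 2 / real DIM('a)" and a2: "1 / 2 \<le> a" and q: "q = real DIM('a) / 2 - \<epsilon>" "0 < q" "0 < \<epsilon>"
    and L: "3 / 2 \<le> L" and \<kappa>: "0 < \<kappa>"
    and mass: "(\<kappa> * (unit_ball_vol (real DIM('a)) * real DIM('a) / q) * L powr (- q)) powr (2 / real DIM('a)) \<le> mass_const p * (1 - a)"
    and sup: "(\<kappa> * L powr (- (q + 1))) powr (2 / real DIM('a)) \<le> sup_const p"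
  shows "\<exists>u. is_minimal_solution a p (ennreal (exp (- 2 * L / a))) (fun_measure (\<lambda>x :: 'a::euclidean_space. \<kappa> * f_eps \<epsilon> x)) u"
proof -
  define V where "V = unit_ball_vol (real DIM('a))"
  have V: "0 < V" by (simp add: V_def)
  let ?B = "ball (0 :: 'a) (exp (- L))"
  let ?f1 = "\<lambda>x :: 'a. \<kappa> * f_eps \<epsilon> x * indicator ?B x"
  let ?f2 = "\<lambda>x :: 'a. \<kappa> * f_eps \<epsilon> x * indicator (- ?B) x"
  let ?M = "\<kappa> * (V * real DIM('a) / q) * L powr (- q)"
  let ?b = "\<kappa> * (exp (real DIM('a) * L) * L powr (- (q + 1)))"
  have p2: "p - 1 = 2 / real DIM('a)" by (simp add: p)
  have sum: "(\<lambda>x. ?f1 x + ?f2 x) = (\<lambda>x. \<kappa> * f_eps \<epsilon> x)"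
    by (auto simp: fun_eq_iff split: split_indicator)
  have f1: "(\<integral>\<^sup>+x. ennreal (?f1 x) \<partial>lborel) = ennreal ?M"
    unfolding V_def f_eps_mass[OF q(1,2) L \<kappa>, symmetric]
    by (intro nn_integral_cong) (auto split: split_indicator)
  have tot: "(\<integral>\<^sup>+x. ennreal (\<kappa> * f_eps \<epsilon> (x :: 'a)) \<partial>lborel) < \<infinity>"
  proof -
    have "(\<integral>\<^sup>+x. ennreal (\<kappa> * f_eps \<epsilon> (x :: 'a)) \<partial>lborel) = (\<integral>\<^sup>+x\<in>ball 0 (exp (- (3 / 2))). ennreal (\<kappa> * f_eps \<epsilon> (x :: 'a)) \<partial>lborel)"
      by (intro nn_integral_cong) (auto simp: f_eps_def split: split_indicator)
    also have "\<dots> = ennreal (\<kappa> * (unit_ball_vol (real DIM('a)) * real DIM('a) / q) * (3 / 2) powr (- q))"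
      using f_eps_mass[OF q(1,2) order_refl \<kappa>] .
    finally show ?thesis by simp
  qed
  have bT: "?b powr (p - 1) * exp (- 2 * L / a) powr a \<le> sup_const p"
  proof -
    have "?b powr (p - 1) = (\<kappa> * L powr (- (q + 1))) powr (2 / real DIM('a)) * exp (real DIM('a) * L) powr (2 / real DIM('a))"
      unfolding p2 by (simp only: powr_mult mult_ac)
    moreover have "exp (real DIM('a) * L) powr (2 / real DIM('a)) = exp (2 * L)" by (simp add: exp_powr_real)
    moreover have "exp (- 2 * L / a) powr a = exp (- 2 * L)" using a01 by (simp add: exp_powr_real)
    ultimately have "?b powr (p - 1) * exp (- 2 * L / a) powr a = (\<kappa> * L powr (- (q + 1))) powr (2 / real DIM('a)) * (exp (2 * L) * exp (- 2 * L))"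
      by (simp only: mult.assoc)
    then show ?thesis using sup by (simp flip: exp_add)
  qed
  have "\<exists>u. is_minimal_solution a p (ennreal (exp (- 2 * L / a))) (fun_measure (\<lambda>x. ?f1 x + ?f2 x)) u"
  proof (rule ex_minimal_solution[OF p a2, where M = ?M and b = ?b])
    show "?M powr (p - 1) \<le> mass_const p * (1 - a)" using mass by (simp add: p2 V_def)
    show "?f2 x \<le> ?b" for x
      using f_eps_le[OF q L, of x] \<kappa> L by (auto split: split_indicator simp del: mem_ball intro!: mult_left_mono)
    show "(\<integral>\<^sup>+x. ennreal (?f1 x + ?f2 x) \<partial>lborel) < \<infinity>" using tot sum by metis
    show "0 < ?M" using V q L \<kappa> by simp
    show "0 < ?b" using \<kappa> L by simp
    show "(\<integral>\<^sup>+x. ennreal (?f1 x) \<partial>lborel) \<le> ennreal ?M" using f1 by simp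
    show "?b powr (p - 1) * exp (- 2 * L / a) powr a \<le> sup_const p" by (rule bT)
  qed (use \<kappa> in \<open>auto simp: f_eps_nonneg\<close>)
  then show ?thesis unfolding sum .
qed

lemma f_eps_not_solvable:
  fixes \<epsilon> \<kappa> L q :: real
  assumes p: "p = 1 + 2 / real DIM('a)" and a2: "1 / 2 \<le> a" and q: "q = real DIM('a) / 2 - \<epsilon>" "0 < q"
    and L: "3 / 2 \<le> L" and \<kappa>: "0 < \<kappa>"
    and mass: "1 - a \<le> blowup_const DIM('a) p * (\<kappa> * (unit_ball_vol (real DIM('a)) * real DIM('a) / q) * L powr (- q)) powr (2 / real DIM('a))"
    and T: "ennreal (exp (- 2 * L / a + 2 / (1 - a))) < T"
  shows "\<not> is_solution a p T (fun_measure (\<lambda>x :: 'a::euclidean_space. \<kappa> * f_eps \<epsilon> x)) u"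
proof (rule no_solution[OF p a2, where \<sigma> = "exp (- L)"])
  show "ennreal (\<kappa> * (unit_ball_vol (real DIM('a)) * real DIM('a) / q) * L powr (- q)) \<le> (\<integral>\<^sup>+x\<in>ball 0 (exp (- L)). ennreal (\<kappa> * f_eps \<epsilon> (x :: 'a)) \<partial>lborel)"
    unfolding f_eps_mass[OF q L \<kappa>] ..
  show "0 < \<kappa> * (unit_ball_vol (real DIM('a)) * real DIM('a) / q) * L powr (- q)"
    using q L \<kappa> by simp
  show "1 - a \<le> blowup_const DIM('a) p * (\<kappa> * (unit_ball_vol (real DIM('a)) * real DIM('a) / q) * L powr (- q)) powr (p - 1)"
    using mass by (simp add: p)
  have "exp (- L) powr (2 / a) = exp (- 2 * L / a)" by (simp add: exp_powr_real mult.commute)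
  then have "exp (- L) powr (2 / a) * exp (2 / (1 - a)) = exp (- 2 * L / a + 2 / (1 - a))"
    by (simp only: exp_add)
  then show "ennreal (exp (- L) powr (2 / a) * exp (2 / (1 - a))) < T" using T by simp
qed auto

end

text \<open>The scale \<open>K\<close> satisfies \<open>\<kappa> * K powr (- q) = (1 - \<alpha>) powr (N / 2)\<close>: up to constants, the ball of radius \<open>exp (- K)\<close> carries
  the critical mass \<open>(1 - \<alpha>) powr (N / 2)\<close>. Moreover \<open>K * (1 - \<alpha>)\<close> tends to infinity, so the factor \<open>exp (2 / (1 - \<alpha>))\<close>
  lost in the nonexistence argument is negligible.\<close>

lemma life_span_bounds:
  fixes \<epsilon> q :: real
  defines "N \<equiv> real DIM('a::euclidean_space)"
  assumes p: "p = 1 + 2 / N" and q: "q = N / 2 - \<epsilon>" "0 < q" "0 < \<epsilon>"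
  shows "\<exists>C1 C2. 0 < C1 \<and> C1 \<le> C2 \<and> (\<forall>\<kappa>>0. \<exists>\<alpha>0. 0 < \<alpha>0 \<and> \<alpha>0 < 1 \<and> (\<forall>\<alpha>. \<alpha>0 < \<alpha> \<and> \<alpha> < 1 \<longrightarrow>
     (let K = \<kappa> powr (1 / q) * (1 - \<alpha>) powr (- (N / (2 * q))); T = life_span \<alpha> p (fun_measure (\<lambda>x :: 'a. \<kappa> * f_eps \<epsilon> x))
      in ennreal (exp (- (C2 * K))) \<le> T \<and> T \<le> ennreal (exp (- (C1 * K))))))"
proof -
  have N: "1 \<le> N" using DIM_positive[where 'a = 'a] unfolding N_def by linarith
  have p1: "1 < p" using N by (simp add: p)
  define D where "D = unit_ball_vol N * N / q"
  have D: "0 < D" using N q by (simp add: D_def)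
  \<comment> \<open>\<open>(\<kappa> * L powr (- q)) powr (2 / N) \<le> Y * (1 - a)\<close> will
    imply both hypotheses of \<open>f_eps_solvable\<close>, on the mass and on the size.\<close>
  define Y where "Y = min (sup_const p) (mass_const p / D powr (2 / N))"
  have Y: "0 < Y" using sup_const_pos[of p] mass_const_pos[OF p1] D by (simp add: Y_def)
  \<comment> \<open>Solves \<open>((C2 / 4) powr (- q)) powr (2 / N) = Y\<close>. The 4 is there
    because \<open>L = a / 2 * (C2 * K)\<close> is only known to be at least
    \<open>C2 / 4 * K\<close>.\<close>
  define C2 where "C2 = 4 * Y powr (- (N / (2 * q)))"
  define B where "B = blowup_const DIM('a) p"
  have B: "0 < B" by (simp add: B_def blowup_const_pos)
  \<comment> \<open>Makes the mass hypothesis of \<open>f_eps_not_solvable\<close> an equality at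
    \<open>L = C * K\<close>, as expressed by \<open>CB\<close>.\<close>
  define C where "C = (B * D powr (2 / N)) powr (N / (2 * q))"
  \<comment> \<open>The minimum ensures \<open>C1 \<le> C2\<close>; a smaller constant only weakens
    the upper bound for the life span.\<close>
  define C1 where "C1 = min C C2"
  have C2: "0 < C2" and C: "0 < C" using Y B D by (auto simp: C2_def C_def)
  have C2Y: "((C2 / 4) powr (- q)) powr (2 / N) = Y"
    using Y N q(2) by (simp add: C2_def powr_powr)
  have CB: "B * D powr (2 / N) * (C powr (- q)) powr (2 / N) = 1"
  proof -
    have "(C powr (- q)) powr (2 / N) = (B * D powr (2 / N)) powr (- 1)"
      using N q(2) by (simp add: C_def powr_powr)
    then show ?thesis using B D by (simp add: powr_minus_divide)
  qed
  \<comment> \<open>\<open>X \<le> K * (1 - a)\<close> will give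
    \<open>2 / (1 - a) \<le> C * K\<close> and, in both halves,
    \<open>3 / 2 \<le> L\<close>.\<close>
  define X where "X = max (6 / C) (6 / C2)"
  have X: "0 < X" using C C2 by (simp add: X_def less_max_iff_disj)
  define e where "e = N / (2 * q) - 1"
  have "2 * q < N" using q by simp
  then have e: "0 < e" using q(2) by (simp add: e_def)
  have main: "\<exists>\<alpha>0. 0 < \<alpha>0 \<and> \<alpha>0 < 1 \<and> (\<forall>\<alpha>. \<alpha>0 < \<alpha> \<and> \<alpha> < 1 \<longrightarrow>
     (let K = \<kappa> powr (1 / q) * (1 - \<alpha>) powr (- (N / (2 * q))); T = life_span \<alpha> p (fun_measure (\<lambda>x :: 'a. \<kappa> * f_eps \<epsilon> x))
      in ennreal (exp (- (C2 * K))) \<le> T \<and> T \<le> ennreal (exp (- (C1 * K)))))" if \<kappa>: "0 < \<kappa>" for \<kappa>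
  proof -
    \<comment> \<open>\<open>K * (1 - a) = \<kappa> powr (1 / q) * (1 - a) powr (- e)\<close>
      reaches \<open>X\<close> once \<open>1 - a < \<delta>\<close>; \<open>e\<close> is positive
      because \<open>\<epsilon>\<close> is.\<close>
    define \<delta> where "\<delta> = (X * \<kappa> powr (- (1 / q))) powr (- (1 / e))"
    have \<delta>: "0 < \<delta>" using X \<kappa> by (simp add: \<delta>_def)
    have "ennreal (exp (- (C2 * K))) \<le> T \<and> T \<le> ennreal (exp (- (C1 * K)))"
      if ab: "max (1 / 2) (1 - \<delta>) < a" "a < 1" and Kd: "K = \<kappa> powr (1 / q) * (1 - a) powr (- (N / (2 * q)))"
        and Td: "T = life_span a p (fun_measure (\<lambda>x :: 'a. \<kappa> * f_eps \<epsilon> x))" for a K T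
    proof -
      interpret fractional a by standard (use ab in auto)
      have a2: "1 / 2 \<le> a" and a\<delta>: "1 - a < \<delta>" "0 < 1 - a" using ab by auto
      have K: "0 < K" using \<kappa> a\<delta> by (simp add: Kd)
      have Kq: "\<kappa> * K powr (- q) = (1 - a) powr (N / 2)"
      proof -
        have "K powr (- q) = (\<kappa> powr (1 / q)) powr (- q) * ((1 - a) powr (- (N / (2 * q)))) powr (- q)"
          unfolding Kd by (rule powr_mult)
        also have "(\<kappa> powr (1 / q)) powr (- q) = 1 / \<kappa>" using q(2) \<kappa> by (simp add: powr_powr powr_minus_divide)
        also have "((1 - a) powr (- (N / (2 * q)))) powr (- q) = (1 - a) powr (N / 2)" using q(2) by (simp add: powr_powr)
        finally show ?thesis using \<kappa> by simp
      qed
      have scale: "(\<kappa> * (c * K) powr (- q)) powr (2 / N) = (c powr (- q)) powr (2 / N) * (1 - a)" for c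
      proof -
        have "\<kappa> * (c * K) powr (- q) = c powr (- q) * (1 - a) powr (N / 2)"
          unfolding powr_mult Kq[symmetric] by (simp only: mult_ac)
        then have "(\<kappa> * (c * K) powr (- q)) powr (2 / N) = (c powr (- q)) powr (2 / N) * ((1 - a) powr (N / 2)) powr (2 / N)"
          by (simp only: powr_mult)
        also have "((1 - a) powr (N / 2)) powr (2 / N) = 1 - a" using N a\<delta> by (simp add: powr_powr)
        finally show ?thesis .
      qed
      have XK: "X / (1 - a) \<le> K"
      proof -
        have "\<delta> powr (- e) \<le> (1 - a) powr (- e)" using a\<delta> e by (intro powr_mono2') auto
        moreover have "\<delta> powr (- e) = X * \<kappa> powr (- (1 / q))" using e X \<kappa> by (simp add: \<delta>_def powr_powr)
        ultimately have "\<kappa> powr (1 / q) * (X * \<kappa> powr (- (1 / q))) \<le> \<kappa> powr (1 / q) * (1 - a) powr (- e)"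
          by (intro mult_left_mono) auto
        moreover have "\<kappa> powr (1 / q) * (X * \<kappa> powr (- (1 / q))) = X" using \<kappa> by (simp add: powr_minus_divide)
        moreover have "\<kappa> powr (1 / q) * (1 - a) powr (- e) = K * (1 - a)"
        proof -
          have "(1 - a) powr (- e) = (1 - a) powr (- (N / (2 * q))) * (1 - a) powr 1"
            unfolding powr_add[symmetric] by (simp add: e_def)
          then show ?thesis using a\<delta> by (simp add: Kd)
        qed
        ultimately show ?thesis using a\<delta> by (simp add: divide_le_eq)
      qed
      have "X * 1 \<le> X / (1 - a)" using X a\<delta> a01 by (simp add: le_divide_eq mult_left_le)
      then have XK': "X \<le> K" using XK by simp
      have CK: "6 \<le> C * K" and C2K: "6 \<le> C2 * K"
      proof -
        have "6 / C \<le> K" "6 / C2 \<le> K" using XK' by (auto simp: X_def)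
        then show "6 \<le> C * K" "6 \<le> C2 * K" using C C2 by (simp_all add: divide_le_eq mult.commute)
      qed
      have CK2: "2 / (1 - a) \<le> C * K"
      proof -
        have "6 / C / (1 - a) \<le> X / (1 - a)" using a\<delta> by (intro divide_right_mono) (auto simp: X_def)
        then have "6 / C / (1 - a) \<le> K" using XK by linarith
        then have "C * (6 / C / (1 - a)) \<le> C * K" using C by (intro mult_left_mono) auto
        then have "6 / (1 - a) \<le> C * K" using C by simp
        moreover have "2 / (1 - a) \<le> 6 / (1 - a)" using a\<delta> by (intro divide_right_mono) auto
        ultimately show ?thesis by linarith
      qed
      have "ennreal (exp (- (C2 * K))) \<le> T"
      proof -
        \<comment> \<open>Chosen so that the existence time \<open>exp (- 2 * L / a)\<close> is
          \<open>exp (- (C2 * K))\<close>.\<close>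
        define L where "L = a / 2 * (C2 * K)"
        have L4: "C2 / 4 * K \<le> L" using a2 C2 K by (simp add: L_def) 
        have L: "3 / 2 \<le> L" using L4 C2K by linarith
        have mono: "L powr (- q) \<le> (C2 / 4 * K) powr (- q)"
          using L4 C2 K q by (intro powr_mono2') auto
        have m1: "(\<kappa> * L powr (- q)) powr (2 / N) \<le> Y * (1 - a)"
        proof -
          have "(\<kappa> * L powr (- q)) powr (2 / N) \<le> (\<kappa> * (C2 / 4 * K) powr (- q)) powr (2 / N)"
            by (rule powr_mono2) (use mono \<kappa> N in \<open>auto intro: mult_left_mono\<close>)
          then show ?thesis unfolding scale C2Y .
        qed
        have mass: "(\<kappa> * D * L powr (- q)) powr (2 / N) \<le> mass_const p * (1 - a)"
        proof -
          have "(\<kappa> * D * L powr (- q)) powr (2 / N) = D powr (2 / N) * (\<kappa> * L powr (- q)) powr (2 / N)"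
            by (simp only: powr_mult mult_ac)
          also have "\<dots> \<le> D powr (2 / N) * (Y * (1 - a))" using m1 by (intro mult_left_mono) auto
          also have "\<dots> \<le> D powr (2 / N) * (mass_const p / D powr (2 / N) * (1 - a))"
            using a\<delta> by (intro mult_left_mono mult_right_mono) (auto simp: Y_def)
          also have "\<dots> = mass_const p * (1 - a)" using D by simp
          finally show ?thesis .
        qed
        have sup: "(\<kappa> * L powr (- (q + 1))) powr (2 / N) \<le> sup_const p"
        proof -
          have "L powr (- (q + 1)) \<le> L powr (- q)" using L by (intro powr_mono) auto
          then have "(\<kappa> * L powr (- (q + 1))) powr (2 / N) \<le> (\<kappa> * L powr (- q)) powr (2 / N)"
            by (intro powr_mono2) (use \<kappa> N in \<open>auto intro: mult_left_mono\<close>)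
          also have "\<dots> \<le> Y * (1 - a)" by (rule m1)
          also have "\<dots> \<le> Y" using Y a01 by (simp add: mult_left_le)
          also have "\<dots> \<le> sup_const p" by (simp add: Y_def)
          finally show ?thesis .
        qed
        have "\<exists>u. is_minimal_solution a p (ennreal (exp (- 2 * L / a))) (fun_measure (\<lambda>x :: 'a. \<kappa> * f_eps \<epsilon> x)) u"
          by (rule f_eps_solvable[OF _ a2 _ q(2,3) L \<kappa>]) (use p q mass sup in \<open>auto simp: N_def D_def\<close>)
        moreover have "- 2 * L / a = - (C2 * K)" using a01 by (simp add: L_def)
        ultimately show ?thesis unfolding Td life_span_def by (intro Sup_upper) auto
      qed
      moreover have "T \<le> ennreal (exp (- (C1 * K)))"
      proof -
        \<comment> \<open>Compensates for the waiting time: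
          \<open>- 2 * L / a + 2 / (1 - a) = - (C * K)\<close>. The correction at most doubles the
          bracket, so the factor \<open>a / 2\<close> still gives
          \<open>L \<le> C * K\<close>.\<close>
        define L where "L = a / 2 * (C * K + 2 / (1 - a))"
        have "a / 2 * (C * K + 2 / (1 - a)) \<le> 1 / 2 * (C * K + C * K)"
          using a01 CK2 C K a\<delta> by (intro mult_mono) auto
        then have LC: "L \<le> C * K" by (simp add: L_def)
        have "1 / 4 * (C * K) \<le> a / 2 * (C * K + 2 / (1 - a))"
          using a2 C K a\<delta> by (intro mult_mono) auto
        then have "1 / 4 * (C * K) \<le> L" by (simp only: L_def)
        then have L: "3 / 2 \<le> L" using CK by linarith
        have mono: "(C * K) powr (- q) \<le> L powr (- q)" using LC L q by (intro powr_mono2') auto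
        have mass: "1 - a \<le> B * (\<kappa> * D * L powr (- q)) powr (2 / N)"
        proof -
          have "1 - a = B * D powr (2 / N) * (C powr (- q)) powr (2 / N) * (1 - a)" unfolding CB by simp
          also have "\<dots> = B * D powr (2 / N) * (\<kappa> * (C * K) powr (- q)) powr (2 / N)"
            unfolding scale by (simp only: mult_ac)
          also have "\<dots> \<le> B * D powr (2 / N) * (\<kappa> * L powr (- q)) powr (2 / N)"
            by (rule mult_left_mono[OF powr_mono2]) (use mono \<kappa> N B D in \<open>auto intro: mult_left_mono\<close>)
          also have "\<dots> = B * (\<kappa> * D * L powr (- q)) powr (2 / N)" by (simp only: powr_mult mult_ac)
          finally show ?thesis .
        qed
        have expo: "- 2 * L / a + 2 / (1 - a) = - (C * K)" using a01 by (simp add: L_def)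
        have "T' \<le> ennreal (exp (- (C * K)))" if "is_solution a p T' (fun_measure (\<lambda>x :: 'a. \<kappa> * f_eps \<epsilon> x)) u" for T' u
        proof (rule ccontr)
          assume "\<not> T' \<le> ennreal (exp (- (C * K)))"
          then have "ennreal (exp (- 2 * L / a + 2 / (1 - a))) < T'" unfolding expo by simp
          then have "\<not> is_solution a p T' (fun_measure (\<lambda>x :: 'a. \<kappa> * f_eps \<epsilon> x)) u"
            by (intro f_eps_not_solvable[OF _ a2 _ q(2) L \<kappa>]) (use p q mass in \<open>auto simp: N_def D_def B_def\<close>)
          with that show False by simp
        qed
        then have "T \<le> ennreal (exp (- (C * K)))"
          unfolding Td life_span_def by (intro Sup_least) (auto simp: is_minimal_solution_def)
        also have "\<dots> \<le> ennreal (exp (- (C1 * K)))"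
          using K by (intro ennreal_leI) (simp add: C1_def mult_right_mono)
        finally show ?thesis .
      qed
      ultimately show ?thesis ..
    qed
    then show ?thesis using \<delta> by (intro exI[of _ "max (1 / 2) (1 - \<delta>)"]) (auto simp: Let_def)
  qed
  show ?thesis
  proof (rule exI[of _ C1], rule exI[of _ C2], intro conjI allI impI)
    show "0 < C1" "C1 \<le> C2" using C C2 by (auto simp: C1_def)
  qed (rule main)
qed

section \<open>The logarithmic form of the bounds and the limit\<close>

lemma exp_neg_powr_tendsto_0:
  fixes c e :: real
  assumes "0 < c" "0 < e"
  shows "((\<lambda>x. exp (- (c * (1 - x) powr (- e)))) \<longlongrightarrow> 0) (at_left 1)"
  using assms by real_asymp

theorem theorem1p5:
  fixes N p \<epsilon> :: real and T :: "real \<Rightarrow> real \<Rightarrow> ennreal"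
  assumes N: "N = real CARD('n::finite)"
    and p: "p = 1 + 2 / N"
    and eps: "0 < \<epsilon>" "\<epsilon> < N / 2"
    and T: "\<And>\<alpha> \<kappa>. T \<alpha> \<kappa> = life_span \<alpha> p (fun_measure (\<lambda>x::real^'n. \<kappa> * f_eps \<epsilon> x))"
  shows "(\<exists>C1 C2. 0 < C1 \<and> C1 \<le> C2 \<and>
            (\<forall>\<kappa>>0. \<exists>\<alpha>0. 0 < \<alpha>0 \<and> \<alpha>0 < 1 \<and>
              (\<forall>\<alpha>. \<alpha>0 < \<alpha> \<and> \<alpha> < 1 \<longrightarrow>
                 0 < T \<alpha> \<kappa> \<and> T \<alpha> \<kappa> < \<infinity> \<and>
                 C1 * \<kappa> powr (2 / (N - 2 * \<epsilon>)) * (1 - \<alpha>) powr (- (N / (N - 2 * \<epsilon>)))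
                   \<le> - ln (enn2real (T \<alpha> \<kappa>)) \<and>
                 - ln (enn2real (T \<alpha> \<kappa>))
                   \<le> C2 * \<kappa> powr (2 / (N - 2 * \<epsilon>)) * (1 - \<alpha>) powr (- (N / (N - 2 * \<epsilon>))))))
       \<and> (\<forall>\<kappa>>0. ((\<lambda>\<alpha>. T \<alpha> \<kappa>) \<longlongrightarrow> 0) (at_left 1))"
proof -
  define q where "q = N / 2 - \<epsilon>"
  have q: "0 < q" using eps by (simp add: q_def)
  define K where "K \<alpha> \<kappa> = \<kappa> powr (2 / (N - 2 * \<epsilon>)) * (1 - \<alpha>) powr (- (N / (N - 2 * \<epsilon>)))" for \<alpha> \<kappa>
  have K_eq: "K \<alpha> \<kappa> = \<kappa> powr (1 / q) * (1 - \<alpha>) powr (- (N / (2 * q)))" for \<alpha> \<kappa>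
  proof -
    have e: "N - 2 * \<epsilon> = 2 * q" by (simp add: q_def)
    show ?thesis unfolding K_def e by simp
  qed
  have DIM: "real DIM(real^'n) = N" by (simp add: N)
  obtain C1 C2 where C: "0 < C1" "C1 \<le> C2"
    and bounds: "\<And>\<kappa>. 0 < \<kappa> \<Longrightarrow> \<exists>\<alpha>0. 0 < \<alpha>0 \<and> \<alpha>0 < 1 \<and> (\<forall>\<alpha>. \<alpha>0 < \<alpha> \<and> \<alpha> < 1 \<longrightarrow>
      ennreal (exp (- (C2 * K \<alpha> \<kappa>))) \<le> T \<alpha> \<kappa> \<and> T \<alpha> \<kappa> \<le> ennreal (exp (- (C1 * K \<alpha> \<kappa>))))"
    using life_span_bounds[where 'a = "real^'n", of p q \<epsilon>] p q eps(1) unfolding DIM T K_eq Let_def q_def by blast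
  have two_sided: "\<exists>\<alpha>0. 0 < \<alpha>0 \<and> \<alpha>0 < 1 \<and> (\<forall>\<alpha>. \<alpha>0 < \<alpha> \<and> \<alpha> < 1 \<longrightarrow>
      0 < T \<alpha> \<kappa> \<and> T \<alpha> \<kappa> < \<infinity> \<and> C1 * K \<alpha> \<kappa> \<le> - ln (enn2real (T \<alpha> \<kappa>)) \<and> - ln (enn2real (T \<alpha> \<kappa>)) \<le> C2 * K \<alpha> \<kappa>)"
    if \<kappa>: "0 < \<kappa>" for \<kappa>
  proof -
    obtain \<alpha>0 where \<alpha>0: "0 < \<alpha>0" "\<alpha>0 < 1"
      and b: "\<And>\<alpha>. \<alpha>0 < \<alpha> \<Longrightarrow> \<alpha> < 1 \<Longrightarrow> ennreal (exp (- (C2 * K \<alpha> \<kappa>))) \<le> T \<alpha> \<kappa> \<and> T \<alpha> \<kappa> \<le> ennreal (exp (- (C1 * K \<alpha> \<kappa>)))"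
      using bounds[OF \<kappa>] by blast
    have "0 < T \<alpha> \<kappa> \<and> T \<alpha> \<kappa> < \<infinity> \<and> C1 * K \<alpha> \<kappa> \<le> - ln (enn2real (T \<alpha> \<kappa>)) \<and> - ln (enn2real (T \<alpha> \<kappa>)) \<le> C2 * K \<alpha> \<kappa>"
      if "\<alpha>0 < \<alpha>" "\<alpha> < 1" for \<alpha>
    proof -
      note b' = b[OF that]
      \<comment> \<open>The bounds exclude \<open>top\<close> and 0, the two values at which
        \<open>ln (enn2real (T \<alpha> \<kappa>))\<close> would not be the logarithm of the life
        span.\<close>
      then have "T \<alpha> \<kappa> \<noteq> top" by (auto simp: top_unique)
      then obtain r where r: "T \<alpha> \<kappa> = ennreal r" "0 \<le> r" by (cases "T \<alpha> \<kappa>") auto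
      then have r2: "exp (- (C2 * K \<alpha> \<kappa>)) \<le> r" "r \<le> exp (- (C1 * K \<alpha> \<kappa>))" using b' by auto
      then have r0: "0 < r" using exp_gt_zero[of "- (C2 * K \<alpha> \<kappa>)"] by linarith
      have "- (C2 * K \<alpha> \<kappa>) \<le> ln r" using r2(1) r0 by (simp add: ln_ge_iff)
      moreover have "ln r \<le> ln (exp (- (C1 * K \<alpha> \<kappa>)))" using r2(2) r0 by (subst ln_le_cancel_iff) auto
      ultimately show ?thesis using r r0 by simp
    qed
    then show ?thesis using \<alpha>0 by blast
  qed
  have lim: "((\<lambda>\<alpha>. T \<alpha> \<kappa>) \<longlongrightarrow> 0) (at_left 1)" if \<kappa>: "0 < \<kappa>" for \<kappa>
  proof (rule tendsto_sandwich[OF _ _ tendsto_const])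
    obtain \<alpha>0 where "\<alpha>0 < 1" and b: "\<And>\<alpha>. \<alpha>0 < \<alpha> \<Longrightarrow> \<alpha> < 1 \<Longrightarrow> T \<alpha> \<kappa> \<le> ennreal (exp (- (C1 * K \<alpha> \<kappa>)))"
      using bounds[OF \<kappa>] by blast
    then show "\<forall>\<^sub>F \<alpha> in at_left 1. T \<alpha> \<kappa> \<le> ennreal (exp (- (C1 * K \<alpha> \<kappa>)))"
      by (auto simp: eventually_at_left_field)
    have e: "0 < N / (2 * q)" using q by (simp add: N)
    have "0 < C1 * \<kappa> powr (1 / q)" using C \<kappa> by simp
    then have "((\<lambda>\<alpha>. exp (- (C1 * \<kappa> powr (1 / q) * (1 - \<alpha>) powr (- (N / (2 * q)))))) \<longlongrightarrow> 0) (at_left 1)"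
      using e by (rule exp_neg_powr_tendsto_0)
    then have "((\<lambda>\<alpha>. exp (- (C1 * K \<alpha> \<kappa>))) \<longlongrightarrow> 0) (at_left 1)" by (simp add: K_eq mult.assoc)
    then show "((\<lambda>\<alpha>. ennreal (exp (- (C1 * K \<alpha> \<kappa>)))) \<longlongrightarrow> 0) (at_left 1)"
      using tendsto_ennrealI by fastforce
  qed simp
  show ?thesis
    using C two_sided lim unfolding K_def mult.assoc by blast
qed

end
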